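(* Let $A$ be a unital associative algebra over a field $k$ of characteristic zero. Then there is a natural map of long exact sequences $$\begin{array}{ccccccccc} H^{\mathrm{rel}}_{n-1}(A) & \to & HL_{n+1}(A) & \xrightarrow{(\pi_1)_*} & H^{\mathrm{Lie}}_{n+1}(A) & \to & H^{\mathrm{rel}}_{n-2}(A) & \to & \cdots\\ \downarrow{\scriptstyle \alpha_*} & & \downarrow{\scriptstyle \varphi_*} & & \downarrow{\scriptstyle \theta_*} & & \downarrow{\scriptstyle \alpha_*} & & \\ HC_{n-1}(A) & \xrightarrow{B} & HH_n(A) & \xrightarrow{I} & HC_n(A) & \xrightarrow{S} & HC_{n-2}(A) & \xrightarrow{B} & \cdots \end{array}$$ that is, all squares commute, where the top row is the long exact sequence relating Leibniz and Lie-algebra homology of $A$, the bottom row is Connes' ISB sequence, and the vertical maps $\alpha_*,\varphi_*,\theta_*$ are those defined in the context.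
   Context: $A$ is regarded as a Lie algebra via $[a,b]=ab-ba$; tensor and exterior powers are over $k$. Leibniz homology $HL_*(\mathsf g)$ of a Lie algebra $\mathsf g$ is the homology of the complex $CL_*(\mathsf g)$ with $CL_n(\mathsf g)=\mathsf g^{\otimes n}$ ($n\ge 0$) and $$d(g_1,\ldots,g_n)=\sum_{1\le i<j\le n}(-1)^j(g_1,\ldots,g_{i-1},[g_i,g_j],g_{i+1},\ldots,\hat g_j,\ldots,g_n).$$ Lie-algebra homology $H^{\mathrm{Lie}}_*(\mathsf g)$ is the homology of $\Lambda^*(\mathsf g)$, with $\mathsf g^{\wedge n}$ in degree $n$ and $d$ given by the same formula with exterior powers in place of tensor powers. The canonical projection $\pi_1:\mathsf g^{\otimes n}\to\mathsf g^{\wedge n}$ is a chain map. $(\ker\pi_1)_*[2]$ is the complex with $(\ker\pi_1)_n[2]=\ker[\mathsf g^{\otimes(n+2)}\to\mathsf g^{\wedge(n+2)}]$, and $H^{\mathrm{rel}}_*(\mathsf g)$ is its homology. The short exact sequence $0\to(\ker\pi_1)_*[2]\to CL_*(\mathsf g)\to\Lambda^*(\mathsf g)\to 0$ induces the long exact sequence $\cdots\to H^{\mathrm{rel}}_{n-2}(\mathsf g)\to HL_n(\mathsf g)\to H^{\mathrm{Lie}}_n(\mathsf g)\to H^{\mathrm{rel}}_{n-3}(\mathsf g)\to\cdots$. $CHH_n(A)=A^{\otimes(n+1)}$ ($n\ge 0$) with the Hochschild boundary $b(a_0,\ldots,a_n)=\sum_{i=0}^{n-1}(-1)^i(a_0,\ldots,a_ia_{i+1},\ldots,a_n)+(-1)^n(a_na_0,a_1,\ldots,a_{n-1})$;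 its homology is $HH_*(A)$. With $t(a_0,\ldots,a_n)=(-1)^n(a_n,a_0,\ldots,a_{n-1})$, $C^\lambda_n(A)=A^{\otimes(n+1)}/\operatorname{Im}(1-t)$ with the boundary induced by $b$, and $HC_*(A)$ is its homology. $\pi_2:CHH_*(A)\to C^\lambda_*(A)$ is the projection and $I=(\pi_2)_*$. One has $H_n((\ker\pi_2)_* )\cong HC_{n-1}(A)$, the isomorphism $HC_{n-1}(A)\to H_n((\ker \pi_2)_* )$ being induced by Connes' operator $x\mapsto(1-t)sNx$, where $N=\sum_i t^i$ and $s(a_0,\ldots,a_m)=(1,a_0,\ldots,a_m)$. Under this identification the long exact sequence of $0\to(\ker\pi_2)_*\to CHH_*(A)\to C^\lambda_*(A)\to0$ is Connes' sequence $\cdots\to HC_{n-1}(A)\xrightarrow{B}HH_n(A)\xrightarrow{I}HC_n(A)\xrightarrow{S}HC_{n-2}(A)\to\cdots$. The chain maps $\theta:\Lambda^{*+1}(A)\to C^\lambda_*(A)$ and $\varphi:CL_{*+1}(A)\to CHH_*(A)$ are $$\theta(a_0\wedge a_1\wedge\cdots\wedge a_n)=\sum_{\sigma\in S_n}(\operatorname{sgn}\sigma)(a_0,a_{\sigma^{-1}(1)},\ldots,a_{\sigma^{-1}(n)}),$$ $$\varphi(a_0,a_1,\ldots,a_n)=\sum_{\sigma\in S_n}(\operatorname{sgn}\sigma)(a_0,a_{\sigma^{-1}(1)},\ldots,a_{\sigma^{-1}(n)}),$$ inducing $\theta_*:H^{\mathrm{Lie}}_{*+1}(A)\to HC_*(A)$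 and $\varphi_*:HL_{*+1}(A)\to HH_*(A)$. The chain map $\alpha:(\ker\pi_1)_{*+1}[2]\to(\ker\pi_2)_*$ (up to the evident index shift) is the restriction of $\varphi$ to $\ker\pi_1\subset A^{\otimes(n+1)}$, inducing $\alpha_*:H^{\mathrm{rel}}_{n-1}(A)\to H_n((\ker\pi_2)_* )\cong HC_{n-1}(A)$. *)

theory Defs
  imports
    Complex_Main
    "HOL-Algebra.Module"
    "HOL-Algebra.AbelCoset"
    "HOL-Combinatorics.Permutations"
    "HOL-Library.Poly_Mapping"
begin

section \<open>Unital associative algebras\<close>

text \<open>The sort \<open>{ring, monoid_mult}\<close> is used instead of \<^class>\<open>ring_1\<close> because the latter
  excludes the zero algebra.\<close>

locale unital_algebra = vector_space scale
  for scale :: "'k::field \<Rightarrow> 'a::{ring,monoid_mult} \<Rightarrow> 'a" +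
  assumes scale_mult_left: "scale c x * y = scale c (x * y)"
    and scale_mult_right: "x * scale c y = scale c (x * y)"

definition unital_algebra_hom ::
  "('k::field \<Rightarrow> 'a::{ring,monoid_mult} \<Rightarrow> 'a) \<Rightarrow> ('k \<Rightarrow> 'b::{ring,monoid_mult} \<Rightarrow> 'b) \<Rightarrow> ('a \<Rightarrow> 'b) \<Rightarrow> bool"
  where "unital_algebra_hom sc sc' f \<longleftrightarrow>
    Vector_Spaces.linear sc sc' f \<and> (\<forall>x y. f (x * y) = f x * f y) \<and> f 1 = 1"

definition bracket :: "'a::ring \<Rightarrow> 'a \<Rightarrow> 'a"
  where "bracket a b = a * b - b * a"


section \<open>Linear algebra with carriers\<close>

text \<open>Vector spaces over the field type \<^typ>\<open>'k\<close> are \<^locale>\<open>Module.module\<close> records over the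
  ring below; the multiplicative fields of the records are irrelevant.\<close>

definition scalar_ring :: "'k::field ring"
  where "scalar_ring = \<lparr>carrier = UNIV, monoid.mult = (*), one = 1, zero = 0, add = (+)\<rparr>"

definition linear_maps :: "('k, 'm) module \<Rightarrow> ('k, 'n) module \<Rightarrow> ('m \<Rightarrow> 'n) set"
  where "linear_maps M N = {f. f \<in> carrier M \<rightarrow> carrier N
    \<and> (\<forall>x\<in>carrier M. \<forall>y\<in>carrier M. f (x \<oplus>\<^bsub>M\<^esub> y) = f x \<oplus>\<^bsub>N\<^esub> f y)
    \<and> (\<forall>c. \<forall>x\<in>carrier M. f (c \<odot>\<^bsub>M\<^esub> x) = c \<odot>\<^bsub>N\<^esub> f x)}"

definition quot_module :: "('k, 'm) module \<Rightarrow> 'm set \<Rightarrow> ('k, 'm set) module"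
  where "quot_module M N =
    \<lparr>carrier = a_rcosets\<^bsub>M\<^esub> N, monoid.mult = undefined, one = undefined, zero = N, add = set_add M,
     smult = (\<lambda>c S. \<Union>x\<in>S. N +>\<^bsub>M\<^esub> (c \<odot>\<^bsub>M\<^esub> x))\<rparr>"

text \<open>The map that \<open>f\<close> induces on cosets, provided that \<open>f\<close> is constant on them.\<close>

definition descend :: "('m \<Rightarrow> 'n) \<Rightarrow> 'm set \<Rightarrow> 'n"
  where "descend f S = the_elem (f ` S)"

text \<open>The map into the quotient of \<open>M\<close> by \<open>N\<close> induced on cosets by a map \<open>f\<close> into \<open>M\<close>.\<close>

definition induced :: "('k, 'n) module \<Rightarrow> 'n set \<Rightarrow> ('m \<Rightarrow> 'n) \<Rightarrow> 'm set \<Rightarrow> 'n set"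
  where "induced M N f = descend (\<lambda>x. N +>\<^bsub>M\<^esub> f x)"


section \<open>Complexes, homology, long exact sequences\<close>

text \<open>Complexes are indexed by \<^typ>\<open>int\<close>; \<open>bd C n\<close> maps degree \<open>n\<close> to degree \<open>n - 1\<close>.\<close>

record ('k, 'm) chain_cx =
  chain :: "int \<Rightarrow> ('k, 'm) module"
  bd :: "int \<Rightarrow> 'm \<Rightarrow> 'm"

text \<open>Extension by zero to negative degrees; \<open>D k\<close> maps \<open>M (Suc k)\<close> to \<open>M k\<close>.\<close>

definition nonneg_cx :: "(nat \<Rightarrow> ('k, 'm) module) \<Rightarrow> (nat \<Rightarrow> 'm \<Rightarrow> 'm) \<Rightarrow> ('k, 'm) chain_cx"
  where "nonneg_cx M D =
    \<lparr>chain = (\<lambda>n. if n < 0 then (M 0)\<lparr>carrier := {\<zero>\<^bsub>M 0\<^esub>}\<rparr> else M (nat n)),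
     bd = (\<lambda>n. if n \<le> 0 then (\<lambda>_. \<zero>\<^bsub>M 0\<^esub>) else D (nat (n - 1)))\<rparr>"

definition shift_cx :: "int \<Rightarrow> ('k, 'm) chain_cx \<Rightarrow> ('k, 'm) chain_cx"
  where "shift_cx p C = \<lparr>chain = (\<lambda>n. chain C (n + p)), bd = (\<lambda>n. bd C (n + p))\<rparr>"

definition ker_cx ::
  "('k, 'm) chain_cx \<Rightarrow> ('k, 'n) chain_cx \<Rightarrow> (int \<Rightarrow> 'm \<Rightarrow> 'n) \<Rightarrow> ('k, 'm) chain_cx"
  where "ker_cx C D p =
    \<lparr>chain = (\<lambda>n. (chain C n)\<lparr>carrier := a_kernel (chain C n) (chain D n) (p n)\<rparr>), bd = bd C\<rparr>"

definition cycles :: "('k, 'm) chain_cx \<Rightarrow> int \<Rightarrow> 'm set"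
  where "cycles C n = a_kernel (chain C n) (chain C (n - 1)) (bd C n)"

definition boundaries :: "('k, 'm) chain_cx \<Rightarrow> int \<Rightarrow> 'm set"
  where "boundaries C n = bd C (n + 1) ` carrier (chain C (n + 1))"

definition homology :: "('k, 'm) chain_cx \<Rightarrow> int \<Rightarrow> ('k, 'm set) module"
  where "homology C n = quot_module ((chain C n)\<lparr>carrier := cycles C n\<rparr>) (boundaries C n)"

definition hom_class :: "('k, 'm) chain_cx \<Rightarrow> int \<Rightarrow> 'm \<Rightarrow> 'm set"
  where "hom_class C n x = boundaries C n +>\<^bsub>chain C n\<^esub> x"

text \<open>The map into \<open>homology D n\<close> induced by a map of chains into \<open>chain D n\<close>.\<close>

definition hom_map :: "('k, 'n) chain_cx \<Rightarrow> int \<Rightarrow> ('m \<Rightarrow> 'n) \<Rightarrow> 'm set \<Rightarrow> 'n set"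
  where "hom_map D n f = descend (\<lambda>x. hom_class D n (f x))"

text \<open>For a surjective chain map \<open>p\<close> from \<open>C\<close> to \<open>D\<close> with kernel \<open>K\<close>: lift a cycle in the class \<open>z\<close> to
  \<open>C\<close> and take its boundary, which lies in \<open>K\<close>.\<close>

definition connecting ::
  "('k, 'm) chain_cx \<Rightarrow> ('k, 'n) chain_cx \<Rightarrow> (int \<Rightarrow> 'm \<Rightarrow> 'n) \<Rightarrow> int \<Rightarrow> 'n set \<Rightarrow> 'm set"
  where "connecting C D p n z =
    the_elem ((\<lambda>c. hom_class (ker_cx C D p) (n - 1) (bd C n c))
      ` {c \<in> carrier (chain C n). p n c \<in> z})"

text \<open>Sequences \<open>\<dots> \<rightarrow> X n \<rightarrow> Y n \<rightarrow> Z n \<rightarrow> X (n - 1) \<rightarrow> \<dots>\<close>\<close>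

record ('k, 'x, 'y, 'z) les =
  X_les :: "int \<Rightarrow> ('k, 'x) module"
  Y_les :: "int \<Rightarrow> ('k, 'y) module"
  Z_les :: "int \<Rightarrow> ('k, 'z) module"
  XY_les :: "int \<Rightarrow> 'x \<Rightarrow> 'y"
  YZ_les :: "int \<Rightarrow> 'y \<Rightarrow> 'z"
  ZX_les :: "int \<Rightarrow> 'z \<Rightarrow> 'x"

definition is_les :: "('k::field, 'x, 'y, 'z) les \<Rightarrow> bool"
  where "is_les L \<longleftrightarrow> (\<forall>n.
      Module.module scalar_ring (X_les L n)
    \<and> Module.module scalar_ring (Y_les L n)
    \<and> Module.module scalar_ring (Z_les L n)
    \<and> XY_les L n \<in> linear_maps (X_les L n) (Y_les L n)
    \<and> YZ_les L n \<in> linear_maps (Y_les L n) (Z_les L n)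
    \<and> ZX_les L n \<in> linear_maps (Z_les L n) (X_les L (n - 1))
    \<and> XY_les L n ` carrier (X_les L n) = a_kernel (Y_les L n) (Z_les L n) (YZ_les L n)
    \<and> YZ_les L n ` carrier (Y_les L n) = a_kernel (Z_les L n) (X_les L (n - 1)) (ZX_les L n)
    \<and> ZX_les L n ` carrier (Z_les L n) =
        a_kernel (X_les L (n - 1)) (Y_les L (n - 1)) (XY_les L (n - 1)))"

definition is_les_map ::
  "('k::field, 'x, 'y, 'z) les \<Rightarrow> ('k, 'u, 'v, 'w) les
    \<Rightarrow> (int \<Rightarrow> 'x \<Rightarrow> 'u) \<Rightarrow> (int \<Rightarrow> 'y \<Rightarrow> 'v) \<Rightarrow> (int \<Rightarrow> 'z \<Rightarrow> 'w) \<Rightarrow> bool"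
  where "is_les_map L L' \<alpha> \<phi> \<theta> \<longleftrightarrow> (\<forall>n.
      \<alpha> n \<in> linear_maps (X_les L n) (X_les L' n)
    \<and> \<phi> n \<in> linear_maps (Y_les L n) (Y_les L' n)
    \<and> \<theta> n \<in> linear_maps (Z_les L n) (Z_les L' n)
    \<and> (\<forall>x\<in>carrier (X_les L n). \<phi> n (XY_les L n x) = XY_les L' n (\<alpha> n x))
    \<and> (\<forall>y\<in>carrier (Y_les L n). \<theta> n (YZ_les L n y) = YZ_les L' n (\<phi> n y))
    \<and> (\<forall>z\<in>carrier (Z_les L n). \<alpha> (n - 1) (ZX_les L n z) = ZX_les L' n (\<theta> n z)))"


section \<open>Tensor and exterior powers\<close>

text \<open>\<open>'a list \<Rightarrow>\<^sub>0 'k\<close> is the free vector space on words, and the word \<open>[a\<^sub>1, \<dots>, a\<^sub>n]\<close> represents the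
  pure tensor \<open>(a\<^sub>1, \<dots>, a\<^sub>n)\<close>.\<close>

definition fscale :: "'k::field \<Rightarrow> ('w \<Rightarrow>\<^sub>0 'k) \<Rightarrow> 'w \<Rightarrow>\<^sub>0 'k"
  where "fscale c = Poly_Mapping.map ((*) c)"

definition fword :: "'w \<Rightarrow> 'w \<Rightarrow>\<^sub>0 'k::field"
  where "fword w = Poly_Mapping.single w 1"

definition lin_ext :: "('v \<Rightarrow> 'w \<Rightarrow>\<^sub>0 'k) \<Rightarrow> ('v \<Rightarrow>\<^sub>0 'k::field) \<Rightarrow> 'w \<Rightarrow>\<^sub>0 'k"
  where "lin_ext f x = (\<Sum>w\<in>Poly_Mapping.keys x. fscale (Poly_Mapping.lookup x w) (f w))"

definition word_module :: "nat \<Rightarrow> ('k::field, 'a list \<Rightarrow>\<^sub>0 'k) module"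
  where "word_module n =
    \<lparr>carrier = {x. \<forall>w\<in>Poly_Mapping.keys x. length w = n}, monoid.mult = undefined, one = undefined,
     zero = 0, add = (+), smult = fscale\<rparr>"

definition tensor_rel :: "('k::field \<Rightarrow> 'a::ab_group_add \<Rightarrow> 'a) \<Rightarrow> nat \<Rightarrow> ('a list \<Rightarrow>\<^sub>0 'k) set"
  where "tensor_rel sc n = Modules.module.span fscale
    ({fword (u @ [a + b] @ v) - fword (u @ [a] @ v) - fword (u @ [b] @ v) | u v a b.
        length u + 1 + length v = n}
   \<union> {fword (u @ [sc c a] @ v) - fscale c (fword (u @ [a] @ v)) | u v a c.
        length u + 1 + length v = n})"

type_synonym ('a, 'k) tensor = "('a list \<Rightarrow>\<^sub>0 'k) set"

definition tensor_power ::
  "('k::field \<Rightarrow> 'a::ab_group_add \<Rightarrow> 'a) \<Rightarrow> nat \<Rightarrow> ('k, ('a, 'k) tensor) module"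
  where "tensor_power sc n = quot_module (word_module n) (tensor_rel sc n)"

text \<open>The map into the \<open>n\<close>-th tensor power that is given on pure tensors by the formula \<open>f\<close>.\<close>

definition tensor_map ::
  "('k::field \<Rightarrow> 'b::ab_group_add \<Rightarrow> 'b) \<Rightarrow> nat \<Rightarrow> ('a list \<Rightarrow> 'b list \<Rightarrow>\<^sub>0 'k)
    \<Rightarrow> ('a, 'k) tensor \<Rightarrow> ('b, 'k) tensor"
  where "tensor_map sc n f = induced (word_module n) (tensor_rel sc n) (lin_ext f)"

definition alt_rel ::
  "('k::field \<Rightarrow> 'a::ab_group_add \<Rightarrow> 'a) \<Rightarrow> nat \<Rightarrow> ('a, 'k) tensor set"
  where "alt_rel sc n = (\<lambda>x. tensor_rel sc n +>\<^bsub>word_module n\<^esub> x)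
    ` Modules.module.span fscale {fword w | w. length w = n \<and> \<not> distinct w}"

definition ext_power ::
  "('k::field \<Rightarrow> 'a::ab_group_add \<Rightarrow> 'a) \<Rightarrow> nat \<Rightarrow> ('k, ('a, 'k) tensor set) module"
  where "ext_power sc n = quot_module (tensor_power sc n) (alt_rel sc n)"


section \<open>Leibniz and Lie algebra homology\<close>

text \<open>Positions in words are counted from 0, which turns the sign \<open>(-1)\<^sup>j\<close> of the usual formula into
  \<open>(-1) ^ Suc j\<close>.\<close>

definition leibniz_word :: "'a::ring list \<Rightarrow> 'a list \<Rightarrow>\<^sub>0 'k::field"
  where "leibniz_word w = (\<Sum>j<length w. \<Sum>i<j.
    fscale ((- 1) ^ Suc j) (fword (take j (w[i := bracket (w ! i) (w ! j)]) @ drop (Suc j) w)))"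

definition leibniz_bd :: "('k::field \<Rightarrow> 'a::ring \<Rightarrow> 'a) \<Rightarrow> nat \<Rightarrow> ('a, 'k) tensor \<Rightarrow> ('a, 'k) tensor"
  where "leibniz_bd sc n = tensor_map sc n leibniz_word"

definition CL_cx :: "('k::field \<Rightarrow> 'a::ring \<Rightarrow> 'a) \<Rightarrow> ('k, ('a, 'k) tensor) chain_cx"
  where "CL_cx sc = nonneg_cx (tensor_power sc) (leibniz_bd sc)"

definition Lie_cx :: "('k::field \<Rightarrow> 'a::ring \<Rightarrow> 'a) \<Rightarrow> ('k, ('a, 'k) tensor set) chain_cx"
  where "Lie_cx sc = nonneg_cx (ext_power sc)
    (\<lambda>n. induced (tensor_power sc n) (alt_rel sc n) (leibniz_bd sc n))"

definition pi1 :: "('k::field \<Rightarrow> 'a::ring \<Rightarrow> 'a) \<Rightarrow> int \<Rightarrow> ('a, 'k) tensor \<Rightarrow> ('a, 'k) tensor set"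
  where "pi1 sc n x = alt_rel sc (nat n) +>\<^bsub>tensor_power sc (nat n)\<^esub> x"

definition rel_cx :: "('k::field \<Rightarrow> 'a::ring \<Rightarrow> 'a) \<Rightarrow> ('k, ('a, 'k) tensor) chain_cx"
  where "rel_cx sc = shift_cx 2 (ker_cx (CL_cx sc) (Lie_cx sc) (pi1 sc))"

definition HL :: "('k::field \<Rightarrow> 'a::ring \<Rightarrow> 'a) \<Rightarrow> int \<Rightarrow> ('k, ('a, 'k) tensor set) module"
  where "HL sc = homology (CL_cx sc)"

definition HLie :: "('k::field \<Rightarrow> 'a::ring \<Rightarrow> 'a) \<Rightarrow> int \<Rightarrow> ('k, ('a, 'k) tensor set set) module"
  where "HLie sc = homology (Lie_cx sc)"

definition Hrel :: "('k::field \<Rightarrow> 'a::ring \<Rightarrow> 'a) \<Rightarrow> int \<Rightarrow> ('k, ('a, 'k) tensor set) module"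
  where "Hrel sc = homology (rel_cx sc)"

text \<open>\<open>Hrel (n - 1) \<rightarrow> HL (n + 1) \<rightarrow> HLie (n + 1) \<rightarrow> Hrel (n - 2)\<close>\<close>

definition leibniz_les :: "('k::field \<Rightarrow> 'a::ring \<Rightarrow> 'a)
    \<Rightarrow> ('k, ('a, 'k) tensor set, ('a, 'k) tensor set, ('a, 'k) tensor set set) les"
  where "leibniz_les sc =
    \<lparr>X_les = (\<lambda>n. Hrel sc (n - 1)), Y_les = (\<lambda>n. HL sc (n + 1)), Z_les = (\<lambda>n. HLie sc (n + 1)),
     XY_les = (\<lambda>n. hom_map (CL_cx sc) (n + 1) (\<lambda>x. x)),
     YZ_les = (\<lambda>n. hom_map (Lie_cx sc) (n + 1) (pi1 sc (n + 1))),
     ZX_les = (\<lambda>n. connecting (CL_cx sc) (Lie_cx sc) (pi1 sc) (n + 1))\<rparr>"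


section \<open>Hochschild and cyclic homology\<close>

text \<open>All operators below are indexed by the length of the tensors they produce.\<close>

definition hochschild_word :: "'a::ring list \<Rightarrow> 'a list \<Rightarrow>\<^sub>0 'k::field"
  where "hochschild_word w = (let n = length w - 1 in
    (\<Sum>i<n. fscale ((- 1) ^ i) (fword (take i w @ [w ! i * w ! Suc i] @ drop (i + 2) w)))
    + fscale ((- 1) ^ n) (fword ((last w * hd w) # tl (butlast w))))"

definition hochschild_bd ::
  "('k::field \<Rightarrow> 'a::ring \<Rightarrow> 'a) \<Rightarrow> nat \<Rightarrow> ('a, 'k) tensor \<Rightarrow> ('a, 'k) tensor"
  where "hochschild_bd sc n = tensor_map sc n hochschild_word"

definition cyc_op :: "('k::field \<Rightarrow> 'a::ring \<Rightarrow> 'a) \<Rightarrow> nat \<Rightarrow> ('a, 'k) tensor \<Rightarrow> ('a, 'k) tensor"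
  where "cyc_op sc n =
    tensor_map sc n (\<lambda>w. fscale ((- 1) ^ (length w - 1)) (fword (last w # butlast w)))"

definition one_minus_cyc ::
  "('k::field \<Rightarrow> 'a::ring \<Rightarrow> 'a) \<Rightarrow> nat \<Rightarrow> ('a, 'k) tensor \<Rightarrow> ('a, 'k) tensor"
  where "one_minus_cyc sc n x = x \<ominus>\<^bsub>tensor_power sc n\<^esub> cyc_op sc n x"

definition norm_op :: "('k::field \<Rightarrow> 'a::ring \<Rightarrow> 'a) \<Rightarrow> nat \<Rightarrow> ('a, 'k) tensor \<Rightarrow> ('a, 'k) tensor"
  where "norm_op sc n x = (\<Oplus>\<^bsub>tensor_power sc n\<^esub> i\<in>{..<n}. (cyc_op sc n ^^ i) x)"

definition unit_op ::
  "('k::field \<Rightarrow> 'a::{ring,monoid_mult} \<Rightarrow> 'a) \<Rightarrow> nat \<Rightarrow> ('a, 'k) tensor \<Rightarrow> ('a, 'k) tensor"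
  where "unit_op sc n = tensor_map sc n (\<lambda>w. fword (1 # w))"

definition cyc_rel :: "('k::field \<Rightarrow> 'a::ring \<Rightarrow> 'a) \<Rightarrow> nat \<Rightarrow> ('a, 'k) tensor set"
  where "cyc_rel sc n = one_minus_cyc sc n ` carrier (tensor_power sc n)"

definition CHH_cx :: "('k::field \<Rightarrow> 'a::ring \<Rightarrow> 'a) \<Rightarrow> ('k, ('a, 'k) tensor) chain_cx"
  where "CHH_cx sc = nonneg_cx (\<lambda>n. tensor_power sc (n + 1)) (\<lambda>n. hochschild_bd sc (n + 1))"

definition cyclic_cx :: "('k::field \<Rightarrow> 'a::ring \<Rightarrow> 'a) \<Rightarrow> ('k, ('a, 'k) tensor set) chain_cx"
  where "cyclic_cx sc = nonneg_cx
    (\<lambda>n. quot_module (tensor_power sc (n + 1)) (cyc_rel sc (n + 1)))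
    (\<lambda>n. induced (tensor_power sc (n + 1)) (cyc_rel sc (n + 1)) (hochschild_bd sc (n + 1)))"

definition pi2 :: "('k::field \<Rightarrow> 'a::ring \<Rightarrow> 'a) \<Rightarrow> int \<Rightarrow> ('a, 'k) tensor \<Rightarrow> ('a, 'k) tensor set"
  where "pi2 sc n x = cyc_rel sc (nat n + 1) +>\<^bsub>tensor_power sc (nat n + 1)\<^esub> x"

definition ker_pi2_cx :: "('k::field \<Rightarrow> 'a::ring \<Rightarrow> 'a) \<Rightarrow> ('k, ('a, 'k) tensor) chain_cx"
  where "ker_pi2_cx sc = ker_cx (CHH_cx sc) (cyclic_cx sc) (pi2 sc)"

definition HH :: "('k::field \<Rightarrow> 'a::ring \<Rightarrow> 'a) \<Rightarrow> int \<Rightarrow> ('k, ('a, 'k) tensor set) module"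
  where "HH sc = homology (CHH_cx sc)"

definition HC :: "('k::field \<Rightarrow> 'a::ring \<Rightarrow> 'a) \<Rightarrow> int \<Rightarrow> ('k, ('a, 'k) tensor set set) module"
  where "HC sc = homology (cyclic_cx sc)"

text \<open>Connes' operator \<open>x \<mapsto> (1 - t) s N x\<close> from the cyclic chains of degree \<open>n - 1\<close>, which are classes of
  tensors of length \<open>n\<close>, to the kernel of \<^const>\<open>pi2\<close> in degree \<open>n\<close>. It vanishes for \<open>n \<le> 0\<close>, where its
  source is zero.\<close>

definition connes_op ::
  "('k::field \<Rightarrow> 'a::{ring,monoid_mult} \<Rightarrow> 'a) \<Rightarrow> int \<Rightarrow> ('a, 'k) tensor set \<Rightarrow> ('a, 'k) tensor"
  where "connes_op sc n =
    (if n \<le> 0 then (\<lambda>_. \<zero>\<^bsub>tensor_power sc 1\<^esub>)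
     else descend (\<lambda>x. one_minus_cyc sc (nat n + 1) (unit_op sc (nat n + 1) (norm_op sc (nat n) x))))"

text \<open>The isomorphism from \<open>HC (n - 1)\<close> to the \<open>n\<close>-th homology of the kernel of \<^const>\<open>pi2\<close>, and its
  inverse.\<close>

definition connes_iso :: "('k::field \<Rightarrow> 'a::{ring,monoid_mult} \<Rightarrow> 'a) \<Rightarrow> int
    \<Rightarrow> ('a, 'k) tensor set set \<Rightarrow> ('a, 'k) tensor set"
  where "connes_iso sc n = hom_map (ker_pi2_cx sc) n (connes_op sc n)"

definition connes_iso_inv :: "('k::field \<Rightarrow> 'a::{ring,monoid_mult} \<Rightarrow> 'a) \<Rightarrow> int
    \<Rightarrow> ('a, 'k) tensor set \<Rightarrow> ('a, 'k) tensor set set"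
  where "connes_iso_inv sc n = inv_into (carrier (HC sc (n - 1))) (connes_iso sc n)"

text \<open>\<open>HC (n - 1) \<rightarrow> HH n \<rightarrow> HC n \<rightarrow> HC (n - 2)\<close>, with the maps \<open>B\<close>, \<open>I\<close>, \<open>S\<close>\<close>

definition connes_les :: "('k::field \<Rightarrow> 'a::{ring,monoid_mult} \<Rightarrow> 'a)
    \<Rightarrow> ('k, ('a, 'k) tensor set set, ('a, 'k) tensor set, ('a, 'k) tensor set set) les"
  where "connes_les sc =
    \<lparr>X_les = (\<lambda>n. HC sc (n - 1)), Y_les = HH sc, Z_les = HC sc,
     XY_les = (\<lambda>n. hom_map (CHH_cx sc) n (\<lambda>x. x) \<circ> connes_iso sc n),
     YZ_les = (\<lambda>n. hom_map (cyclic_cx sc) n (pi2 sc n)),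
     ZX_les = (\<lambda>n. connes_iso_inv sc (n - 1) \<circ> connecting (CHH_cx sc) (cyclic_cx sc) (pi2 sc) n)\<rparr>"


section \<open>The vertical maps\<close>

text \<open>Position 0 is fixed, and \<open>permute_list (inv_into UNIV \<sigma>) (a\<^sub>0, \<dots>, a\<^sub>n)\<close> has the entry \<open>a\<^bsub>\<sigma>\<^sup>-\<^sup>1(i)\<^esub>\<close> at position \<open>i\<close>.\<close>

definition antisym_word :: "'a list \<Rightarrow> 'a list \<Rightarrow>\<^sub>0 'k::field"
  where "antisym_word w = (\<Sum>\<sigma> | \<sigma> permutes {1..<length w}.
    fscale (of_int (sign \<sigma>)) (fword (permute_list (inv_into UNIV \<sigma>) w)))"

text \<open>In degrees \<open>n < 0\<close> the chain maps have target zero.\<close>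

definition phi :: "('k::field \<Rightarrow> 'a::ring \<Rightarrow> 'a) \<Rightarrow> int \<Rightarrow> ('a, 'k) tensor \<Rightarrow> ('a, 'k) tensor"
  where "phi sc n = (if n < 0 then (\<lambda>_. \<zero>\<^bsub>chain (CHH_cx sc) n\<^esub>)
    else tensor_map sc (nat n + 1) antisym_word)"

definition theta ::
  "('k::field \<Rightarrow> 'a::ring \<Rightarrow> 'a) \<Rightarrow> int \<Rightarrow> ('a, 'k) tensor set \<Rightarrow> ('a, 'k) tensor set"
  where "theta sc n = (if n < 0 then (\<lambda>_. \<zero>\<^bsub>chain (cyclic_cx sc) n\<^esub>)
    else induced (tensor_power sc (nat n + 1)) (cyc_rel sc (nat n + 1))
      (tensor_map sc (nat n + 1) antisym_word))"

definition phi_star ::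
  "('k::field \<Rightarrow> 'a::ring \<Rightarrow> 'a) \<Rightarrow> int \<Rightarrow> ('a, 'k) tensor set \<Rightarrow> ('a, 'k) tensor set"
  where "phi_star sc n = hom_map (CHH_cx sc) n (phi sc n)"

definition theta_star ::
  "('k::field \<Rightarrow> 'a::ring \<Rightarrow> 'a) \<Rightarrow> int \<Rightarrow> ('a, 'k) tensor set set \<Rightarrow> ('a, 'k) tensor set set"
  where "theta_star sc n = hom_map (cyclic_cx sc) n (theta sc n)"

definition alpha_star :: "('k::field \<Rightarrow> 'a::{ring,monoid_mult} \<Rightarrow> 'a) \<Rightarrow> int
    \<Rightarrow> ('a, 'k) tensor set \<Rightarrow> ('a, 'k) tensor set set"
  where "alpha_star sc n = connes_iso_inv sc n \<circ> hom_map (ker_pi2_cx sc) n (phi sc n)"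


section \<open>Functoriality in the algebra\<close>

text \<open>Maps induced by \<open>f\<close>; \<open>sc\<close> is the scalar multiplication of the target algebra.\<close>

definition tensor_fun :: "('k::field \<Rightarrow> 'b::ring \<Rightarrow> 'b) \<Rightarrow> ('a::ring \<Rightarrow> 'b) \<Rightarrow> nat
    \<Rightarrow> ('a, 'k) tensor \<Rightarrow> ('b, 'k) tensor"
  where "tensor_fun sc f n = tensor_map sc n (\<lambda>w. fword (map f w))"

definition HL_fun :: "('k::field \<Rightarrow> 'b::ring \<Rightarrow> 'b) \<Rightarrow> ('a::ring \<Rightarrow> 'b) \<Rightarrow> int
    \<Rightarrow> ('a, 'k) tensor set \<Rightarrow> ('b, 'k) tensor set"
  where "HL_fun sc f n = hom_map (CL_cx sc) n (tensor_fun sc f (nat n))"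

definition HLie_fun :: "('k::field \<Rightarrow> 'b::ring \<Rightarrow> 'b) \<Rightarrow> ('a::ring \<Rightarrow> 'b) \<Rightarrow> int
    \<Rightarrow> ('a, 'k) tensor set set \<Rightarrow> ('b, 'k) tensor set set"
  where "HLie_fun sc f n = hom_map (Lie_cx sc) n
    (induced (tensor_power sc (nat n)) (alt_rel sc (nat n)) (tensor_fun sc f (nat n)))"

definition Hrel_fun :: "('k::field \<Rightarrow> 'b::ring \<Rightarrow> 'b) \<Rightarrow> ('a::ring \<Rightarrow> 'b) \<Rightarrow> int
    \<Rightarrow> ('a, 'k) tensor set \<Rightarrow> ('b, 'k) tensor set"
  where "Hrel_fun sc f n = hom_map (rel_cx sc) n (tensor_fun sc f (nat (n + 2)))"

definition HH_fun :: "('k::field \<Rightarrow> 'b::ring \<Rightarrow> 'b) \<Rightarrow> ('a::ring \<Rightarrow> 'b) \<Rightarrow> int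
    \<Rightarrow> ('a, 'k) tensor set \<Rightarrow> ('b, 'k) tensor set"
  where "HH_fun sc f n = hom_map (CHH_cx sc) n (tensor_fun sc f (nat n + 1))"

definition HC_fun :: "('k::field \<Rightarrow> 'b::ring \<Rightarrow> 'b) \<Rightarrow> ('a::ring \<Rightarrow> 'b) \<Rightarrow> int
    \<Rightarrow> ('a, 'k) tensor set set \<Rightarrow> ('b, 'k) tensor set set"
  where "HC_fun sc f n = hom_map (cyclic_cx sc) n
    (induced (tensor_power sc (nat n + 1)) (cyc_rel sc (nat n + 1)) (tensor_fun sc f (nat n + 1)))"

end

theory Submission
  imports Defs
begin

text \<open>Both rows are long exact homology sequences of short exact sequences of complexes. The upper one
  belongs to the projection of the Leibniz complex onto the exterior powers. The lower one belongs to the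
  projection of the Hochschild complex onto its quotient by the image of \<open>1 - t\<close>, and cyclic homology is put
  in the place of the homology of the kernel along Connes' isomorphism. Antisymmetrization \<open>\<phi>\<close> is a map of
  short exact sequences, and such a map induces a map of long exact sequences. So three things have to be
  shown: \<open>\<phi>\<close> is a chain map, it sends tensors with a repeated letter into the image of \<open>1 - t\<close>, and Connes'
  operator induces an isomorphism. All of them rest on identities between formulas on words, which hold
  in the free vector space on words, some exactly and some modulo the tensor relations.

  For a letter \<open>x\<close> let \<open>ad x\<close> be the action of \<open>x\<close> on tensors by the bracket. By \<open>leibniz_word_snoc\<close>, the
  Leibniz boundary satisfies \<open>d (w x) = (d w) x \<plusminus> ad x w\<close>. Together with \<open>leib_ad_word\<close>, which says that \<open>d\<close>
  commutes with \<open>ad x\<close> by the Jacobi identity, this gives \<open>d (d w) = 0\<close>. On the other side, by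
  \<open>antisym_word_snoc\<close>, \<open>\<phi> (w x)\<close> arises from \<open>\<phi> w\<close> by the signed insertion \<open>i x\<close> of the letter \<open>x\<close> at all
  positions behind the first letter. The insertion is a homotopy, \<open>b (i x) + (i x) b = ad x\<close>, which is
  \<open>hoch_ins1\<close>. Comparing the two recursions yields \<open>b \<phi> = \<phi> d\<close> by induction (\<open>hoch_antisymmetrize\<close>).

  The sum over all permutations of a word, with signs, is \<open>N \<phi>\<close> with the norm \<open>N\<close> of the cyclic operator
  (\<open>alt_word_conv_nrm\<close>), and it vanishes if a letter is repeated. In characteristic zero a tensor whose norm
  vanishes lies in the image of \<open>1 - t\<close> (\<open>antisym_nondistinct\<close>). Hence \<open>\<theta>\<close> is well defined and \<open>\<phi>\<close> maps the
  kernel of the upper projection to that of the lower one.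

  For Connes' isomorphism let \<open>b'\<close> be the Hochschild boundary without its last summand, and let \<open>s\<close> prepend
  the unit. The identities \<open>b (1 - t) = (1 - t) b'\<close> (\<open>hoch_cyc\<close>), \<open>N b = b' N\<close> (\<open>nrm_hoch\<close>) and
  \<open>b' s + s b' = 1\<close> (\<open>bar_cons_one\<close>) and the exactness of the sequence of \<open>1 - t\<close> and \<open>N\<close> in characteristic
  zero give injectivity and surjectivity of the map induced by \<open>(1 - t) s N\<close> by a diagram chase
  (\<open>connes_op_injective\<close>, \<open>connes_op_surjective\<close>).

  Everything is natural, because all operators are given by formulas on words in terms of the unit and the
  multiplication, and these commute with the letterwise application of a homomorphism of algebras.\<close>

section \<open>Linear algebra over the scalar ring\<close>

abbreviation kmod :: "('k::field, 'm) module \<Rightarrow> bool"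
  where "kmod M \<equiv> Module.module scalar_ring M"

lemma scalar_ring_simps [simp]:
  "carrier scalar_ring = UNIV" "a \<otimes>\<^bsub>scalar_ring\<^esub> b = a * b" "\<one>\<^bsub>scalar_ring\<^esub> = 1"
  "\<zero>\<^bsub>scalar_ring\<^esub> = 0" "a \<oplus>\<^bsub>scalar_ring\<^esub> b = a + b"
  by (simp_all add: scalar_ring_def)

lemma cring_scalar_ring: "cring (scalar_ring :: 'k::field ring)"
proof -
  have "\<exists>y. y + x = 0" for x :: 'k
    by (rule exI[of _ "- x"]) simp
  then show ?thesis
    by (intro cringI abelian_groupI comm_monoidI) (auto simp: algebra_simps)
qed

lemma kmod_neg_eq_smult:
  assumes "kmod M" "x \<in> carrier M"
  shows "\<ominus>\<^bsub>M\<^esub> x = (- 1) \<odot>\<^bsub>M\<^esub> x"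
proof -
  interpret M: Module.module scalar_ring M by fact
  have "(- 1) \<odot>\<^bsub>M\<^esub> x \<oplus>\<^bsub>M\<^esub> x = (- 1 + 1) \<odot>\<^bsub>M\<^esub> x"
    using M.smult_l_distr[of "- 1" 1 x] M.smult_one[of x] assms(2) by simp
  also have "\<dots> = \<zero>\<^bsub>M\<^esub>"
    using M.smult_l_null[of x] assms(2) by simp
  finally show ?thesis
    using M.minus_equality[of "(- 1) \<odot>\<^bsub>M\<^esub> x" x] assms(2) M.smult_closed[of "- 1" x] by simp
qed

lemma kmod_smult_closed: "kmod M \<Longrightarrow> x \<in> carrier M \<Longrightarrow> c \<odot>\<^bsub>M\<^esub> x \<in> carrier M"
  using Module.module.smult_closed[of scalar_ring M c x] by simp

lemma kmod_abelian_group: "kmod M \<Longrightarrow> abelian_group M"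
  by (simp add: Module.module_def)

lemma kmod_submoduleI:
  assumes "kmod M" "H \<subseteq> carrier M" "\<zero>\<^bsub>M\<^esub> \<in> H"
    "\<And>x y. x \<in> H \<Longrightarrow> y \<in> H \<Longrightarrow> x \<oplus>\<^bsub>M\<^esub> y \<in> H" "\<And>c x. x \<in> H \<Longrightarrow> c \<odot>\<^bsub>M\<^esub> x \<in> H"
  shows "submodule H scalar_ring M"
proof -
  interpret M: Module.module scalar_ring M by fact
  show ?thesis
    using assms(2-5) kmod_neg_eq_smult[OF assms(1)] by (intro M.submoduleI) auto
qed

lemma linear_mapsI:
  assumes "\<And>x. x \<in> carrier M \<Longrightarrow> f x \<in> carrier N"
    "\<And>x y. x \<in> carrier M \<Longrightarrow> y \<in> carrier M \<Longrightarrow> f (x \<oplus>\<^bsub>M\<^esub> y) = f x \<oplus>\<^bsub>N\<^esub> f y"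
    "\<And>c x. x \<in> carrier M \<Longrightarrow> f (c \<odot>\<^bsub>M\<^esub> x) = c \<odot>\<^bsub>N\<^esub> f x"
  shows "f \<in> linear_maps M N"
  using assms by (auto simp: linear_maps_def)

lemma
  assumes "f \<in> linear_maps M N"
  shows linear_maps_closed: "x \<in> carrier M \<Longrightarrow> f x \<in> carrier N"
    and linear_maps_add: "x \<in> carrier M \<Longrightarrow> y \<in> carrier M \<Longrightarrow> f (x \<oplus>\<^bsub>M\<^esub> y) = f x \<oplus>\<^bsub>N\<^esub> f y"
    and linear_maps_smult: "x \<in> carrier M \<Longrightarrow> f (c \<odot>\<^bsub>M\<^esub> x) = c \<odot>\<^bsub>N\<^esub> f x"
  using assms by (auto simp: linear_maps_def)

lemma linear_maps_zero:
  assumes "kmod M" "kmod N" "f \<in> linear_maps M N"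
  shows "f \<zero>\<^bsub>M\<^esub> = \<zero>\<^bsub>N\<^esub>"
proof -
  interpret M: Module.module scalar_ring M by fact
  interpret N: Module.module scalar_ring N by fact
  have "f \<zero>\<^bsub>M\<^esub> = f (0 \<odot>\<^bsub>M\<^esub> \<zero>\<^bsub>M\<^esub>)" using M.smult_l_null[of "\<zero>\<^bsub>M\<^esub>"] by simp
  also have "\<dots> = 0 \<odot>\<^bsub>N\<^esub> f \<zero>\<^bsub>M\<^esub>" by (rule linear_maps_smult[OF assms(3) M.zero_closed])
  also have "\<dots> = \<zero>\<^bsub>N\<^esub>"
    using N.smult_l_null[of "f \<zero>\<^bsub>M\<^esub>"] linear_maps_closed[OF assms(3)] by simp
  finally show ?thesis .
qed

lemma linear_maps_minus:
  assumes "kmod M" "kmod N" "f \<in> linear_maps M N" "x \<in> carrier M" "y \<in> carrier M"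
  shows "f (x \<ominus>\<^bsub>M\<^esub> y) = f x \<ominus>\<^bsub>N\<^esub> f y"
proof -
  have "(- 1) \<odot>\<^bsub>M\<^esub> y \<in> carrier M" using assms(1,5) by (rule kmod_smult_closed)
  then show ?thesis
    using assms linear_maps_closed[OF assms(3)]
    by (simp add: a_minus_def kmod_neg_eq_smult linear_maps_add[OF assms(3)] linear_maps_smult[OF assms(3)])
qed

lemma linear_maps_comp:
  assumes "f \<in> linear_maps M N" "g \<in> linear_maps N P"
  shows "(\<lambda>x. g (f x)) \<in> linear_maps M P"
  using assms by (auto simp: linear_maps_def Pi_iff)

lemma linear_maps_const_zero:
  assumes "kmod N"
  shows "(\<lambda>_. \<zero>\<^bsub>N\<^esub>) \<in> linear_maps M N"
proof -
  interpret N: Module.module scalar_ring N by fact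
  show ?thesis using N.smult_r_null by (intro linear_mapsI) auto
qed

lemma kmod_minus_eq_zero_iff:
  assumes "kmod M" "x \<in> carrier M" "y \<in> carrier M"
  shows "x \<ominus>\<^bsub>M\<^esub> y = \<zero>\<^bsub>M\<^esub> \<longleftrightarrow> x = y"
proof -
  interpret M: Module.module scalar_ring M by fact
  show ?thesis
    using assms(2,3) M.minus_equality[of x "\<ominus>\<^bsub>M\<^esub> y"] M.minus_minus[of y] M.r_neg[of y]
    by (auto simp: a_minus_def)
qed

lemma submodule_a_kernel:
  assumes "kmod M" "kmod N" "f \<in> linear_maps M N"
  shows "submodule (a_kernel M N f) scalar_ring M"
proof -
  interpret M: Module.module scalar_ring M by fact
  interpret N: Module.module scalar_ring N by fact
  show ?thesis
  proof (rule kmod_submoduleI[OF assms(1)])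
    show "\<zero>\<^bsub>M\<^esub> \<in> a_kernel M N f"
      using linear_maps_zero[OF assms] by (auto simp: a_kernel_def')
    show "c \<odot>\<^bsub>M\<^esub> x \<in> a_kernel M N f" if "x \<in> a_kernel M N f" for c x
      using that linear_maps_smult[OF assms(3), of x c] N.smult_r_null[of c] kmod_smult_closed[OF assms(1)]
      by (auto simp: a_kernel_def')
  qed (use linear_maps_add[OF assms(3)] in \<open>auto simp: a_kernel_def'\<close>)
qed

lemma submodule_image:
  assumes "kmod M" "kmod N" "f \<in> linear_maps M N" "submodule H scalar_ring M"
  shows "submodule (f ` H) scalar_ring N"
proof -
  interpret M: Module.module scalar_ring M by fact
  note H = M.submoduleE[OF assms(4)]
  have zero: "\<zero>\<^bsub>M\<^esub> \<in> H"
    using assms(4) by (metis subgroup.one_closed submodule.axioms(1) monoid.simps(2))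
  show ?thesis
  proof (rule kmod_submoduleI[OF assms(2)])
    show "f ` H \<subseteq> carrier N" using H(1) linear_maps_closed[OF assms(3)] by auto
    show "\<zero>\<^bsub>N\<^esub> \<in> f ` H" using linear_maps_zero[OF assms(1-3)] zero by (metis imageI)
    show "x \<oplus>\<^bsub>N\<^esub> y \<in> f ` H" if "x \<in> f ` H" "y \<in> f ` H" for x y
    proof -
      from that obtain u v where "u \<in> H" "v \<in> H" "x = f u" "y = f v" by auto
      then show ?thesis
        using H(1,5) linear_maps_add[OF assms(3), of u v] by (metis imageI subsetD)
    qed
    show "c \<odot>\<^bsub>N\<^esub> x \<in> f ` H" if "x \<in> f ` H" for c x
    proof -
      from that obtain u where "u \<in> H" "x = f u" by auto
      then show ?thesis
        using H(1) H(4)[of c u] linear_maps_smult[OF assms(3), of u c] by (metis UNIV_I imageI scalar_ring_simps(1) subsetD)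
    qed
  qed
qed

lemma submodule_facts:
  assumes "kmod M" "submodule H scalar_ring M"
  shows submodule_subset: "H \<subseteq> carrier M"
    and submodule_zero: "\<zero>\<^bsub>M\<^esub> \<in> H"
    and submodule_add: "x \<in> H \<Longrightarrow> y \<in> H \<Longrightarrow> x \<oplus>\<^bsub>M\<^esub> y \<in> H"
    and submodule_smult: "x \<in> H \<Longrightarrow> c \<odot>\<^bsub>M\<^esub> x \<in> H"
    and submodule_kmod: "kmod (M\<lparr>carrier := H\<rparr>)"
    and submodule_abelian: "abelian_subgroup H M"
proof -
  interpret M: Module.module scalar_ring M by fact
  note H = M.submoduleE[OF assms(2)]
  show "H \<subseteq> carrier M" "x \<in> H \<Longrightarrow> y \<in> H \<Longrightarrow> x \<oplus>\<^bsub>M\<^esub> y \<in> H" "x \<in> H \<Longrightarrow> c \<odot>\<^bsub>M\<^esub> x \<in> H"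
    using H(1,4,5) by auto
  show "\<zero>\<^bsub>M\<^esub> \<in> H"
    using assms(2) by (metis subgroup.one_closed submodule.axioms(1) monoid.simps(2))
  show "kmod (M\<lparr>carrier := H\<rparr>)"
    using assms by (simp add: submodule.submodule_is_module)
  show "abelian_subgroup H M"
    by (intro abelian_subgroupI3 additive_subgroup.intro submodule.axioms(1)[OF assms(2)] M.abelian_group_axioms)
qed

lemma submodule_minus:
  assumes "kmod M" "submodule H scalar_ring M" "x \<in> H" "y \<in> H"
  shows "x \<ominus>\<^bsub>M\<lparr>carrier := H\<rparr>\<^esub> y = x \<ominus>\<^bsub>M\<^esub> y"
proof -
  have "(\<lambda>x. x) \<in> linear_maps (M\<lparr>carrier := H\<rparr>) M"
    using submodule_subset[OF assms(1,2)] by (auto intro!: linear_mapsI)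
  from linear_maps_minus[OF submodule_kmod[OF assms(1,2)] assms(1) this] assms(3,4)
  show ?thesis by simp
qed

lemma submodule_minus_closed:
  assumes "kmod M" "submodule H scalar_ring M" "x \<in> H" "y \<in> H"
  shows "x \<ominus>\<^bsub>M\<^esub> y \<in> H"
  using assms submodule_add[OF assms(1,2)] submodule_smult[OF assms(1,2)] submodule_subset[OF assms(1,2)]
  by (simp add: a_minus_def kmod_neg_eq_smult subsetD)

section \<open>Quotients\<close>

lemma quot_module_simps [simp]:
  "carrier (quot_module M N) = a_rcosets\<^bsub>M\<^esub> N" "\<zero>\<^bsub>quot_module M N\<^esub> = N"
  by (simp_all add: quot_module_def)

lemma a_rcosets_iff: "z \<in> a_rcosets\<^bsub>M\<^esub> N \<longleftrightarrow> (\<exists>x\<in>carrier M. z = N +>\<^bsub>M\<^esub> x)"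
  by (auto simp: A_RCOSETS_def')

lemma coset_cong_record [simp]: "N +>\<^bsub>M\<lparr>carrier := Z\<rparr>\<^esub> x = N +>\<^bsub>M\<^esub> x"
  by (simp add: a_r_coset_def')

lemma coset_mem_iff:
  assumes "kmod M" "submodule N scalar_ring M" "x \<in> carrier M"
  shows "y \<in> N +>\<^bsub>M\<^esub> x \<longleftrightarrow> y \<in> carrier M \<and> y \<ominus>\<^bsub>M\<^esub> x \<in> N"
proof -
  interpret abelian_subgroup N M by (rule submodule_abelian[OF assms(1,2)])
  show ?thesis
    using a_rcos_module[OF assms(3), of y] a_elemrcos_carrier[OF assms(3)] by (auto simp: a_minus_def)
qed

lemma coset_eq_iff:
  assumes "kmod M" "submodule N scalar_ring M" "x \<in> carrier M" "y \<in> carrier M"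
  shows "N +>\<^bsub>M\<^esub> x = N +>\<^bsub>M\<^esub> y \<longleftrightarrow> x \<ominus>\<^bsub>M\<^esub> y \<in> N"
proof -
  interpret abelian_subgroup N M by (rule submodule_abelian[OF assms(1,2)])
  show ?thesis
    using coset_mem_iff[OF assms(1,2,4), of x] a_rcos_self[OF assms(3)] a_repr_independence'[of x y] assms(3,4)
    by blast
qed

lemma coset_zero: "kmod M \<Longrightarrow> submodule N scalar_ring M \<Longrightarrow> N +>\<^bsub>M\<^esub> \<zero>\<^bsub>M\<^esub> = N"
  by (metis abelian_group.a_coset_add_zero kmod_abelian_group submodule_subset)

lemma coset_eq_zero_iff:
  assumes "kmod M" "submodule N scalar_ring M" "x \<in> carrier M"
  shows "N +>\<^bsub>M\<^esub> x = N \<longleftrightarrow> x \<in> N"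
proof -
  interpret M: Module.module scalar_ring M by fact
  have "x \<ominus>\<^bsub>M\<^esub> \<zero>\<^bsub>M\<^esub> = x" using assms(3) by (simp add: a_minus_def)
  then show ?thesis
    using coset_eq_iff[OF assms(1,2,3) M.zero_closed] coset_zero[OF assms(1,2)] by simp
qed

lemma coset_add:
  assumes "kmod M" "submodule N scalar_ring M" "x \<in> carrier M" "y \<in> carrier M"
  shows "(N +>\<^bsub>M\<^esub> x) \<oplus>\<^bsub>quot_module M N\<^esub> (N +>\<^bsub>M\<^esub> y) = N +>\<^bsub>M\<^esub> (x \<oplus>\<^bsub>M\<^esub> y)"
  using abelian_subgroup.a_rcos_sum[OF submodule_abelian[OF assms(1,2)] assms(3,4)]
  by (simp add: quot_module_def)

lemma coset_smult:
  assumes "kmod M" "submodule N scalar_ring M" "x \<in> carrier M"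
  shows "c \<odot>\<^bsub>quot_module M N\<^esub> (N +>\<^bsub>M\<^esub> x) = N +>\<^bsub>M\<^esub> (c \<odot>\<^bsub>M\<^esub> x)"
proof -
  interpret M: Module.module scalar_ring M by fact
  interpret N: abelian_subgroup N M by (rule submodule_abelian[OF assms(1,2)])
  have lin: "(\<lambda>x. c \<odot>\<^bsub>M\<^esub> x) \<in> linear_maps M M"
  proof (rule linear_mapsI)
    show "c \<odot>\<^bsub>M\<^esub> (d \<odot>\<^bsub>M\<^esub> x) = d \<odot>\<^bsub>M\<^esub> (c \<odot>\<^bsub>M\<^esub> x)" if "x \<in> carrier M" for d x
      using M.smult_assoc1[of c d x] M.smult_assoc1[of d c x] that by (simp add: mult.commute)
  qed (use M.smult_r_distr[of c] kmod_smult_closed[OF assms(1)] in auto)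
  have const: "N +>\<^bsub>M\<^esub> (c \<odot>\<^bsub>M\<^esub> y) = N +>\<^bsub>M\<^esub> (c \<odot>\<^bsub>M\<^esub> x)" if "y \<in> N +>\<^bsub>M\<^esub> x" for y
  proof -
    have y: "y \<in> carrier M" "y \<ominus>\<^bsub>M\<^esub> x \<in> N" using that coset_mem_iff[OF assms] by auto
    then have "c \<odot>\<^bsub>M\<^esub> y \<ominus>\<^bsub>M\<^esub> c \<odot>\<^bsub>M\<^esub> x \<in> N"
      using linear_maps_minus[OF assms(1,1) lin y(1) assms(3)] submodule_smult[OF assms(1,2) y(2), of c] by simp
    then show ?thesis
      using coset_eq_iff[OF assms(1,2)] kmod_smult_closed[OF assms(1)] y(1) assms(3) by simp
  qed
  have "(\<Union>y\<in>N +>\<^bsub>M\<^esub> x. N +>\<^bsub>M\<^esub> (c \<odot>\<^bsub>M\<^esub> y)) = (\<Union>y\<in>N +>\<^bsub>M\<^esub> x. N +>\<^bsub>M\<^esub> (c \<odot>\<^bsub>M\<^esub> x))"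
    by (rule SUP_cong[OF refl const])
  also have "\<dots> = N +>\<^bsub>M\<^esub> (c \<odot>\<^bsub>M\<^esub> x)"
    using N.a_rcos_self[OF assms(3)] by (metis SUP_const empty_iff)
  finally show ?thesis by (simp add: quot_module_def)
qed

lemma quot_kmod:
  assumes "kmod M" "submodule N scalar_ring M"
  shows "kmod (quot_module M N)"
proof -
  interpret M: Module.module scalar_ring M by fact
  note add = coset_add[OF assms] and smult = coset_smult[OF assms]
  note closed = kmod_smult_closed[OF assms(1)]
  show ?thesis
  proof (rule moduleI)
    show "cring (scalar_ring :: 'a ring)" by (rule cring_scalar_ring)
    show "abelian_group (quot_module M N)"
    proof (rule abelian_groupI)
      show "\<zero>\<^bsub>quot_module M N\<^esub> \<in> carrier (quot_module M N)"
        using coset_zero[OF assms] by (force simp: a_rcosets_iff)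
      show "\<zero>\<^bsub>quot_module M N\<^esub> \<oplus>\<^bsub>quot_module M N\<^esub> z = z" if z: "z \<in> carrier (quot_module M N)" for z
      proof -
        obtain x where "x \<in> carrier M" "z = N +>\<^bsub>M\<^esub> x" using z by (auto simp: a_rcosets_iff)
        then show ?thesis using add[of "\<zero>\<^bsub>M\<^esub>" x] coset_zero[OF assms] by simp
      qed
      show "\<exists>y\<in>carrier (quot_module M N). y \<oplus>\<^bsub>quot_module M N\<^esub> z = \<zero>\<^bsub>quot_module M N\<^esub>"
        if z: "z \<in> carrier (quot_module M N)" for z
      proof -
        obtain x where x: "x \<in> carrier M" "z = N +>\<^bsub>M\<^esub> x" using z by (auto simp: a_rcosets_iff)
        have "(N +>\<^bsub>M\<^esub> (\<ominus>\<^bsub>M\<^esub> x)) \<oplus>\<^bsub>quot_module M N\<^esub> z = N"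
          using add[of "\<ominus>\<^bsub>M\<^esub> x" x] x coset_zero[OF assms] by (simp add: M.l_neg)
        then show ?thesis using x by (intro bexI[of _ "N +>\<^bsub>M\<^esub> (\<ominus>\<^bsub>M\<^esub> x)"]) (auto simp: a_rcosets_iff)
      qed
    qed (auto simp: a_rcosets_iff add M.a_assoc M.a_comm M.a_lcomm)
  qed (auto simp: a_rcosets_iff add smult closed M.smult_l_distr[simplified] M.smult_r_distr[simplified]
      M.smult_assoc1[simplified] M.smult_one[simplified])
qed

lemma coset_linear:
  assumes "kmod M" "submodule N scalar_ring M"
  shows "(\<lambda>x. N +>\<^bsub>M\<^esub> x) \<in> linear_maps M (quot_module M N)"
  using assms by (intro linear_mapsI) (auto simp: coset_add coset_smult a_rcosets_iff)

lemma a_kernel_coset: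
  assumes "kmod M" "submodule N scalar_ring M"
  shows "a_kernel M (quot_module M N) (\<lambda>x. N +>\<^bsub>M\<^esub> x) = N"
  using coset_eq_zero_iff[OF assms] submodule_subset[OF assms] by (auto simp: a_kernel_def')

lemma descend_coset:
  assumes "kmod M" "submodule N scalar_ring M" "kmod P" "f \<in> linear_maps M P"
    "\<And>x. x \<in> N \<Longrightarrow> f x = \<zero>\<^bsub>P\<^esub>" "x \<in> carrier M"
  shows "descend f (N +>\<^bsub>M\<^esub> x) = f x"
proof -
  interpret N: abelian_subgroup N M by (rule submodule_abelian[OF assms(1,2)])
  have const: "f y = f x" if "y \<in> N +>\<^bsub>M\<^esub> x" for y
  proof -
    have y: "y \<in> carrier M" "y \<ominus>\<^bsub>M\<^esub> x \<in> N" using that coset_mem_iff[OF assms(1,2,6)] by auto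
    have "f y \<ominus>\<^bsub>P\<^esub> f x = \<zero>\<^bsub>P\<^esub>"
      using linear_maps_minus[OF assms(1,3,4) y(1) assms(6)] assms(5)[OF y(2)] by simp
    then show ?thesis
      using kmod_minus_eq_zero_iff[OF assms(3)] linear_maps_closed[OF assms(4)] y(1) assms(6) by simp
  qed
  have "f ` (N +>\<^bsub>M\<^esub> x) = (\<lambda>_. f x) ` (N +>\<^bsub>M\<^esub> x)"
    by (rule image_cong[OF refl const])
  also have "\<dots> = {f x}" by (rule image_constant[OF N.a_rcos_self[OF assms(6)]])
  finally show ?thesis by (simp add: descend_def)
qed

lemma descend_linear:
  assumes "kmod M" "submodule N scalar_ring M" "kmod P" "f \<in> linear_maps M P"
    "\<And>x. x \<in> N \<Longrightarrow> f x = \<zero>\<^bsub>P\<^esub>"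
  shows "descend f \<in> linear_maps (quot_module M N) P"
proof -
  interpret M: Module.module scalar_ring M by fact
  note d = descend_coset[OF assms]
  show ?thesis
    using linear_maps_closed[OF assms(4)] linear_maps_add[OF assms(4)] linear_maps_smult[OF assms(4)]
    by (intro linear_mapsI)
      (auto simp: a_rcosets_iff d coset_add[OF assms(1,2)] coset_smult[OF assms(1,2)] kmod_smult_closed[OF assms(1)])
qed

lemma
  assumes "kmod M" "submodule N scalar_ring M" "kmod M'" "submodule N' scalar_ring M'"
    "f \<in> linear_maps M M'" "f ` N \<subseteq> N'"
  shows induced_coset: "x \<in> carrier M \<Longrightarrow> induced M' N' f (N +>\<^bsub>M\<^esub> x) = N' +>\<^bsub>M'\<^esub> f x"
    and induced_linear: "induced M' N' f \<in> linear_maps (quot_module M N) (quot_module M' N')"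
proof -
  have *: "(\<lambda>x. N' +>\<^bsub>M'\<^esub> f x) \<in> linear_maps M (quot_module M' N')"
    by (rule linear_maps_comp[OF assms(5) coset_linear[OF assms(3,4)]])
  have **: "N' +>\<^bsub>M'\<^esub> f x = \<zero>\<^bsub>quot_module M' N'\<^esub>" if "x \<in> N" for x
    using that assms(6) coset_eq_zero_iff[OF assms(3,4)] submodule_subset[OF assms(3,4)] by auto
  show "x \<in> carrier M \<Longrightarrow> induced M' N' f (N +>\<^bsub>M\<^esub> x) = N' +>\<^bsub>M'\<^esub> f x"
    unfolding induced_def by (rule descend_coset[OF assms(1,2) quot_kmod[OF assms(3,4)] * **])
  show "induced M' N' f \<in> linear_maps (quot_module M N) (quot_module M' N')"
    unfolding induced_def by (rule descend_linear[OF assms(1,2) quot_kmod[OF assms(3,4)] * **])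
qed

section \<open>Complexes and homology\<close>

lemma submodule_restrict:
  assumes "kmod M" "submodule Z scalar_ring M" "submodule N scalar_ring M" "N \<subseteq> Z"
  shows "submodule N scalar_ring (M\<lparr>carrier := Z\<rparr>)"
  using assms submodule_zero[OF assms(1,3)] submodule_add[OF assms(1,3)] submodule_smult[OF assms(1,3)]
  by (intro kmod_submoduleI submodule_kmod[OF assms(1,2)]) auto

lemma kmod_minus_zero:
  assumes "kmod M" "x \<in> carrier M"
  shows "x \<ominus>\<^bsub>M\<^esub> \<zero>\<^bsub>M\<^esub> = x"
proof -
  interpret M: Module.module scalar_ring M by fact
  have "\<ominus>\<^bsub>M\<^esub> \<zero>\<^bsub>M\<^esub> = \<zero>\<^bsub>M\<^esub>" using M.minus_equality[of "\<zero>\<^bsub>M\<^esub>" "\<zero>\<^bsub>M\<^esub>"] by simp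
  then show ?thesis using assms(2) by (simp add: a_minus_def)
qed

lemma kmod_minus_minus:
  assumes "kmod M" "x \<in> carrier M" "y \<in> carrier M"
  shows "x \<ominus>\<^bsub>M\<^esub> (x \<ominus>\<^bsub>M\<^esub> y) = y"
proof -
  interpret M: Module.module scalar_ring M by fact
  have "x \<oplus>\<^bsub>M\<^esub> (\<ominus>\<^bsub>M\<^esub> x \<oplus>\<^bsub>M\<^esub> y) = y"
    using assms(2,3) M.a_assoc[of x "\<ominus>\<^bsub>M\<^esub> x" y] by (simp add: M.r_neg)
  then show ?thesis using assms(2,3) by (simp add: a_minus_def M.minus_add)
qed

definition is_complex :: "('k::field, 'm) chain_cx \<Rightarrow> bool"
  where "is_complex C \<longleftrightarrow> (\<forall>n. kmod (chain C n) \<and> bd C n \<in> linear_maps (chain C n) (chain C (n - 1))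
    \<and> (\<forall>x\<in>carrier (chain C n). bd C (n - 1) (bd C n x) = \<zero>\<^bsub>chain C (n - 1 - 1)\<^esub>))"

definition is_chain_map ::
  "('k::field, 'm) chain_cx \<Rightarrow> ('k, 'n) chain_cx \<Rightarrow> (int \<Rightarrow> 'm \<Rightarrow> 'n) \<Rightarrow> bool"
  where "is_chain_map C D f \<longleftrightarrow> (\<forall>n. f n \<in> linear_maps (chain C n) (chain D n)
    \<and> (\<forall>x\<in>carrier (chain C n). bd D n (f n x) = f (n - 1) (bd C n x)))"

text \<open>Connes' operator raises the degree and anticommutes with the boundaries, so that maps
  between homology modules of different degrees, induced by maps that are not chain maps, have to
  be covered.\<close>

definition homology_compatible ::
  "('k::field, 'm) chain_cx \<Rightarrow> int \<Rightarrow> ('k, 'n) chain_cx \<Rightarrow> int \<Rightarrow> ('m \<Rightarrow> 'n) \<Rightarrow> bool"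
  where "homology_compatible C m D n f \<longleftrightarrow> f \<in> linear_maps (chain C m) (chain D n)
    \<and> f ` cycles C m \<subseteq> cycles D n \<and> f ` boundaries C m \<subseteq> boundaries D n"

lemma is_complexD:
  assumes "is_complex C"
  shows complex_kmod: "kmod (chain C n)"
    and complex_bd: "bd C n \<in> linear_maps (chain C n) (chain C (n - 1))"
    and complex_bd_Suc: "bd C (n + 1) \<in> linear_maps (chain C (n + 1)) (chain C n)"
    and complex_bd_bd: "x \<in> carrier (chain C n) \<Longrightarrow> bd C (n - 1) (bd C n x) = \<zero>\<^bsub>chain C (n - 1 - 1)\<^esub>"
    and complex_bd_bd_Suc: "x \<in> carrier (chain C (n + 1)) \<Longrightarrow> bd C n (bd C (n + 1) x) = \<zero>\<^bsub>chain C (n - 1)\<^esub>"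
proof -
  have *: "kmod (chain C n)" "bd C n \<in> linear_maps (chain C n) (chain C (n - 1))"
    "x \<in> carrier (chain C n) \<Longrightarrow> bd C (n - 1) (bd C n x) = \<zero>\<^bsub>chain C (n - 1 - 1)\<^esub>" for n x
    using assms by (auto simp: is_complex_def)
  then show "kmod (chain C n)" "bd C n \<in> linear_maps (chain C n) (chain C (n - 1))"
    "x \<in> carrier (chain C n) \<Longrightarrow> bd C (n - 1) (bd C n x) = \<zero>\<^bsub>chain C (n - 1 - 1)\<^esub>" by auto
  show "bd C (n + 1) \<in> linear_maps (chain C (n + 1)) (chain C n)"
    "x \<in> carrier (chain C (n + 1)) \<Longrightarrow> bd C n (bd C (n + 1) x) = \<zero>\<^bsub>chain C (n - 1)\<^esub>"
    using *(2)[of "n + 1"] *(3)[of x "n + 1"] by simp_all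
qed

lemma is_chain_mapD:
  assumes "is_chain_map C D f"
  shows chain_map_linear: "f n \<in> linear_maps (chain C n) (chain D n)"
    and chain_map_bd: "x \<in> carrier (chain C n) \<Longrightarrow> bd D n (f n x) = f (n - 1) (bd C n x)"
    and chain_map_bd_Suc: "x \<in> carrier (chain C (n + 1)) \<Longrightarrow> bd D (n + 1) (f (n + 1) x) = f n (bd C (n + 1) x)"
proof -
  have *: "f n \<in> linear_maps (chain C n) (chain D n)"
    "x \<in> carrier (chain C n) \<Longrightarrow> bd D n (f n x) = f (n - 1) (bd C n x)" for n x
    using assms by (auto simp: is_chain_map_def)
  show "f n \<in> linear_maps (chain C n) (chain D n)"
    "x \<in> carrier (chain C n) \<Longrightarrow> bd D n (f n x) = f (n - 1) (bd C n x)" by fact+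
  show "x \<in> carrier (chain C (n + 1)) \<Longrightarrow> bd D (n + 1) (f (n + 1) x) = f n (bd C (n + 1) x)"
    using *(2)[of x "n + 1"] by simp
qed

lemma cycles_iff: "x \<in> cycles C n \<longleftrightarrow> x \<in> carrier (chain C n) \<and> bd C n x = \<zero>\<^bsub>chain C (n - 1)\<^esub>"
  by (auto simp: cycles_def a_kernel_def')

lemma boundaries_iff: "x \<in> boundaries C n \<longleftrightarrow> (\<exists>y\<in>carrier (chain C (n + 1)). x = bd C (n + 1) y)"
  by (auto simp: boundaries_def)

context
  fixes C :: "('k::field, 'm) chain_cx"
  assumes C: "is_complex C"
begin

lemma cycles_submodule: "submodule (cycles C n) scalar_ring (chain C n)"
  unfolding cycles_def by (rule submodule_a_kernel) (use is_complexD[OF C] in auto)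

lemma boundaries_subset_cycles: "boundaries C n \<subseteq> cycles C n"
  using linear_maps_closed[OF complex_bd_Suc[OF C]] complex_bd_bd_Suc[OF C]
  by (auto simp: cycles_iff boundaries_iff)

lemma boundaries_submodule: "submodule (boundaries C n) scalar_ring (chain C n)"
proof -
  have "submodule (carrier (chain C (n + 1))) scalar_ring (chain C (n + 1))"
    by (rule Module.module.carrier_is_submodule[OF complex_kmod[OF C]])
  then show ?thesis
    unfolding boundaries_def using is_complexD[OF C] by (intro submodule_image) auto
qed

lemma cycles_kmod: "kmod ((chain C n)\<lparr>carrier := cycles C n\<rparr>)"
  by (rule submodule_kmod[OF complex_kmod[OF C] cycles_submodule])

lemma boundaries_submodule_cycles:
  "submodule (boundaries C n) scalar_ring ((chain C n)\<lparr>carrier := cycles C n\<rparr>)"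
  by (rule submodule_restrict[OF complex_kmod[OF C] cycles_submodule boundaries_submodule boundaries_subset_cycles])

lemma homology_kmod: "kmod (homology C n)"
  unfolding homology_def by (rule quot_kmod[OF cycles_kmod boundaries_submodule_cycles])

lemma hom_class_linear: "hom_class C n \<in> linear_maps ((chain C n)\<lparr>carrier := cycles C n\<rparr>) (homology C n)"
  using coset_linear[OF cycles_kmod boundaries_submodule_cycles]
  by (simp add: homology_def hom_class_def[abs_def])

lemma hom_class_closed: "x \<in> cycles C n \<Longrightarrow> hom_class C n x \<in> carrier (homology C n)"
  using linear_maps_closed[OF hom_class_linear] by simp

lemma hom_class_add: "x \<in> cycles C n \<Longrightarrow> y \<in> cycles C n \<Longrightarrow>
    hom_class C n (x \<oplus>\<^bsub>chain C n\<^esub> y) = hom_class C n x \<oplus>\<^bsub>homology C n\<^esub> hom_class C n y"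
  using linear_maps_add[OF hom_class_linear] by simp

lemma hom_class_smult: "x \<in> cycles C n \<Longrightarrow>
    hom_class C n (c \<odot>\<^bsub>chain C n\<^esub> x) = c \<odot>\<^bsub>homology C n\<^esub> hom_class C n x"
  using linear_maps_smult[OF hom_class_linear] by simp

lemma homology_cases:
  assumes "z \<in> carrier (homology C n)"
  obtains x where "x \<in> cycles C n" "z = hom_class C n x"
  using assms by (auto simp: homology_def a_rcosets_iff hom_class_def)

lemma hom_class_eq_iff:
  assumes "x \<in> cycles C n" "y \<in> cycles C n"
  shows "hom_class C n x = hom_class C n y \<longleftrightarrow> x \<ominus>\<^bsub>chain C n\<^esub> y \<in> boundaries C n"
proof -
  have "x \<in> carrier (chain C n)" "y \<in> carrier (chain C n)" using assms by (auto simp: cycles_iff)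
  then show ?thesis
    unfolding hom_class_def by (rule coset_eq_iff[OF complex_kmod[OF C] boundaries_submodule])
qed

lemma hom_class_eqI:
  assumes "x \<in> cycles C n" "y \<in> cycles C n" "u \<in> carrier (chain C (n + 1))"
    "x \<ominus>\<^bsub>chain C n\<^esub> y = bd C (n + 1) u"
  shows "hom_class C n x = hom_class C n y"
  using assms by (auto simp: hom_class_eq_iff boundaries_iff)

lemma hom_class_eq_zero_iff:
  assumes "x \<in> cycles C n"
  shows "hom_class C n x = \<zero>\<^bsub>homology C n\<^esub> \<longleftrightarrow> x \<in> boundaries C n"
  using coset_eq_zero_iff[OF complex_kmod[OF C] boundaries_submodule, of x n] assms
  by (auto simp: cycles_iff hom_class_def homology_def)

lemma mem_hom_class_iff:
  assumes "x \<in> cycles C n"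
  shows "y \<in> hom_class C n x \<longleftrightarrow> y \<in> cycles C n \<and> hom_class C n y = hom_class C n x"
proof -
  have "y \<in> hom_class C n x \<longleftrightarrow> y \<in> carrier (chain C n) \<and> y \<ominus>\<^bsub>chain C n\<^esub> x \<in> boundaries C n"
    using coset_mem_iff[OF complex_kmod[OF C] boundaries_submodule, of x n y] assms
    by (auto simp: cycles_iff hom_class_def)
  moreover have "y \<in> cycles C n" if "y \<in> carrier (chain C n)" "y \<ominus>\<^bsub>chain C n\<^esub> x \<in> boundaries C n"
  proof -
    have "\<zero>\<^bsub>chain C (n - 1)\<^esub> = bd C n (y \<ominus>\<^bsub>chain C n\<^esub> x)"
      using subsetD[OF boundaries_subset_cycles that(2)] by (simp add: cycles_iff)
    also have "\<dots> = bd C n y \<ominus>\<^bsub>chain C (n - 1)\<^esub> bd C n x"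
      using linear_maps_minus[OF complex_kmod[OF C] complex_kmod[OF C] complex_bd[OF C]] that(1) assms
      by (simp add: cycles_iff)
    finally show ?thesis
      using kmod_minus_eq_zero_iff[OF complex_kmod[OF C]] linear_maps_closed[OF complex_bd[OF C]] that(1) assms
      by (metis cycles_iff)
  qed
  ultimately show ?thesis
    using hom_class_eq_iff[OF _ assms, of y] by (auto simp: cycles_iff)
qed

end

lemma
  assumes C: "is_complex C" and D: "is_complex D" and f: "homology_compatible C m D n f"
  shows hom_map_hom_class: "x \<in> cycles C m \<Longrightarrow> hom_map D n f (hom_class C m x) = hom_class D n (f x)"
    and hom_map_linear: "hom_map D n f \<in> linear_maps (homology C m) (homology D n)"
proof -
  have "f \<in> linear_maps ((chain C m)\<lparr>carrier := cycles C m\<rparr>) ((chain D n)\<lparr>carrier := cycles D n\<rparr>)"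
    using f by (auto simp: homology_compatible_def linear_maps_def cycles_iff Pi_iff image_subset_iff)
  from linear_maps_comp[OF this hom_class_linear[OF D]]
  have *: "(\<lambda>x. hom_class D n (f x)) \<in> linear_maps ((chain C m)\<lparr>carrier := cycles C m\<rparr>) (homology D n)" .
  have **: "hom_class D n (f x) = \<zero>\<^bsub>homology D n\<^esub>" if "x \<in> boundaries C m" for x
  proof -
    have "f x \<in> boundaries D n" using f that by (auto simp: homology_compatible_def)
    then show ?thesis
      using hom_class_eq_zero_iff[OF D subsetD[OF boundaries_subset_cycles[OF D]]] by simp
  qed
  note arg = cycles_kmod[OF C] boundaries_submodule_cycles[OF C] homology_kmod[OF D] * **
  show "x \<in> cycles C m \<Longrightarrow> hom_map D n f (hom_class C m x) = hom_class D n (f x)"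
    using descend_coset[OF arg, of x] by (simp add: hom_map_def hom_class_def)
  show "hom_map D n f \<in> linear_maps (homology C m) (homology D n)"
    unfolding hom_map_def homology_def[of C] by (rule descend_linear[OF arg])
qed

lemma homology_compatible_chain_map:
  assumes "is_complex C" "is_complex D" "is_chain_map C D f"
  shows "homology_compatible C n D n (f n)"
  unfolding homology_compatible_def
proof (intro conjI subsetI)
  show lin: "f n \<in> linear_maps (chain C n) (chain D n)" by (rule chain_map_linear[OF assms(3)])
  fix y
  show "y \<in> cycles D n" if "y \<in> f n ` cycles C n"
    using that linear_maps_closed[OF lin] chain_map_bd[OF assms(3)]
      linear_maps_zero[OF complex_kmod[OF assms(1)] complex_kmod[OF assms(2)] chain_map_linear[OF assms(3)]]
    by (auto simp: cycles_iff)
  show "y \<in> boundaries D n" if "y \<in> f n ` boundaries C n"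
  proof -
    from that obtain u where "u \<in> carrier (chain C (n + 1))" "y = f n (bd C (n + 1) u)"
      by (auto simp: boundaries_iff)
    then show ?thesis
      using chain_map_bd_Suc[OF assms(3)] linear_maps_closed[OF chain_map_linear[OF assms(3)]]
      by (auto simp: boundaries_iff intro!: bexI[of _ "f (n + 1) u"])
  qed
qed

lemma homology_compatible_cycles: "homology_compatible C m D n f \<Longrightarrow> x \<in> cycles C m \<Longrightarrow> f x \<in> cycles D n"
  by (auto simp: homology_compatible_def)

section \<open>The long exact sequence of a short exact sequence of complexes\<close>

lemma ker_cx_simps [simp]:
  "chain (ker_cx C D p) n = (chain C n)\<lparr>carrier := a_kernel (chain C n) (chain D n) (p n)\<rparr>"
  "bd (ker_cx C D p) = bd C"
  by (simp_all add: ker_cx_def)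

definition ses_les ::
  "('k::field, 'm) chain_cx \<Rightarrow> ('k, 'n) chain_cx \<Rightarrow> (int \<Rightarrow> 'm \<Rightarrow> 'n) \<Rightarrow> ('k, 'm set, 'm set, 'n set) les"
  where "ses_les C D p =
    \<lparr>X_les = homology (ker_cx C D p), Y_les = homology C, Z_les = homology D,
     XY_les = (\<lambda>n. hom_map C n (\<lambda>x. x)), YZ_les = (\<lambda>n. hom_map D n (p n)),
     ZX_les = (\<lambda>n. connecting C D p n)\<rparr>"

locale short_exact =
  fixes C :: "('k::field, 'm) chain_cx" and D :: "('k, 'n) chain_cx" and p :: "int \<Rightarrow> 'm \<Rightarrow> 'n"
  assumes C: "is_complex C" and D: "is_complex D" and p: "is_chain_map C D p"
    and surj: "p n ` carrier (chain C n) = carrier (chain D n)"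
begin

abbreviation "K \<equiv> ker_cx C D p"

lemma ker_carrier_iff: "x \<in> a_kernel (chain C n) (chain D n) (p n) \<longleftrightarrow> x \<in> carrier (chain C n) \<and> p n x = \<zero>\<^bsub>chain D n\<^esub>"
  by (auto simp: a_kernel_def')

lemma ker_submodule: "submodule (a_kernel (chain C n) (chain D n) (p n)) scalar_ring (chain C n)"
  by (intro submodule_a_kernel complex_kmod C D chain_map_linear[OF p])

lemma bd_zero: "bd D n \<zero>\<^bsub>chain D n\<^esub> = \<zero>\<^bsub>chain D (n - 1)\<^esub>"
  by (rule linear_maps_zero[OF complex_kmod[OF D] complex_kmod[OF D] complex_bd[OF D]])

lemma ker_complex: "is_complex K"
  unfolding is_complex_def
proof (intro allI conjI ballI)
  fix n
  show "kmod (chain K n)"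
    using submodule_kmod[OF complex_kmod[OF C] ker_submodule] by simp
  show "bd K n \<in> linear_maps (chain K n) (chain K (n - 1))"
    using linear_maps_closed[OF complex_bd[OF C]] linear_maps_add[OF complex_bd[OF C]]
      linear_maps_smult[OF complex_bd[OF C]] chain_map_bd[OF p] bd_zero
    by (intro linear_mapsI) (auto simp: ker_carrier_iff simp flip: chain_map_bd[OF p])
  show "bd K (n - 1) (bd K n x) = \<zero>\<^bsub>chain K (n - 1 - 1)\<^esub>" if "x \<in> carrier (chain K n)" for x
    using that complex_bd_bd[OF C] by (auto simp: ker_carrier_iff)
qed

lemma ker_cycles_iff: "x \<in> cycles K n \<longleftrightarrow> x \<in> cycles C n \<and> p n x = \<zero>\<^bsub>chain D n\<^esub>"
  by (auto simp: cycles_iff ker_carrier_iff)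

lemma ker_boundaries_iff: "x \<in> boundaries K n \<longleftrightarrow>
    (\<exists>y\<in>carrier (chain C (n + 1)). p (n + 1) y = \<zero>\<^bsub>chain D (n + 1)\<^esub> \<and> x = bd C (n + 1) y)"
  by (auto simp: boundaries_iff ker_carrier_iff)

lemma ker_incl_compatible: "homology_compatible K n C n (\<lambda>x. x)"
  unfolding homology_compatible_def
  by (auto simp: ker_cycles_iff ker_boundaries_iff boundaries_iff ker_carrier_iff intro!: linear_mapsI) blast

lemma p_compatible: "homology_compatible C n D n (p n)"
  by (rule homology_compatible_chain_map[OF C D p])

lemma p_minus: "x \<in> carrier (chain C n) \<Longrightarrow> y \<in> carrier (chain C n) \<Longrightarrow>
    p n (x \<ominus>\<^bsub>chain C n\<^esub> y) = p n x \<ominus>\<^bsub>chain D n\<^esub> p n y"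
  by (intro linear_maps_minus complex_kmod C D chain_map_linear[OF p])

lemma bd_minus: "x \<in> carrier (chain C n) \<Longrightarrow> y \<in> carrier (chain C n) \<Longrightarrow>
    bd C n (x \<ominus>\<^bsub>chain C n\<^esub> y) = bd C n x \<ominus>\<^bsub>chain C (n - 1)\<^esub> bd C n y"
  by (intro linear_maps_minus complex_kmod C complex_bd)

lemma minus_closed: "x \<in> carrier (chain C n) \<Longrightarrow> y \<in> carrier (chain C n) \<Longrightarrow>
    x \<ominus>\<^bsub>chain C n\<^esub> y \<in> carrier (chain C n)"
  using abelian_group.minus_closed[OF kmod_abelian_group[OF complex_kmod[OF C]]] .

lemma bd_lift_cycle:
  assumes "c \<in> carrier (chain C n)" "p n c \<in> cycles D n"
  shows "bd C n c \<in> cycles K (n - 1)"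
  using assms linear_maps_closed[OF complex_bd[OF C]] complex_bd_bd[OF C] chain_map_bd[OF p]
  by (simp add: ker_carrier_iff cycles_iff)

lemma ker_hom_class_eq_iff:
  assumes "x \<in> cycles K n" "y \<in> cycles K n"
  shows "hom_class K n x = hom_class K n y \<longleftrightarrow>
    (\<exists>u\<in>carrier (chain C (n + 1)). p (n + 1) u = \<zero>\<^bsub>chain D (n + 1)\<^esub> \<and> x \<ominus>\<^bsub>chain C n\<^esub> y = bd C (n + 1) u)"
proof -
  have "x \<ominus>\<^bsub>chain K n\<^esub> y = x \<ominus>\<^bsub>chain C n\<^esub> y"
    using submodule_minus[OF complex_kmod[OF C] ker_submodule] assms by (auto simp: cycles_iff ker_carrier_iff)
  then show ?thesis
    using hom_class_eq_iff[OF ker_complex assms] by (simp add: ker_boundaries_iff)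
qed

lemma connecting_class_unique:
  assumes c: "c \<in> carrier (chain C n)" "p n c \<in> cycles D n"
    and c': "c' \<in> carrier (chain C n)" "p n c' \<in> hom_class D n (p n c)"
  shows "hom_class K (n - 1) (bd C n c') = hom_class K (n - 1) (bd C n c)"
proof -
  have cyc: "p n c' \<in> cycles D n" and "hom_class D n (p n c') = hom_class D n (p n c)"
    using c' c mem_hom_class_iff[OF D] by auto
  then obtain v where v: "v \<in> carrier (chain D (n + 1))" "p n c' \<ominus>\<^bsub>chain D n\<^esub> p n c = bd D (n + 1) v"
    using hom_class_eq_iff[OF D] c(2) by (auto simp: boundaries_iff)
  obtain w where w: "w \<in> carrier (chain C (n + 1))" "v = p (n + 1) w"
    using surj[of "n + 1"] v(1) by auto
  have bw: "bd C (n + 1) w \<in> carrier (chain C n)" using linear_maps_closed[OF complex_bd_Suc[OF C]] w by auto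
  \<comment> \<open>Subtracting the boundary of a lift of \<open>v\<close> corrects the difference of the two lifts to an element of
    the kernel without changing its boundary.\<close>
  let ?u = "(c' \<ominus>\<^bsub>chain C n\<^esub> c) \<ominus>\<^bsub>chain C n\<^esub> bd C (n + 1) w"
  have u: "?u \<in> carrier (chain C n)" using c c' bw minus_closed by auto
  have "p n ?u = (p n c' \<ominus>\<^bsub>chain D n\<^esub> p n c) \<ominus>\<^bsub>chain D n\<^esub> bd D (n + 1) v"
    using c c' bw w by (simp add: p_minus minus_closed chain_map_bd_Suc[OF p])
  also have "\<dots> = \<zero>\<^bsub>chain D n\<^esub>"
    using v kmod_minus_eq_zero_iff[OF complex_kmod[OF D]] linear_maps_closed[OF complex_bd_Suc[OF D] v(1)] by simp
  finally have pu: "p n ?u = \<zero>\<^bsub>chain D n\<^esub>" .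
  have "bd C n c' \<ominus>\<^bsub>chain C (n - 1)\<^esub> bd C n c \<in> carrier (chain C (n - 1))"
    using c c' linear_maps_closed[OF complex_bd[OF C]] by (intro minus_closed) auto
  then have "bd C n ?u = bd C n c' \<ominus>\<^bsub>chain C (n - 1)\<^esub> bd C n c"
    using c c' bw w by (simp add: bd_minus minus_closed complex_bd_bd_Suc[OF C] kmod_minus_zero[OF complex_kmod[OF C]])
  then show ?thesis
    using u pu c cyc c'(1) by (auto simp: ker_hom_class_eq_iff bd_lift_cycle intro!: bexI[of _ ?u])
qed

lemma connecting_hom_class:
  assumes c: "c \<in> carrier (chain C n)" "p n c \<in> cycles D n"
  shows "connecting C D p n (hom_class D n (p n c)) = hom_class K (n - 1) (bd C n c)"
proof -
  let ?L = "{c' \<in> carrier (chain C n). p n c' \<in> hom_class D n (p n c)}"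
  have "c \<in> ?L" using c mem_hom_class_iff[OF D] by auto
  moreover have "hom_class K (n - 1) (bd C n c') = hom_class K (n - 1) (bd C n c)" if "c' \<in> ?L" for c'
    using connecting_class_unique[OF c] that by blast
  ultimately have "(\<lambda>c. hom_class K (n - 1) (bd C n c)) ` ?L = {hom_class K (n - 1) (bd C n c)}"
    by (smt (verit, ccfv_SIG) image_cong image_constant)
  then show ?thesis unfolding connecting_def by (metis the_elem_eq)
qed

lemma homology_D_cases:
  assumes "z \<in> carrier (homology D n)"
  obtains c where "c \<in> carrier (chain C n)" "p n c \<in> cycles D n" "z = hom_class D n (p n c)"
proof -
  obtain x where "x \<in> cycles D n" "z = hom_class D n x" using homology_cases[OF D assms] .
  moreover then obtain c where "c \<in> carrier (chain C n)" "x = p n c"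
    using surj[of n] by (auto simp: cycles_iff)
  ultimately show ?thesis using that by blast
qed

lemma connecting_linear: "connecting C D p n \<in> linear_maps (homology D n) (homology K (n - 1))"
proof (rule linear_mapsI)
  interpret Cn: Module.module scalar_ring "chain C n" by (rule complex_kmod[OF C])
  note pl = linear_maps_add[OF chain_map_linear[OF p]] linear_maps_smult[OF chain_map_linear[OF p]]
  note bl = linear_maps_add[OF complex_bd[OF C]] linear_maps_smult[OF complex_bd[OF C]]
  fix x assume "x \<in> carrier (homology D n)"
  then obtain c where c: "c \<in> carrier (chain C n)" "p n c \<in> cycles D n" "x = hom_class D n (p n c)"
    by (rule homology_D_cases)
  show "connecting C D p n x \<in> carrier (homology K (n - 1))"
    using c by (simp add: connecting_hom_class hom_class_closed[OF ker_complex] bd_lift_cycle)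
  show "connecting C D p n (a \<odot>\<^bsub>homology D n\<^esub> x) = a \<odot>\<^bsub>homology K (n - 1)\<^esub> connecting C D p n x" for a
  proof -
    have "p n (a \<odot>\<^bsub>chain C n\<^esub> c) \<in> cycles D n"
      using c submodule_smult[OF complex_kmod[OF D] cycles_submodule[OF D]] by (simp add: pl)
    moreover have "a \<odot>\<^bsub>homology D n\<^esub> x = hom_class D n (p n (a \<odot>\<^bsub>chain C n\<^esub> c))"
      using c by (simp add: pl hom_class_smult[OF D])
    ultimately show ?thesis
      using c hom_class_smult[OF ker_complex bd_lift_cycle[OF c(1,2)], of a] kmod_smult_closed[OF complex_kmod[OF C]]
      by (simp add: connecting_hom_class bl)
  qed
  fix y assume "y \<in> carrier (homology D n)"
  then obtain d where d: "d \<in> carrier (chain C n)" "p n d \<in> cycles D n" "y = hom_class D n (p n d)"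
    by (rule homology_D_cases)
  have "p n (c \<oplus>\<^bsub>chain C n\<^esub> d) \<in> cycles D n"
    using c d submodule_add[OF complex_kmod[OF D] cycles_submodule[OF D]] by (simp add: pl)
  moreover have "x \<oplus>\<^bsub>homology D n\<^esub> y = hom_class D n (p n (c \<oplus>\<^bsub>chain C n\<^esub> d))"
    using c d by (simp add: pl hom_class_add[OF D])
  ultimately show "connecting C D p n (x \<oplus>\<^bsub>homology D n\<^esub> y) = connecting C D p n x \<oplus>\<^bsub>homology K (n - 1)\<^esub> connecting C D p n y"
    using c d hom_class_add[OF ker_complex bd_lift_cycle[OF c(1,2)] bd_lift_cycle[OF d(1,2)]]
    by (simp add: connecting_hom_class bl)
qed

lemmas incl_hom_class = hom_map_hom_class[OF ker_complex C ker_incl_compatible]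
lemmas p_hom_class = hom_map_hom_class[OF C D p_compatible]
lemmas incl_linear = hom_map_linear[OF ker_complex C ker_incl_compatible]
lemmas p_linear = hom_map_linear[OF C D p_compatible]

lemma exact_at_C:
  "hom_map C n (\<lambda>x. x) ` carrier (homology K n) = a_kernel (homology C n) (homology D n) (hom_map D n (p n))"
proof (intro equalityI subsetI)
  fix z assume "z \<in> hom_map C n (\<lambda>x. x) ` carrier (homology K n)"
  then obtain w where w: "w \<in> carrier (homology K n)" "z = hom_map C n (\<lambda>x. x) w" by auto
  then obtain x where x: "x \<in> cycles K n" "w = hom_class K n x" using homology_cases[OF ker_complex] by blast
  then have "z = hom_class C n x" "x \<in> cycles C n" "p n x = \<zero>\<^bsub>chain D n\<^esub>"
    using w incl_hom_class by (auto simp: ker_cycles_iff)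
  moreover from this have "hom_map D n (p n) z = hom_class D n \<zero>\<^bsub>chain D n\<^esub>" using p_hom_class by simp
  moreover have "\<zero>\<^bsub>chain D n\<^esub> \<in> boundaries D n"
    by (rule submodule_zero[OF complex_kmod[OF D] boundaries_submodule[OF D]])
  moreover from this have "hom_class D n \<zero>\<^bsub>chain D n\<^esub> = \<zero>\<^bsub>homology D n\<^esub>"
    using hom_class_eq_zero_iff[OF D] boundaries_subset_cycles[OF D] by blast
  ultimately show "z \<in> a_kernel (homology C n) (homology D n) (hom_map D n (p n))"
    using hom_class_closed[OF C] by (auto simp: a_kernel_def')
next
  fix z assume "z \<in> a_kernel (homology C n) (homology D n) (hom_map D n (p n))"
  then have z: "z \<in> carrier (homology C n)" "hom_map D n (p n) z = \<zero>\<^bsub>homology D n\<^esub>" by (auto simp: a_kernel_def')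
  obtain x where x: "x \<in> cycles C n" "z = hom_class C n x" using homology_cases[OF C z(1)] .
  then have "hom_class D n (p n x) = \<zero>\<^bsub>homology D n\<^esub>" using z(2) p_hom_class by simp
  then have "p n x \<in> boundaries D n"
    using hom_class_eq_zero_iff[OF D homology_compatible_cycles[OF p_compatible x(1)]] by simp
  then obtain v where v: "v \<in> carrier (chain D (n + 1))" "p n x = bd D (n + 1) v" by (auto simp: boundaries_iff)
  obtain w where w: "w \<in> carrier (chain C (n + 1))" "v = p (n + 1) w" using surj[of "n + 1"] v(1) by auto
  have bw: "bd C (n + 1) w \<in> carrier (chain C n)" using linear_maps_closed[OF complex_bd_Suc[OF C]] w by auto
  let ?y = "x \<ominus>\<^bsub>chain C n\<^esub> bd C (n + 1) w"
  have xC: "x \<in> carrier (chain C n)" using x by (simp add: cycles_iff)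
  have bwZ: "bd C (n + 1) w \<in> cycles C n" using bw w complex_bd_bd_Suc[OF C] by (simp add: cycles_iff)
  have yZ: "?y \<in> cycles C n"
    by (rule submodule_minus_closed[OF complex_kmod[OF C] cycles_submodule[OF C] x(1) bwZ])
  have "p n ?y = \<zero>\<^bsub>chain D n\<^esub>"
    using xC bw w v kmod_minus_eq_zero_iff[OF complex_kmod[OF D]] linear_maps_closed[OF complex_bd_Suc[OF D] v(1)]
    by (simp add: p_minus chain_map_bd_Suc[OF p])
  then have yK: "?y \<in> cycles K n" using yZ by (simp add: ker_cycles_iff)
  have "x \<ominus>\<^bsub>chain C n\<^esub> ?y = bd C (n + 1) w"
    by (rule kmod_minus_minus[OF complex_kmod[OF C] xC bw])
  then have "z = hom_class C n ?y"
    using hom_class_eqI[OF C x(1) yZ w(1)] x(2) by simp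
  then show "z \<in> hom_map C n (\<lambda>x. x) ` carrier (homology K n)"
    using incl_hom_class[OF yK] hom_class_closed[OF ker_complex yK] by force
qed

lemma exact_at_D:
  "hom_map D n (p n) ` carrier (homology C n) = a_kernel (homology D n) (homology K (n - 1)) (connecting C D p n)"
proof (intro equalityI subsetI)
  fix z assume "z \<in> hom_map D n (p n) ` carrier (homology C n)"
  then obtain w where w: "w \<in> carrier (homology C n)" "z = hom_map D n (p n) w" by auto
  obtain x where x: "x \<in> cycles C n" "w = hom_class C n x" using homology_cases[OF C w(1)] .
  have z: "z = hom_class D n (p n x)" using w x p_hom_class by simp
  have px: "p n x \<in> cycles D n" using homology_compatible_cycles[OF p_compatible x(1)] .
  have "connecting C D p n z = hom_class K (n - 1) \<zero>\<^bsub>chain C (n - 1)\<^esub>"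
    using x px z by (simp add: connecting_hom_class cycles_iff)
  also have "\<dots> = \<zero>\<^bsub>homology K (n - 1)\<^esub>"
    using submodule_zero[OF complex_kmod[OF ker_complex] boundaries_submodule[OF ker_complex], of "n - 1"]
      hom_class_eq_zero_iff[OF ker_complex] boundaries_subset_cycles[OF ker_complex] by auto
  finally show "z \<in> a_kernel (homology D n) (homology K (n - 1)) (connecting C D p n)"
    using z px hom_class_closed[OF D] by (auto simp: a_kernel_def')
next
  fix z assume "z \<in> a_kernel (homology D n) (homology K (n - 1)) (connecting C D p n)"
  then have z: "z \<in> carrier (homology D n)" "connecting C D p n z = \<zero>\<^bsub>homology K (n - 1)\<^esub>" by (auto simp: a_kernel_def')
  obtain c where c: "c \<in> carrier (chain C n)" "p n c \<in> cycles D n" "z = hom_class D n (p n c)"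
    using homology_D_cases[OF z(1)] .
  have "bd C n c \<in> boundaries K (n - 1)"
    using z(2) c hom_class_eq_zero_iff[OF ker_complex bd_lift_cycle[OF c(1,2)]] by (simp add: connecting_hom_class)
  then obtain u where u: "u \<in> carrier (chain C n)" "p n u = \<zero>\<^bsub>chain D n\<^esub>" "bd C n c = bd C n u"
    by (auto simp: ker_boundaries_iff)
  let ?y = "c \<ominus>\<^bsub>chain C n\<^esub> u"
  have "bd C n ?y = \<zero>\<^bsub>chain C (n - 1)\<^esub>"
    using c u kmod_minus_eq_zero_iff[OF complex_kmod[OF C]] linear_maps_closed[OF complex_bd[OF C]]
    by (simp add: bd_minus)
  then have yZ: "?y \<in> cycles C n" using minus_closed[OF c(1) u(1)] by (simp add: cycles_iff)
  have "p n ?y = p n c"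
    using c u linear_maps_closed[OF chain_map_linear[OF p] c(1)] by (simp add: p_minus kmod_minus_zero[OF complex_kmod[OF D]])
  then show "z \<in> hom_map D n (p n) ` carrier (homology C n)"
    using c(3) p_hom_class[OF yZ] hom_class_closed[OF C yZ] by force
qed

lemma exact_at_K:
  "connecting C D p n ` carrier (homology D n)
    = a_kernel (homology K (n - 1)) (homology C (n - 1)) (hom_map C (n - 1) (\<lambda>x. x))"
proof (intro equalityI subsetI)
  fix z assume "z \<in> connecting C D p n ` carrier (homology D n)"
  then obtain c where c: "c \<in> carrier (chain C n)" "p n c \<in> cycles D n" "z = hom_class K (n - 1) (bd C n c)"
    using homology_D_cases connecting_hom_class by (metis (no_types, lifting) imageE)
  have b: "bd C n c \<in> cycles K (n - 1)" by (rule bd_lift_cycle[OF c(1,2)])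
  have "bd C n c \<in> boundaries C (n - 1)" using c(1) by (auto simp: boundaries_iff)
  then have "hom_map C (n - 1) (\<lambda>x. x) z = \<zero>\<^bsub>homology C (n - 1)\<^esub>"
    using hom_class_eq_zero_iff[OF C, of "bd C n c" "n - 1"] b
    by (simp add: c(3) incl_hom_class[OF b] ker_cycles_iff)
  then show "z \<in> a_kernel (homology K (n - 1)) (homology C (n - 1)) (hom_map C (n - 1) (\<lambda>x. x))"
    using c(3) hom_class_closed[OF ker_complex b] by (auto simp: a_kernel_def')
next
  fix z assume "z \<in> a_kernel (homology K (n - 1)) (homology C (n - 1)) (hom_map C (n - 1) (\<lambda>x. x))"
  then have z: "z \<in> carrier (homology K (n - 1))" "hom_map C (n - 1) (\<lambda>x. x) z = \<zero>\<^bsub>homology C (n - 1)\<^esub>"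
    by (auto simp: a_kernel_def')
  obtain x where x: "x \<in> cycles K (n - 1)" "z = hom_class K (n - 1) x" using homology_cases[OF ker_complex z(1)] .
  have xC: "x \<in> cycles C (n - 1)" and px: "p (n - 1) x = \<zero>\<^bsub>chain D (n - 1)\<^esub>" using x(1) by (auto simp: ker_cycles_iff)
  have "x \<in> boundaries C (n - 1)"
    using z(2) x incl_hom_class[OF x(1)] hom_class_eq_zero_iff[OF C xC] by simp
  then obtain c where c: "c \<in> carrier (chain C n)" "x = bd C n c" by (auto simp: boundaries_iff)
  have pc: "p n c \<in> cycles D n"
    using c px chain_map_bd[OF p c(1)] linear_maps_closed[OF chain_map_linear[OF p] c(1)] by (simp add: cycles_iff)
  then show "z \<in> connecting C D p n ` carrier (homology D n)"
    using x(2) c connecting_hom_class[OF c(1) pc] hom_class_closed[OF D pc] by force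
qed

theorem is_les_ses_les: "is_les (ses_les C D p)"
  unfolding is_les_def
  by (simp add: ses_les_def homology_kmod[OF C] homology_kmod[OF D] homology_kmod[OF ker_complex]
      incl_linear p_linear connecting_linear exact_at_C exact_at_D exact_at_K)

end

section \<open>Maps of short exact sequences\<close>

locale short_exact_map = S: short_exact C D p + S': short_exact C' D' p'
  for C :: "('k::field, 'm) chain_cx" and D :: "('k, 'n) chain_cx" and p
    and C' :: "('k, 'm1) chain_cx" and D' :: "('k, 'n1) chain_cx" and p' +
  fixes f :: "int \<Rightarrow> 'm \<Rightarrow> 'm1" and g :: "int \<Rightarrow> 'n \<Rightarrow> 'n1"
  assumes f: "is_chain_map C C' f" and g: "is_chain_map D D' g"
    and square: "x \<in> carrier (chain C n) \<Longrightarrow> g n (p n x) = p' n (f n x)"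
begin

lemma ker_chain_map: "is_chain_map S.K S'.K f"
proof -
  have "g n \<zero>\<^bsub>chain D n\<^esub> = \<zero>\<^bsub>chain D' n\<^esub>" for n
    by (intro linear_maps_zero complex_kmod S.D S'.D chain_map_linear[OF g])
  then have "p' n (f n x) = \<zero>\<^bsub>chain D' n\<^esub>" if "x \<in> carrier (chain C n)" "p n x = \<zero>\<^bsub>chain D n\<^esub>" for n x
    using that square[OF that(1)] by simp
  then show ?thesis
    using linear_maps_closed[OF chain_map_linear[OF f]] linear_maps_add[OF chain_map_linear[OF f]]
      linear_maps_smult[OF chain_map_linear[OF f]] chain_map_bd[OF f]
    unfolding is_chain_map_def
    by (intro allI conjI linear_mapsI) (auto simp: S.ker_carrier_iff S'.ker_carrier_iff)
qed

lemma f_compatible: "homology_compatible C n C' n (f n)"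
  by (rule homology_compatible_chain_map[OF S.C S'.C f])

lemma g_compatible: "homology_compatible D n D' n (g n)"
  by (rule homology_compatible_chain_map[OF S.D S'.D g])

lemma ker_compatible: "homology_compatible S.K n S'.K n (f n)"
  by (rule homology_compatible_chain_map[OF S.ker_complex S'.ker_complex ker_chain_map])

theorem is_les_map_ses_les:
  "is_les_map (ses_les C D p) (ses_les C' D' p')
    (\<lambda>n. hom_map S'.K n (f n)) (\<lambda>n. hom_map C' n (f n)) (\<lambda>n. hom_map D' n (g n))"
proof -
  note f_class = hom_map_hom_class[OF S.C S'.C f_compatible]
  note g_class = hom_map_hom_class[OF S.D S'.D g_compatible]
  note k_class = hom_map_hom_class[OF S.ker_complex S'.ker_complex ker_compatible]
  have sq1: "hom_map C' n (f n) (hom_map C n (\<lambda>x. x) z) = hom_map C' n (\<lambda>x. x) (hom_map S'.K n (f n) z)"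
    if z: "z \<in> carrier (homology S.K n)" for n z
  proof -
    obtain x where x: "x \<in> cycles S.K n" "z = hom_class S.K n x" using homology_cases[OF S.ker_complex z] .
    then have "x \<in> cycles C n" "f n x \<in> cycles S'.K n"
      using homology_compatible_cycles[OF ker_compatible] by (auto simp: S.ker_cycles_iff)
    then show ?thesis using x by (simp add: S.incl_hom_class S'.incl_hom_class f_class k_class)
  qed
  have sq2: "hom_map D' n (g n) (hom_map D n (p n) z) = hom_map D' n (p' n) (hom_map C' n (f n) z)"
    if z: "z \<in> carrier (homology C n)" for n z
  proof -
    obtain x where x: "x \<in> cycles C n" "z = hom_class C n x" using homology_cases[OF S.C z] .
    moreover have "p n x \<in> cycles D n" "f n x \<in> cycles C' n"
      using x homology_compatible_cycles[OF S.p_compatible] homology_compatible_cycles[OF f_compatible] by auto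
    ultimately show ?thesis
      using square[of x n] by (simp add: S.p_hom_class S'.p_hom_class f_class g_class cycles_iff)
  qed
  have sq3: "hom_map S'.K (n - 1) (f (n - 1)) (connecting C D p n z) = connecting C' D' p' n (hom_map D' n (g n) z)"
    if z: "z \<in> carrier (homology D n)" for n z
  proof -
    obtain c where c: "c \<in> carrier (chain C n)" "p n c \<in> cycles D n" "z = hom_class D n (p n c)"
      using S.homology_D_cases[OF z] .
    have fc: "f n c \<in> carrier (chain C' n)" using linear_maps_closed[OF chain_map_linear[OF f] c(1)] .
    have gc: "p' n (f n c) \<in> cycles D' n"
      using homology_compatible_cycles[OF g_compatible c(2)] square[OF c(1)] by simp
    have "connecting C' D' p' n (hom_map D' n (g n) z) = connecting C' D' p' n (hom_class D' n (p' n (f n c)))"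
      using c square[OF c(1)] by (simp add: g_class)
    also have "\<dots> = hom_class S'.K (n - 1) (bd C' n (f n c))" by (rule S'.connecting_hom_class[OF fc gc])
    also have "\<dots> = hom_map S'.K (n - 1) (f (n - 1)) (connecting C D p n z)"
      using c by (simp add: S.connecting_hom_class k_class S.bd_lift_cycle chain_map_bd[OF f])
    finally show ?thesis ..
  qed
  show ?thesis
    unfolding is_les_map_def
    by (simp add: ses_les_def sq1 sq2 sq3 hom_map_linear[OF S.C S'.C f_compatible]
        hom_map_linear[OF S.D S'.D g_compatible] hom_map_linear[OF S.ker_complex S'.ker_complex ker_compatible])
qed

end

section \<open>Transport of long exact sequences along isomorphisms\<close>

text \<open>In the lower row, cyclic homology takes the place of the homology of the kernel of \<open>pi2\<close>,
  along Connes' isomorphism.\<close>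

definition transport_les ::
  "('k::field, 'x, 'y, 'z) les \<Rightarrow> (int \<Rightarrow> ('k, 'u) module) \<Rightarrow> (int \<Rightarrow> 'u \<Rightarrow> 'x) \<Rightarrow> ('k, 'u, 'y, 'z) les"
  where "transport_les L U i =
    \<lparr>X_les = U, Y_les = Y_les L, Z_les = Z_les L,
     XY_les = (\<lambda>n. XY_les L n \<circ> i n), YZ_les = YZ_les L,
     ZX_les = (\<lambda>n. inv_into (carrier (U (n - 1))) (i (n - 1)) \<circ> ZX_les L n)\<rparr>"

lemma inv_into_linear:
  assumes "kmod M" "i \<in> linear_maps M N" "bij_betw i (carrier M) (carrier N)"
  shows "inv_into (carrier M) i \<in> linear_maps N M"
proof -
  interpret M: Module.module scalar_ring M by fact
  let ?j = "inv_into (carrier M) i"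
  have j: "?j y \<in> carrier M" "i (?j y) = y" if "y \<in> carrier N" for y
    using bij_betwE[OF bij_betw_inv_into[OF assms(3)]] bij_betw_inv_into_right[OF assms(3)] that by auto
  have ji: "?j (i x) = x" if "x \<in> carrier M" for x
    using bij_betw_inv_into_left[OF assms(3) that] .
  show ?thesis
  proof (rule linear_mapsI)
    show "?j (x \<oplus>\<^bsub>N\<^esub> y) = ?j x \<oplus>\<^bsub>M\<^esub> ?j y" if "x \<in> carrier N" "y \<in> carrier N" for x y
      using linear_maps_add[OF assms(2), of "?j x" "?j y"] that j ji[of "?j x \<oplus>\<^bsub>M\<^esub> ?j y"] by simp
    show "?j (c \<odot>\<^bsub>N\<^esub> x) = c \<odot>\<^bsub>M\<^esub> ?j x" if "x \<in> carrier N" for c x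
      using linear_maps_smult[OF assms(2), of "?j x" c] that j ji[of "c \<odot>\<^bsub>M\<^esub> ?j x"] kmod_smult_closed[OF assms(1)]
      by simp
  qed (rule j)
qed

locale les_transport =
  fixes L :: "('k::field, 'x, 'y, 'z) les" and U :: "int \<Rightarrow> ('k, 'u) module" and i :: "int \<Rightarrow> 'u \<Rightarrow> 'x"
  assumes L: "is_les L" and U: "kmod (U n)" and i_linear: "i n \<in> linear_maps (U n) (X_les L n)"
    and i_bij: "bij_betw (i n) (carrier (U n)) (carrier (X_les L n))"
begin

abbreviation "j n \<equiv> inv_into (carrier (U n)) (i n)"

lemma ij: "x \<in> carrier (X_les L n) \<Longrightarrow> i n (j n x) = x"
  using bij_betw_inv_into_right[OF i_bij] .

lemma ji: "u \<in> carrier (U n) \<Longrightarrow> j n (i n u) = u"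
  using bij_betw_inv_into_left[OF i_bij] .

lemma j_linear: "j n \<in> linear_maps (X_les L n) (U n)"
  by (rule inv_into_linear[OF U i_linear i_bij])

lemma j_closed: "x \<in> carrier (X_les L n) \<Longrightarrow> j n x \<in> carrier (U n)"
  using linear_maps_closed[OF j_linear] .

lemma i_closed: "u \<in> carrier (U n) \<Longrightarrow> i n u \<in> carrier (X_les L n)"
  using linear_maps_closed[OF i_linear] .

lemma i_image: "i n ` carrier (U n) = carrier (X_les L n)"
  using bij_betw_imp_surj_on[OF i_bij] .

theorem is_les_transport_les: "is_les (transport_les L U i)"
proof -
  have l: "kmod (X_les L n)" "kmod (Y_les L n)" "kmod (Z_les L n)"
    "XY_les L n \<in> linear_maps (X_les L n) (Y_les L n)"
    "YZ_les L n \<in> linear_maps (Y_les L n) (Z_les L n)"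
    "ZX_les L n \<in> linear_maps (Z_les L n) (X_les L (n - 1))"
    "XY_les L n ` carrier (X_les L n) = a_kernel (Y_les L n) (Z_les L n) (YZ_les L n)"
    "YZ_les L n ` carrier (Y_les L n) = a_kernel (Z_les L n) (X_les L (n - 1)) (ZX_les L n)"
    "ZX_les L n ` carrier (Z_les L n) = a_kernel (X_les L (n - 1)) (Y_les L (n - 1)) (XY_les L (n - 1))" for n
    using L by (auto simp: is_les_def)
  have j0: "j m x = \<zero>\<^bsub>U m\<^esub> \<longleftrightarrow> x = \<zero>\<^bsub>X_les L m\<^esub>" if "x \<in> carrier (X_les L m)" for m x
    using ij[OF that] linear_maps_zero[OF l(1) U j_linear] linear_maps_zero[OF U l(1) i_linear] by metis
  have "a_kernel (Z_les L n) (U (n - 1)) (j (n - 1) \<circ> ZX_les L n)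
      = a_kernel (Z_les L n) (X_les L (n - 1)) (ZX_les L n)" for n
    using j0 linear_maps_closed[OF l(6)] by (auto simp: a_kernel_def')
  moreover have "j m ` a_kernel (X_les L m) (Y_les L m) (XY_les L m)
      = a_kernel (U m) (Y_les L m) (XY_les L m \<circ> i m)" for m
  proof (intro equalityI subsetI)
    fix u assume "u \<in> a_kernel (U m) (Y_les L m) (XY_les L m \<circ> i m)"
    then have "i m u \<in> a_kernel (X_les L m) (Y_les L m) (XY_les L m)" "u = j m (i m u)"
      using i_closed ji by (auto simp: a_kernel_def')
    then show "u \<in> j m ` a_kernel (X_les L m) (Y_les L m) (XY_les L m)" by blast
  qed (use j_closed ij in \<open>auto simp: a_kernel_def'\<close>)
  moreover have "(XY_les L n \<circ> i n) ` carrier (U n) = XY_les L n ` carrier (X_les L n)" for n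
    by (simp only: image_comp[symmetric] i_image)
  moreover have "(j (n - 1) \<circ> ZX_les L n) ` carrier (Z_les L n) = j (n - 1) ` (ZX_les L n ` carrier (Z_les L n))" for n
    by (rule image_comp[symmetric])
  moreover have "XY_les L n \<circ> i n \<in> linear_maps (U n) (Y_les L n)"
    "j (n - 1) \<circ> ZX_les L n \<in> linear_maps (Z_les L n) (U (n - 1))" for n
    using linear_maps_comp[OF i_linear l(4)] linear_maps_comp[OF l(6) j_linear] by (simp_all add: o_def)
  ultimately show ?thesis
    unfolding is_les_def transport_les_def using l U by simp
qed

lemma is_les_map_into_transport:
  assumes "is_les_map M L \<alpha> \<phi> \<theta>"
  shows "is_les_map M (transport_les L U i) (\<lambda>n. j n \<circ> \<alpha> n) \<phi> \<theta>"
proof -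
  have a: "\<alpha> n \<in> linear_maps (X_les M n) (X_les L n)" for n using assms by (auto simp: is_les_map_def)
  show ?thesis
    using assms linear_maps_comp[OF a j_linear] ij linear_maps_closed[OF a]
    by (auto simp: is_les_map_def transport_les_def o_def)
qed

end

lemma is_les_map_transport:
  assumes "les_transport L U i" "les_transport M V i'" "is_les_map L M \<alpha> \<phi> \<theta>"
    "\<And>n. \<beta> n \<in> linear_maps (U n) (V n)" "\<And>n u. u \<in> carrier (U n) \<Longrightarrow> i' n (\<beta> n u) = \<alpha> n (i n u)"
  shows "is_les_map (transport_les L U i) (transport_les M V i') \<beta> \<phi> \<theta>"
proof -
  interpret T: les_transport L U i by fact
  interpret T': les_transport M V i' by fact
  have ZX: "ZX_les L n z \<in> carrier (X_les L (n - 1))" if "z \<in> carrier (Z_les L n)" for n z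
    using T.L that unfolding is_les_def by (metis linear_maps_closed)
  have "\<beta> m (T.j m x) = T'.j m (\<alpha> m x)" if "x \<in> carrier (X_les L m)" for m x
  proof -
    have "i' m (\<beta> m (T.j m x)) = \<alpha> m x" using assms(5)[OF T.j_closed[OF that]] T.ij[OF that] by simp
    then show ?thesis using T'.ji[OF linear_maps_closed[OF assms(4) T.j_closed[OF that]]] by metis
  qed
  then show ?thesis
    using assms(3-5) T.i_closed ZX by (auto simp: is_les_map_def transport_les_def)
qed

section \<open>Linear maps between spaces of words\<close>

lemma lookup_fscale [simp]: "Poly_Mapping.lookup (fscale c x) w = c * Poly_Mapping.lookup x w"
  by (simp add: fscale_def Poly_Mapping.map.rep_eq when_def)

interpretation fv: vector_space "fscale :: 'k::field \<Rightarrow> ('w \<Rightarrow>\<^sub>0 'k) \<Rightarrow> ('w \<Rightarrow>\<^sub>0 'k)"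
  by unfold_locales (auto intro!: poly_mapping_eqI simp: lookup_add algebra_simps)

abbreviation lin :: "(('v \<Rightarrow>\<^sub>0 'k::field) \<Rightarrow> ('w \<Rightarrow>\<^sub>0 'k)) \<Rightarrow> bool"
  where "lin \<equiv> Vector_Spaces.linear fscale fscale"

lemma lin_iff: "lin F \<longleftrightarrow> (\<forall>x y. F (x + y) = F x + F y) \<and> (\<forall>c x. F (fscale c x) = fscale c (F x))"
  by (simp add: Vector_Spaces.linear_iff fv.vector_space_axioms)

lemma keys_fscale_subset: "Poly_Mapping.keys (fscale c x) \<subseteq> Poly_Mapping.keys x"
  by (auto simp: in_keys_iff)

lemma lin_ext_superset:
  assumes "finite S" "Poly_Mapping.keys x \<subseteq> S"
  shows "lin_ext f x = (\<Sum>w\<in>S. fscale (Poly_Mapping.lookup x w) (f w))"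
  unfolding lin_ext_def using assms by (intro sum.mono_neutral_left) (auto simp: in_keys_iff)

lemma lin_ext_fword [simp]: "lin_ext f (fword w) = f w"
  by (simp add: lin_ext_def fword_def)

lemma lin_lin_ext:
  fixes f :: "'v \<Rightarrow> 'w \<Rightarrow>\<^sub>0 'k::field"
  shows "lin (lin_ext f)"
  unfolding lin_iff
proof (intro conjI allI)
  fix x y :: "'v \<Rightarrow>\<^sub>0 'k" and c
  let ?S = "Poly_Mapping.keys x \<union> Poly_Mapping.keys y"
  have "Poly_Mapping.keys (x + y) \<subseteq> ?S" by (rule keys_add)
  then show "lin_ext f (x + y) = lin_ext f x + lin_ext f y"
    by (simp add: lin_ext_superset[of ?S] lookup_add fv.scale_left_distrib sum.distrib)
  show "lin_ext f (fscale c x) = fscale c (lin_ext f x)"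
    using keys_fscale_subset[of c x]
    by (simp add: lin_ext_superset[of "Poly_Mapping.keys x"] fv.scale_sum_right)
qed

lemma
  shows lin_ext_add: "lin_ext f (x + y) = lin_ext f x + lin_ext f y"
    and lin_ext_fscale: "lin_ext f (fscale c x) = fscale c (lin_ext f x)"
  using lin_lin_ext[of f] by (auto simp: lin_iff)

lemma lin_ext_zero: "lin_ext f 0 = 0"
  by (simp add: lin_ext_def)

lemma lin_ext_uminus: "lin_ext f (- x) = - lin_ext f x"
  using lin_ext_fscale[of f "- 1" x] by simp

lemma lin_ext_diff: "lin_ext f (x - y) = lin_ext f x - lin_ext f y"
  using lin_ext_add[of f x "- y"] by (simp add: lin_ext_uminus)

lemma lin_ext_sum: "lin_ext f (sum g S) = (\<Sum>i\<in>S. lin_ext f (g i))"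
  by (induction S rule: infinite_finite_induct) (auto simp: lin_ext_add lin_ext_zero)

lemmas lin_ext_simps [simp] =
  lin_ext_add lin_ext_fscale lin_ext_zero lin_ext_uminus lin_ext_diff lin_ext_sum

lemma lin_intros:
  shows lin_ident: "lin (\<lambda>x. x)"
    and lin_zero: "lin (\<lambda>_. 0)"
    and lin_ext_lin: "lin F \<Longrightarrow> lin (\<lambda>x. lin_ext f (F x))"
    and lin_add: "lin F \<Longrightarrow> lin G \<Longrightarrow> lin (\<lambda>x. F x + G x)"
    and lin_diff: "lin F \<Longrightarrow> lin G \<Longrightarrow> lin (\<lambda>x. F x - G x)"
    and lin_uminus: "lin F \<Longrightarrow> lin (\<lambda>x. - F x)"
    and lin_fscale: "lin F \<Longrightarrow> lin (\<lambda>x. fscale c (F x))"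
    and lin_sum: "(\<And>i. i \<in> S \<Longrightarrow> lin (H i)) \<Longrightarrow> lin (\<lambda>x. \<Sum>i\<in>S. H i x)"
  by (auto simp: lin_iff fv.scale_right_distrib fv.scale_right_diff_distrib fv.scale_left_commute
      sum.distrib fv.scale_sum_right simp del: fv.scale_scale)

abbreviation words :: "nat \<Rightarrow> ('a list \<Rightarrow>\<^sub>0 'k::field) set"
  where "words n \<equiv> carrier (word_module n)"

lemma words_iff: "x \<in> words n \<longleftrightarrow> (\<forall>w\<in>Poly_Mapping.keys x. length w = n)"
  by (simp add: word_module_def)

lemma word_module_simps [simp]:
  "\<zero>\<^bsub>word_module n\<^esub> = 0" "x \<oplus>\<^bsub>word_module n\<^esub> y = x + y" "c \<odot>\<^bsub>word_module n\<^esub> x = fscale c x"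
  by (simp_all add: word_module_def)

lemma words_subspace: "fv.subspace (words n :: ('a list \<Rightarrow>\<^sub>0 'k::field) set)"
  unfolding fv.subspace_def
proof (intro conjI ballI allI)
  fix x y :: "'a list \<Rightarrow>\<^sub>0 'k" and c assume x: "x \<in> words n"
  then show "fscale c x \<in> words n" using keys_fscale_subset[of c x] by (auto simp: words_iff)
  assume "y \<in> words n"
  with x show "x + y \<in> words n" using keys_add[of x y] by (auto simp: words_iff)
qed (simp add: words_iff)

lemma fword_in_words [simp]: "fword w \<in> words n \<longleftrightarrow> length w = n"
  by (simp add: words_iff fword_def)

lemma words_closed:
  shows words_zero: "0 \<in> words n"
    and words_add: "x \<in> words n \<Longrightarrow> y \<in> words n \<Longrightarrow> x + y \<in> words n"
    and words_diff: "x \<in> words n \<Longrightarrow> y \<in> words n \<Longrightarrow> x - y \<in> words n"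
    and words_uminus: "x \<in> words n \<Longrightarrow> - x \<in> words n"
    and words_fscale: "x \<in> words n \<Longrightarrow> fscale c x \<in> words n"
    and words_sum: "(\<And>i. i \<in> S \<Longrightarrow> h i \<in> words n) \<Longrightarrow> sum h S \<in> words n"
  by (intro fv.subspace_0 fv.subspace_add fv.subspace_diff fv.subspace_neg fv.subspace_scale fv.subspace_sum
      words_subspace; assumption)+

lemma word_expansion: "x = (\<Sum>w\<in>Poly_Mapping.keys x. fscale (Poly_Mapping.lookup x w) (fword w))"
proof (rule poly_mapping_eqI)
  fix k
  have "Poly_Mapping.lookup (fscale (Poly_Mapping.lookup x w) (fword w)) k
      = (if w = k then Poly_Mapping.lookup x k else 0)" for w
    by (simp add: fword_def lookup_single when_def)
  then show "Poly_Mapping.lookup x k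
      = Poly_Mapping.lookup (\<Sum>w\<in>Poly_Mapping.keys x. fscale (Poly_Mapping.lookup x w) (fword w)) k"
    by (simp add: lookup_sum in_keys_iff del: lookup_fscale)
qed

lemma lin_into_subspace:
  assumes "lin F" "fv.subspace S" "x \<in> words n" "\<And>w. length w = n \<Longrightarrow> F (fword w) \<in> S"
  shows "F x \<in> S"
proof -
  interpret F: Vector_Spaces.linear fscale fscale F by fact
  have "F x = (\<Sum>w\<in>Poly_Mapping.keys x. fscale (Poly_Mapping.lookup x w) (F (fword w)))"
    by (subst word_expansion[of x]) (simp only: F.sum F.scale)
  also have "\<dots> \<in> S"
    using assms(2-4) by (intro fv.subspace_sum fv.subspace_scale) (auto simp: words_iff)
  finally show ?thesis .
qed

lemma lin_into_subspace_UNIV: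
  assumes "lin F" "fv.subspace S" "\<And>w. F (fword w) \<in> S"
  shows "F x \<in> S"
proof -
  interpret F: Vector_Spaces.linear fscale fscale F by fact
  have "F x = (\<Sum>w\<in>Poly_Mapping.keys x. fscale (Poly_Mapping.lookup x w) (F (fword w)))"
    by (subst word_expansion[of x]) (simp only: F.sum F.scale)
  also have "\<dots> \<in> S"
    using assms(2,3) by (intro fv.subspace_sum fv.subspace_scale) auto
  finally show ?thesis .
qed

lemma lin_eq_on_words:
  assumes "lin F" "lin G" "x \<in> words n" "\<And>w. length w = n \<Longrightarrow> F (fword w) = G (fword w)"
  shows "F x = G x"
  using lin_into_subspace[OF lin_diff[OF assms(1,2)] fv.subspace_single_0 assms(3)] assms(4) by simp

lemma lin_eq:
  assumes "lin F" "lin G" "\<And>w. F (fword w) = G (fword w)"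
  shows "F x = G x"
  using lin_into_subspace_UNIV[OF lin_diff[OF assms(1,2)] fv.subspace_single_0] assms(3) by simp

lemma lin_span_into_subspace:
  assumes "lin F" "fv.subspace S" "x \<in> fv.span B" "\<And>b. b \<in> B \<Longrightarrow> F b \<in> S"
  shows "F x \<in> S"
proof -
  interpret F: Vector_Spaces.linear fscale fscale F by fact
  have "fv.subspace {x. F x \<in> S}"
    using assms(2) by (auto simp: fv.subspace_def F.add F.scale)
  then have "fv.span B \<subseteq> {x. F x \<in> S}" using assms(4) by (intro fv.span_minimal) auto
  then show ?thesis using assms(3) by auto
qed

lemma lin_ext_words:
  assumes "x \<in> words m" "\<And>w. length w = m \<Longrightarrow> f w \<in> words n"
  shows "lin_ext f x \<in> words n"
  by (rule lin_into_subspace[OF lin_lin_ext words_subspace assms(1)]) (simp add: assms(2))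

lemma lin_ext_cong:
  assumes "x \<in> words m" "\<And>w. length w = m \<Longrightarrow> f w = g w"
  shows "lin_ext f x = lin_ext g x"
  by (rule lin_eq_on_words[OF lin_lin_ext lin_lin_ext assms(1)]) (simp add: assms(2))

abbreviation cons :: "'a \<Rightarrow> ('a list \<Rightarrow>\<^sub>0 'k::field) \<Rightarrow> 'a list \<Rightarrow>\<^sub>0 'k"
  where "cons a \<equiv> lin_ext (\<lambda>w. fword (a # w))"

abbreviation snoc :: "'a \<Rightarrow> ('a list \<Rightarrow>\<^sub>0 'k::field) \<Rightarrow> 'a list \<Rightarrow>\<^sub>0 'k"
  where "snoc a \<equiv> lin_ext (\<lambda>w. fword (w @ [a]))"

lemma cons_snoc: "cons a (snoc b x) = snoc b (cons a x)"
  by (rule lin_eq) (auto intro!: lin_intros)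

lemma cons_words: "x \<in> words n \<Longrightarrow> cons a x \<in> words (Suc n)"
  by (rule lin_ext_words) auto

lemma snoc_words: "x \<in> words n \<Longrightarrow> snoc a x \<in> words (Suc n)"
  by (rule lin_ext_words) auto

section \<open>Tensor powers\<close>

text \<open>The relations of all tensor powers at once, so that a formula on words is compared with the
  relations only once and not in every degree. Additivity and homogeneity are merged for the same
  reason.\<close>

definition tensor_rels :: "('k::field \<Rightarrow> 'a::ab_group_add \<Rightarrow> 'a) \<Rightarrow> ('a list \<Rightarrow>\<^sub>0 'k) set"
  where "tensor_rels sc = fv.span
    {fword (u @ (a + sc c b) # v) - fword (u @ a # v) - fscale c (fword (u @ b # v)) | u v a b c. True}"

lemma tensor_rels_subspace: "fv.subspace (tensor_rels sc)"
  by (simp add: tensor_rels_def)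

lemma tensor_rels_closed:
  shows tensor_rels_zero [simp]: "0 \<in> tensor_rels sc"
    and tensor_rels_add: "x \<in> tensor_rels sc \<Longrightarrow> y \<in> tensor_rels sc \<Longrightarrow> x + y \<in> tensor_rels sc"
    and tensor_rels_diff: "x \<in> tensor_rels sc \<Longrightarrow> y \<in> tensor_rels sc \<Longrightarrow> x - y \<in> tensor_rels sc"
    and tensor_rels_uminus: "x \<in> tensor_rels sc \<Longrightarrow> - x \<in> tensor_rels sc"
    and tensor_rels_fscale: "x \<in> tensor_rels sc \<Longrightarrow> fscale c x \<in> tensor_rels sc"
    and tensor_rels_sum: "(\<And>i. i \<in> S \<Longrightarrow> h i \<in> tensor_rels sc) \<Longrightarrow> sum h S \<in> tensor_rels sc"
  by (intro fv.subspace_0 fv.subspace_add fv.subspace_diff fv.subspace_neg fv.subspace_scale fv.subspace_sum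
      tensor_rels_subspace; assumption)+

lemma tensor_rels_gen:
  "fword (u @ (a + sc c b) # v) - fword (u @ a # v) - fscale c (fword (u @ b # v)) \<in> tensor_rels sc"
  unfolding tensor_rels_def by (rule fv.span_base) blast

text \<open>All computations take place on words. This relation says that two combinations of words
  represent the same tensor.\<close>

definition tensor_eq :: "('k::field \<Rightarrow> 'a::ab_group_add \<Rightarrow> 'a) \<Rightarrow> ('a list \<Rightarrow>\<^sub>0 'k) \<Rightarrow> ('a list \<Rightarrow>\<^sub>0 'k) \<Rightarrow> bool"
  where "tensor_eq sc x y \<longleftrightarrow> x - y \<in> tensor_rels sc"

lemma tensor_eq_refl [simp]: "tensor_eq sc x x"
  by (simp add: tensor_eq_def)

lemma tensor_eq_sym: "tensor_eq sc x y \<Longrightarrow> tensor_eq sc y x"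
  using tensor_rels_uminus[of "x - y" sc] by (simp add: tensor_eq_def)

lemma tensor_eq_trans [trans]: "tensor_eq sc x y \<Longrightarrow> tensor_eq sc y z \<Longrightarrow> tensor_eq sc x z"
  using tensor_rels_add[of "x - y" sc "y - z"] by (simp add: tensor_eq_def)

lemma tensor_eq_eq_trans [trans]:
  "x = y \<Longrightarrow> tensor_eq sc y z \<Longrightarrow> tensor_eq sc x z" "tensor_eq sc x y \<Longrightarrow> y = z \<Longrightarrow> tensor_eq sc x z"
  by simp_all

lemma tensor_eq_add: "tensor_eq sc x y \<Longrightarrow> tensor_eq sc x' y' \<Longrightarrow> tensor_eq sc (x + x') (y + y')"
  using tensor_rels_add[of "x - y" sc "x' - y'"] by (simp add: tensor_eq_def algebra_simps)

lemma tensor_eq_diff: "tensor_eq sc x y \<Longrightarrow> tensor_eq sc x' y' \<Longrightarrow> tensor_eq sc (x - x') (y - y')"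
  using tensor_rels_diff[of "x - y" sc "x' - y'"] by (simp add: tensor_eq_def algebra_simps)

lemma tensor_eq_fscale: "tensor_eq sc x y \<Longrightarrow> tensor_eq sc (fscale c x) (fscale c y)"
  using tensor_rels_fscale[of "x - y" sc c] by (simp add: tensor_eq_def fv.scale_right_diff_distrib)

text \<open>Linearity in one letter, up to the relations of the target. A formula on words descends to
  tensors if it is linear in every letter in this sense.\<close>

definition mlin :: "('k::field \<Rightarrow> 'a::ab_group_add \<Rightarrow> 'a) \<Rightarrow> ('k \<Rightarrow> 'b::ab_group_add \<Rightarrow> 'b) \<Rightarrow> ('a \<Rightarrow> 'b list \<Rightarrow>\<^sub>0 'k) \<Rightarrow> bool"
  where "mlin sc sc' g \<longleftrightarrow> (\<forall>a b c. tensor_eq sc' (g (a + sc c b)) (g a + fscale c (g b)))"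

definition descends :: "('k::field \<Rightarrow> 'a::ab_group_add \<Rightarrow> 'a) \<Rightarrow> ('k \<Rightarrow> 'b::ab_group_add \<Rightarrow> 'b) \<Rightarrow> ('a list \<Rightarrow> 'b list \<Rightarrow>\<^sub>0 'k) \<Rightarrow> bool"
  where "descends sc sc' f \<longleftrightarrow> (\<forall>x\<in>tensor_rels sc. lin_ext f x \<in> tensor_rels sc')"

lemma descendsI:
  assumes "\<And>u v. mlin sc sc' (\<lambda>a. f (u @ a # v))"
  shows "descends sc sc' f"
  unfolding descends_def
proof
  fix x assume x: "x \<in> tensor_rels sc"
  show "lin_ext f x \<in> tensor_rels sc'"
    by (rule lin_span_into_subspace[OF lin_lin_ext tensor_rels_subspace x[unfolded tensor_rels_def]])
      (use assms in \<open>force simp: mlin_def tensor_eq_def algebra_simps\<close>)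
qed

lemma descends_eq: "descends sc sc' f \<Longrightarrow> tensor_eq sc x y \<Longrightarrow> tensor_eq sc' (lin_ext f x) (lin_ext f y)"
  unfolding descends_def tensor_eq_def by (metis lin_ext_diff)

lemma mlin_word: "mlin sc sc (\<lambda>a. fword (u @ a # v))"
  using tensor_rels_gen[of u _ sc _ _ v] by (auto simp: mlin_def tensor_eq_def algebra_simps)

lemma mlin_intros:
  shows mlin_zero: "mlin sc sc' (\<lambda>_. 0)"
    and mlin_add: "mlin sc sc' g \<Longrightarrow> mlin sc sc' h \<Longrightarrow> mlin sc sc' (\<lambda>a. g a + h a)"
    and mlin_diff: "mlin sc sc' g \<Longrightarrow> mlin sc sc' h \<Longrightarrow> mlin sc sc' (\<lambda>a. g a - h a)"
    and mlin_fscale: "mlin sc sc' g \<Longrightarrow> mlin sc sc' (\<lambda>a. fscale d (g a))"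
proof -
  show "mlin sc sc' (\<lambda>_. 0)" by (simp add: mlin_def)
  show "mlin sc sc' (\<lambda>a. g a + h a)" if "mlin sc sc' g" "mlin sc sc' h" for g h
    unfolding mlin_def
  proof (intro allI)
    fix a b c
    from that have "tensor_eq sc' (g (a + sc c b) + h (a + sc c b)) ((g a + fscale c (g b)) + (h a + fscale c (h b)))"
      by (intro tensor_eq_add) (auto simp: mlin_def)
    then show "tensor_eq sc' (g (a + sc c b) + h (a + sc c b)) (g a + h a + fscale c (g b + h b))"
      by (simp add: fv.scale_right_distrib algebra_simps)
  qed
  show "mlin sc sc' (\<lambda>a. g a - h a)" if "mlin sc sc' g" "mlin sc sc' h" for g h
    unfolding mlin_def
  proof (intro allI)
    fix a b c
    from that have "tensor_eq sc' (g (a + sc c b) - h (a + sc c b)) ((g a + fscale c (g b)) - (h a + fscale c (h b)))"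
      by (intro tensor_eq_diff) (auto simp: mlin_def)
    then show "tensor_eq sc' (g (a + sc c b) - h (a + sc c b)) (g a - h a + fscale c (g b - h b))"
      by (simp add: fv.scale_right_diff_distrib algebra_simps)
  qed
  show "mlin sc sc' (\<lambda>a. fscale d (g a))" if "mlin sc sc' g" for g
    unfolding mlin_def
  proof (intro allI)
    fix a b c
    from that have "tensor_eq sc' (fscale d (g (a + sc c b))) (fscale d (g a + fscale c (g b)))"
      by (intro tensor_eq_fscale) (auto simp: mlin_def)
    then show "tensor_eq sc' (fscale d (g (a + sc c b))) (fscale d (g a) + fscale c (fscale d (g b)))"
      by (simp add: fv.scale_right_distrib mult.commute)
  qed
qed

lemma mlin_lin_ext:
  assumes "descends sc' sc'' f" "mlin sc sc' g"
  shows "mlin sc sc'' (\<lambda>a. lin_ext f (g a))"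
  unfolding mlin_def
proof (intro allI)
  fix a b c
  from assms(2) have "tensor_eq sc' (g (a + sc c b)) (g a + fscale c (g b))" by (simp add: mlin_def)
  from descends_eq[OF assms(1) this]
  show "tensor_eq sc'' (lin_ext f (g (a + sc c b))) (lin_ext f (g a) + fscale c (lin_ext f (g b)))" by simp
qed

lemma mlin_linear_arg:
  assumes "mlin sc' sc'' g" "\<And>a b c. h (a + sc c b) = h a + sc' c (h b)"
  shows "mlin sc sc'' (\<lambda>a. g (h a))"
  using assms by (simp add: mlin_def)

lemma mlin_zero_arg:
  assumes "vector_space sc" "mlin sc sc' g"
  shows "tensor_eq sc' (g 0) 0"
proof -
  interpret vector_space sc by fact
  have "tensor_eq sc' (g (0 + sc 1 0)) (g 0 + fscale 1 (g 0))" using assms(2) unfolding mlin_def by blast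
  then have "- g 0 \<in> tensor_rels sc'" by (simp add: tensor_eq_def)
  then show ?thesis using tensor_rels_uminus[of "- g 0" sc'] by (simp add: tensor_eq_def)
qed


abbreviation word_part :: "nat \<Rightarrow> ('a list \<Rightarrow>\<^sub>0 'k::field) \<Rightarrow> 'a list \<Rightarrow>\<^sub>0 'k"
  where "word_part n \<equiv> lin_ext (\<lambda>w. if length w = n then fword w else 0)"

lemma word_part_words: "x \<in> words n \<Longrightarrow> word_part n x = x"
  by (rule lin_eq_on_words[OF lin_lin_ext lin_ident]) auto

lemma word_part_tensor_rels: "x \<in> tensor_rels sc \<Longrightarrow> word_part n x \<in> tensor_rels sc"
proof -
  have "descends sc sc (\<lambda>w. if length w = n then fword w else 0)"
  proof (rule descendsI)
    show "mlin sc sc (\<lambda>a. if length (u @ a # v) = n then fword (u @ a # v) else 0)" for u v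
      using mlin_word[of sc u v] mlin_zero by (cases "length u + Suc (length v) = n") simp_all
  qed
  then show "x \<in> tensor_rels sc \<Longrightarrow> word_part n x \<in> tensor_rels sc" by (simp add: descends_def)
qed

lemma descends_cons: "descends sc sc (\<lambda>w. fword (x # w))"
  using mlin_word[of sc "x # u" for u] by (intro descendsI) auto

lemma descends_snoc: "descends sc sc (\<lambda>w. fword (w @ [x]))"
  using mlin_word[of sc _ "v @ [x]" for v] by (intro descendsI) auto

lemma mlin_of_words:
  assumes "\<And>w. mlin sc sc' (\<lambda>a. f a w)"
  shows "mlin sc sc' (\<lambda>a. lin_ext (f a) x)"
  unfolding mlin_def tensor_eq_def
proof (intro allI)
  fix a b c
  have "lin_ext (f (a + sc c b)) x - (lin_ext (f a) x + fscale c (lin_ext (f b) x)) \<in> tensor_rels sc'"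
    by (rule lin_into_subspace_UNIV[OF _ tensor_rels_subspace])
      (use assms in \<open>auto intro!: lin_intros simp: mlin_def tensor_eq_def\<close>)
  then show "lin_ext (f (a + sc c b)) x - (lin_ext (f a) x + fscale c (lin_ext (f b) x)) \<in> tensor_rels sc'" .
qed

lemma mlin_cons: "mlin sc sc (\<lambda>a. cons a x)"
  using mlin_word[of sc "[]"] by (intro mlin_of_words) auto

lemma mlin_snoc: "mlin sc sc (\<lambda>a. snoc a x)"
  using mlin_word[of sc _ "[]"] by (intro mlin_of_words) auto

lemma mlin_tensor_eq_add:
  assumes "vector_space sc" "mlin sc sc' g"
  shows "tensor_eq sc' (g (a + b)) (g a + g b)"
proof -
  interpret vector_space sc by fact
  have "tensor_eq sc' (g (a + sc 1 b)) (g a + fscale 1 (g b))" using assms(2) unfolding mlin_def by blast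
  then show ?thesis by simp
qed

text \<open>A relation between words of mixed lengths splits into relations in every single length,
  since every generating relation consists of words of one length. Homogeneity is the case \<open>a = 0\<close>
  of the merged relation, because a word with the letter 0 is itself a relation.\<close>

lemma tensor_rel_eq:
  assumes "vector_space sc"
  shows "tensor_rel sc n = tensor_rels sc \<inter> words n"
proof (intro equalityI subsetI IntI)
  interpret vector_space sc by fact
  let ?G = "{fword (u @ [a + b] @ v) - fword (u @ [a] @ v) - fword (u @ [b] @ v) | u v a b.
        length u + 1 + length v = n}
   \<union> {fword (u @ [sc c a] @ v) - fscale c (fword (u @ [a] @ v)) | u v a c.
        length u + 1 + length v = n}"
  fix x assume x: "x \<in> tensor_rel sc n"
  have "tensor_rel sc n \<subseteq> tensor_rels sc"
    unfolding tensor_rel_def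
  proof (rule fv.span_minimal)
    have 1: "fword (u @ (a + b) # v) - fword (u @ a # v) - fword (u @ b # v) \<in> tensor_rels sc" for u v a b
      using mlin_tensor_eq_add[OF assms mlin_word[of sc u v], of a b] by (simp add: tensor_eq_def algebra_simps)
    have 2: "fword (u @ sc c a # v) - fscale c (fword (u @ a # v)) \<in> tensor_rels sc" for u v a c
    proof -
      have "tensor_eq sc (fword (u @ (0 + sc c a) # v)) (fword (u @ 0 # v) + fscale c (fword (u @ a # v)))"
        using mlin_word[of sc u v] unfolding mlin_def by blast
      then have "tensor_eq sc (fword (u @ sc c a # v)) (0 + fscale c (fword (u @ a # v)))"
        using tensor_eq_add[OF mlin_zero_arg[OF assms mlin_word[of sc u v]] tensor_eq_refl] tensor_eq_trans by fastforce
      then show ?thesis by (simp add: tensor_eq_def)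
    qed
    show "?G \<subseteq> tensor_rels sc" using 1 2 by auto
  qed (rule tensor_rels_subspace)
  then show "x \<in> tensor_rels sc" using x by auto
  have "?G \<subseteq> words n" by (auto intro!: words_closed)
  from fv.span_minimal[OF this words_subspace] show "x \<in> words n"
    using x by (auto simp: tensor_rel_def)
next
  interpret vector_space sc by fact
  fix x assume x: "x \<in> tensor_rels sc \<inter> words n"
  \<comment> \<open>The projection to words of length \<open>n\<close> kills or fixes every generating relation.\<close>
  have "word_part n x \<in> tensor_rel sc n"
  proof (rule lin_span_into_subspace[OF lin_lin_ext _ IntD1[OF x, unfolded tensor_rels_def]])
    show "fv.subspace (tensor_rel sc n)" by (simp add: tensor_rel_def)
    have "fword (u @ (a + sc c b) # v) - fword (u @ a # v) - fscale c (fword (u @ b # v)) \<in> tensor_rel sc n"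
      if "length u + 1 + length v = n" for u v a b c
    proof -
      have "fword (u @ [a + sc c b] @ v) - fword (u @ [a] @ v) - fword (u @ [sc c b] @ v) \<in> tensor_rel sc n"
        unfolding tensor_rel_def using that by (intro fv.span_base) blast
      moreover have "fword (u @ [sc c b] @ v) - fscale c (fword (u @ [b] @ v)) \<in> tensor_rel sc n"
        unfolding tensor_rel_def using that by (intro fv.span_base) blast
      ultimately have "(fword (u @ [a + sc c b] @ v) - fword (u @ [a] @ v) - fword (u @ [sc c b] @ v))
          + (fword (u @ [sc c b] @ v) - fscale c (fword (u @ [b] @ v))) \<in> tensor_rel sc n"
        unfolding tensor_rel_def by (rule fv.span_add)
      then show ?thesis by simp
    qed
    moreover have "0 \<in> tensor_rel sc n" by (simp add: tensor_rel_def fv.span_zero)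
    ultimately show "word_part n z \<in> tensor_rel sc n"
      if "z \<in> {fword (u @ (a + sc c b) # v) - fword (u @ a # v) - fscale c (fword (u @ b # v)) | u v a b c. True}" for z
      using that by auto
  qed
  moreover have "word_part n x = x" by (rule word_part_words[OF IntD2[OF x]])
  ultimately show "x \<in> tensor_rel sc n" by simp
qed

lemma word_module_kmod: "kmod (word_module n)"
proof (rule moduleI[OF cring_scalar_ring])
  show "abelian_group (word_module n :: ('a, 'b list \<Rightarrow>\<^sub>0 'a) module)"
    by (rule abelian_groupI) (auto intro: words_closed bexI[of _ "- x" for x] simp: algebra_simps)
qed (auto intro: words_closed simp: fv.scale_left_distrib fv.scale_right_distrib)

lemma word_module_minus:
  assumes "x \<in> words n" "y \<in> words n"
  shows "x \<ominus>\<^bsub>word_module n\<^esub> y = x - y"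
  using kmod_neg_eq_smult[OF word_module_kmod assms(2)] by (simp add: a_minus_def)

lemma subspace_submodule_words:
  assumes "fv.subspace S" "S \<subseteq> words n"
  shows "submodule S scalar_ring (word_module n)"
  using assms by (intro kmod_submoduleI word_module_kmod) (auto simp: fv.subspace_def)

definition tensor_class :: "('k::field \<Rightarrow> 'a::ab_group_add \<Rightarrow> 'a) \<Rightarrow> nat \<Rightarrow> ('a list \<Rightarrow>\<^sub>0 'k) \<Rightarrow> ('a, 'k) tensor"
  where "tensor_class sc n x = tensor_rel sc n +>\<^bsub>word_module n\<^esub> x"

locale tensors = vector_space sc for sc :: "'k::field \<Rightarrow> 'a::ab_group_add \<Rightarrow> 'a"
begin

lemma vs: "vector_space sc" by (rule vector_space_axioms)

lemma tensor_rel_submodule: "submodule (tensor_rel sc n) scalar_ring (word_module n)"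
  unfolding tensor_rel_eq[OF vs]
  by (intro subspace_submodule_words fv.subspace_inter tensor_rels_subspace words_subspace) auto

lemma tensor_power_kmod: "kmod (tensor_power sc n)"
  unfolding tensor_power_def by (rule quot_kmod[OF word_module_kmod tensor_rel_submodule])

lemma tensor_class_linear: "tensor_class sc n \<in> linear_maps (word_module n) (tensor_power sc n)"
  using coset_linear[OF word_module_kmod tensor_rel_submodule] by (simp add: tensor_power_def tensor_class_def[abs_def])

lemma tensor_cases:
  assumes "z \<in> carrier (tensor_power sc n)"
  obtains x where "x \<in> words n" "z = tensor_class sc n x"
  using assms by (auto simp: tensor_power_def a_rcosets_iff tensor_class_def)

lemma tensor_class_closed: "x \<in> words n \<Longrightarrow> tensor_class sc n x \<in> carrier (tensor_power sc n)"
  by (rule linear_maps_closed[OF tensor_class_linear])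

lemma tensor_class_eq_iff:
  "x \<in> words n \<Longrightarrow> y \<in> words n \<Longrightarrow> tensor_class sc n x = tensor_class sc n y \<longleftrightarrow> tensor_eq sc x y"
  using coset_eq_iff[OF word_module_kmod tensor_rel_submodule, of x n y]
  by (simp add: tensor_class_def word_module_minus tensor_eq_def words_diff)
    (simp add: tensor_rel_eq[OF vs] words_diff)

lemma tensor_class_zero: "\<zero>\<^bsub>tensor_power sc n\<^esub> = tensor_class sc n 0"
  using linear_maps_zero[OF word_module_kmod tensor_power_kmod tensor_class_linear] by simp

lemma tensor_class_add: "x \<in> words n \<Longrightarrow> y \<in> words n \<Longrightarrow>
    tensor_class sc n x \<oplus>\<^bsub>tensor_power sc n\<^esub> tensor_class sc n y = tensor_class sc n (x + y)"
  using linear_maps_add[OF tensor_class_linear] by simp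

lemma tensor_class_smult: "x \<in> words n \<Longrightarrow>
    c \<odot>\<^bsub>tensor_power sc n\<^esub> tensor_class sc n x = tensor_class sc n (fscale c x)"
  using linear_maps_smult[OF tensor_class_linear] by simp

lemma tensor_class_minus: "x \<in> words n \<Longrightarrow> y \<in> words n \<Longrightarrow>
    tensor_class sc n x \<ominus>\<^bsub>tensor_power sc n\<^esub> tensor_class sc n y = tensor_class sc n (x - y)"
  using linear_maps_minus[OF word_module_kmod tensor_power_kmod tensor_class_linear] by (simp add: word_module_minus)

lemma tensor_class_finsum:
  fixes x :: "nat \<Rightarrow> _"
  assumes "\<And>i. i < m \<Longrightarrow> x i \<in> words n"
  shows "(\<Oplus>\<^bsub>tensor_power sc n\<^esub> i\<in>{..<m}. tensor_class sc n (x i)) = tensor_class sc n (\<Sum>i<m. x i)"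
  using assms
proof (induction m)
  case 0
  interpret T: Module.module scalar_ring "tensor_power sc n" by (rule tensor_power_kmod)
  show ?case using T.finsum_empty by (simp add: tensor_class_zero)
next
  case (Suc m)
  interpret T: Module.module scalar_ring "tensor_power sc n" by (rule tensor_power_kmod)
  have "(\<Oplus>\<^bsub>tensor_power sc n\<^esub> i\<in>insert m {..<m}. tensor_class sc n (x i))
      = tensor_class sc n (x m) \<oplus>\<^bsub>tensor_power sc n\<^esub> (\<Oplus>\<^bsub>tensor_power sc n\<^esub> i\<in>{..<m}. tensor_class sc n (x i))"
    using Suc.prems by (intro T.finsum_insert) (auto intro: tensor_class_closed)
  moreover have "sum x {..<m} \<in> words n" by (rule words_sum) (use Suc.prems in auto)
  ultimately show ?case
    using Suc by (simp add: lessThan_Suc tensor_class_add)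
qed

end

lemma
  assumes sc: "tensors sc" and sc': "tensors sc'" and f: "descends sc sc' f'"
    and f': "\<And>w. length w = m \<Longrightarrow> f w = f' w" and words: "\<And>w. length w = m \<Longrightarrow> f' w \<in> words n"
  shows tensor_map_class: "x \<in> words m \<Longrightarrow> tensor_map sc' n f (tensor_class sc m x) = tensor_class sc' n (lin_ext f' x)"
    and tensor_map_linear: "tensor_map sc' n f \<in> linear_maps (tensor_power sc m) (tensor_power sc' n)"
proof -
  interpret S: tensors sc by fact
  interpret S': tensors sc' by fact
  have eq: "lin_ext f x = lin_ext f' x" if "x \<in> words m" for x
    using that f' by (rule lin_ext_cong)
  have closed: "lin_ext f' x \<in> words n" if "x \<in> words m" for x
    using that words by (rule lin_ext_words)
  have lin: "lin_ext f \<in> linear_maps (word_module m) (word_module n)"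
    using eq closed by (intro linear_mapsI) auto
  have rel: "lin_ext f ` tensor_rel sc m \<subseteq> tensor_rel sc' n"
    using f eq closed by (auto simp: tensor_rel_eq[OF S.vs] tensor_rel_eq[OF S'.vs] descends_def)
  note arg = word_module_kmod S.tensor_rel_submodule word_module_kmod S'.tensor_rel_submodule lin rel
  show "x \<in> words m \<Longrightarrow> tensor_map sc' n f (tensor_class sc m x) = tensor_class sc' n (lin_ext f' x)"
    using induced_coset[OF arg, of x] eq by (simp add: tensor_map_def tensor_class_def)
  show "tensor_map sc' n f \<in> linear_maps (tensor_power sc m) (tensor_power sc' n)"
    unfolding tensor_map_def tensor_power_def by (rule induced_linear[OF arg])
qed

section \<open>The Leibniz complex on words\<close>

lemma minus_one_power_if: "(- 1 :: 'k::field) ^ n = (if even n then 1 else - 1)"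
  by (simp add: minus_one_power_iff)

text \<open>The bracket with \<open>x\<close>, extended to words as a derivation.\<close>

fun ad_word :: "'a::ring \<Rightarrow> 'a list \<Rightarrow> 'a list \<Rightarrow>\<^sub>0 'k::field"
  where "ad_word x [] = 0"
  | "ad_word x (a # w) = fword (bracket a x # w) + cons a (ad_word x w)"

abbreviation ad :: "'a::ring \<Rightarrow> ('a list \<Rightarrow>\<^sub>0 'k::field) \<Rightarrow> 'a list \<Rightarrow>\<^sub>0 'k"
  where "ad x \<equiv> lin_ext (ad_word x)"

abbreviation leib :: "('a::ring list \<Rightarrow>\<^sub>0 'k::field) \<Rightarrow> 'a list \<Rightarrow>\<^sub>0 'k"
  where "leib \<equiv> lin_ext leibniz_word"

lemma ad_word_conv_sum: "ad_word x w = (\<Sum>i<length w. fword (w[i := bracket (w ! i) x]))"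
  by (induction w) (simp_all add: sum.lessThan_Suc_shift del: sum.lessThan_Suc)

lemma ad_word_snoc: "ad_word x (w @ [y]) = snoc y (ad_word x w) + fword (w @ [bracket y x])"
  by (induction w) (simp_all add: cons_snoc algebra_simps)

lemma ad_cons: "ad x (cons a z) = cons (bracket a x) z + cons a (ad x z)"
  by (rule lin_eq) (auto intro!: lin_intros)

lemma ad_snoc: "ad x (snoc y z) = snoc y (ad x z) + snoc (bracket y x) z"
  by (rule lin_eq) (auto intro!: lin_intros simp: ad_word_snoc)

lemma ad_word_words: "ad_word x w \<in> words (length w)"
  by (induction w) (auto intro: words_add cons_words words_zero)

lemma leibniz_word_Nil [simp]: "leibniz_word [] = 0"
  by (simp add: leibniz_word_def)

text \<open>The summands of the boundary in which the last letter does not take part form the boundary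
  of the rest, and those in which it does form the action of the last letter. This recursion turns
  all identities for the boundary into inductions from the right.\<close>

lemma leibniz_word_snoc:
  "leibniz_word (w @ [x]) = snoc x (leibniz_word w) + fscale ((- 1) ^ Suc (length w)) (ad_word x w)"
proof -
  have "take j ((w @ [x])[i := b]) @ drop (Suc j) (w @ [x]) = (take j (w[i := b]) @ drop (Suc j) w) @ [x]"
    if "j < length w" "i < j" for i j b
    using that by (simp add: list_update_append)
  then have "(\<Sum>j<length w. \<Sum>i<j. fscale ((- 1) ^ Suc j) (fword (take j ((w @ [x])[i := bracket ((w @ [x]) ! i) ((w @ [x]) ! j)])
        @ drop (Suc j) (w @ [x])))) = snoc x (leibniz_word w :: 'a list \<Rightarrow>\<^sub>0 'b)"
    unfolding leibniz_word_def lin_ext_sum lin_ext_fscale lin_ext_fword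
    by (intro sum.cong refl arg_cong2[where f = fscale] arg_cong[where f = fword]) (auto simp: nth_append)
  moreover have "(\<Sum>i<length w. fscale ((- 1) ^ Suc (length w)) (fword (take (length w)
        ((w @ [x])[i := bracket ((w @ [x]) ! i) ((w @ [x]) ! length w)]) @ drop (Suc (length w)) (w @ [x]))))
      = fscale ((- 1) ^ Suc (length w)) (ad_word x w :: 'a list \<Rightarrow>\<^sub>0 'b)"
    unfolding ad_word_conv_sum fv.scale_sum_right
    by (intro sum.cong refl arg_cong2[where f = fscale] arg_cong[where f = fword]) (auto simp: nth_append list_update_append)
  ultimately show ?thesis
    by (subst leibniz_word_def) simp
qed

lemma leib_snoc: "z \<in> words n \<Longrightarrow> leib (snoc x z) = snoc x (leib z) + fscale ((- 1) ^ Suc n) (ad x z)"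
  by (rule lin_eq_on_words) (auto intro!: lin_intros simp: leibniz_word_snoc)

lemma leibniz_word_singleton [simp]: "leibniz_word [x] = 0"
  using leibniz_word_snoc[of "[]" x] by simp

lemma leibniz_word_words: "leibniz_word w \<in> words (length w - 1)"
proof (induction w rule: rev_induct)
  case (snoc x w)
  show ?case
  proof (cases "w = []")
    case False
    then show ?thesis
      using snoc_words[OF snoc.IH, of x] ad_word_words[of x w]
      by (auto simp: leibniz_word_snoc intro!: words_closed)
  qed (simp add: words_zero)
qed (simp add: words_zero)

lemma leib_words: "z \<in> words (Suc n) \<Longrightarrow> leib z \<in> words n"
  by (rule lin_ext_words) (auto intro: subsetD[OF _ leibniz_word_words])

context unital_algebra
begin

sublocale tensors scale
  by unfold_locales

abbreviation eqv (infix "\<approx>" 50) where "eqv \<equiv> tensor_eq scale"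
abbreviation rels where "rels \<equiv> tensor_rels scale"
abbreviation respectful where "respectful \<equiv> descends scale scale"
abbreviation ml where "ml \<equiv> mlin scale scale"

lemma scale_bracket_left: "bracket (a + scale c b) x = bracket a x + scale c (bracket b x)"
  by (simp add: bracket_def algebra_simps scale_mult_left scale_mult_right scale_right_diff_distrib)

lemma scale_bracket_right: "bracket x (a + scale c b) = bracket x a + scale c (bracket x b)"
  by (simp add: bracket_def algebra_simps scale_mult_left scale_mult_right scale_right_diff_distrib)

lemma ml_ad_word: "ml (\<lambda>x. ad_word x w)"
proof (induction w)
  case (Cons a w)
  have "ml (\<lambda>x. fword (bracket a x # w))"
    by (rule mlin_linear_arg[where g = "\<lambda>y. fword (y # w)"])
      (use mlin_word[of scale "[]" w] in \<open>auto simp: scale_bracket_right\<close>)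
  then show ?case
    using Cons by (auto intro!: mlin_intros mlin_lin_ext[OF descends_cons])
qed (simp add: mlin_zero)

lemma respectful_ad: "respectful (ad_word x)"
proof (rule descendsI)
  fix u v
  show "ml (\<lambda>a. ad_word x (u @ a # v))"
  proof (induction u)
    case Nil
    have "ml (\<lambda>a. fword (bracket a x # v))"
      by (rule mlin_linear_arg[where g = "\<lambda>y. fword (y # v)"])
        (use mlin_word[of scale "[]" v] in \<open>auto simp: scale_bracket_left\<close>)
    then show ?case by (auto intro!: mlin_intros mlin_cons)
  next
    case (Cons b u)
    then show ?case
      using mlin_word[of scale "_ # u" v]
      by (auto intro!: mlin_intros mlin_lin_ext[OF descends_cons])
  qed
qed

lemma respectful_leibniz: "respectful leibniz_word"
proof (rule descendsI)
  fix u v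
  show "ml (\<lambda>a. leibniz_word (u @ a # v))"
  proof (induction v rule: rev_induct)
    case Nil
    show ?case by (auto simp: leibniz_word_snoc intro!: mlin_intros mlin_snoc ml_ad_word)
  next
    case (snoc x v)
    have "ml (\<lambda>a. ad_word x (u @ a # v))"
      using mlin_lin_ext[OF respectful_ad mlin_word[of scale u v], of x] by simp
    with snoc have *: "ml (\<lambda>a. snoc x (leibniz_word (u @ a # v))
        + fscale ((- 1) ^ Suc (length u + Suc (length v))) (ad_word x (u @ a # v)))"
      by (intro mlin_add mlin_fscale mlin_lin_ext[OF descends_snoc])
    have eq: "leibniz_word (u @ a # v @ [x]) = snoc x (leibniz_word (u @ a # v))
        + fscale ((- 1) ^ Suc (length u + Suc (length v))) (ad_word x (u @ a # v))" for a
      using leibniz_word_snoc[of "u @ a # v" x] by simp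
    show ?case unfolding eq by (rule *)
  qed
qed

text \<open>The Jacobi identity, in the form in which it makes \<open>x \<mapsto> ad x\<close> a right action.\<close>

lemma bracket_bracket: "bracket (bracket a x) y + bracket a (bracket y x) = bracket (bracket a y) x"
  by (simp add: bracket_def algebra_simps)

lemma ad_ad_word: "ad y (ad_word x w) + ad_word (bracket y x) w \<approx> ad x (ad_word y w)"
proof (induction w)
  case (Cons a w)
  have "fword (bracket (bracket a x) y # w) + fword (bracket a (bracket y x) # w) \<approx> fword (bracket (bracket a y) x # w)"
    using mlin_tensor_eq_add[OF vs mlin_word[of scale "[]" w], of "bracket (bracket a x) y" "bracket a (bracket y x)"]
    by (simp add: bracket_bracket tensor_eq_sym)
  moreover have "cons a (ad y (ad_word x w) + ad_word (bracket y x) w) \<approx> cons a (ad x (ad_word y w))"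
    by (rule descends_eq[OF descends_cons Cons])
  ultimately have "(fword (bracket (bracket a x) y # w) + fword (bracket a (bracket y x) # w))
        + cons a (ad y (ad_word x w) + ad_word (bracket y x) w)
        + (cons (bracket a x) (ad_word y w) + cons (bracket a y) (ad_word x w))
      \<approx> fword (bracket (bracket a y) x # w) + cons a (ad x (ad_word y w))
        + (cons (bracket a x) (ad_word y w) + cons (bracket a y) (ad_word x w))"
    by (intro tensor_eq_add tensor_eq_refl)
  then show ?case by (simp add: ad_cons algebra_simps)
qed simp

text \<open>The Lie algebra acts on its own Leibniz complex by chain maps. Along the recursion of the
  boundary this reduces to the Jacobi identity.\<close>

lemma leib_ad_word: "leib (ad_word x w) \<approx> ad x (leibniz_word w)"
proof (induction w rule: rev_induct)
  case (snoc y w)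
  let ?s = "(- 1) ^ Suc (length w) :: 'k"
  have "snoc y (leib (ad_word x w)) \<approx> snoc y (ad x (leibniz_word w))"
    by (rule descends_eq[OF descends_snoc snoc])
  moreover have "fscale ?s (ad y (ad_word x w) + ad_word (bracket y x) w) \<approx> fscale ?s (ad x (ad_word y w))"
    by (rule tensor_eq_fscale[OF ad_ad_word])
  ultimately have "snoc y (leib (ad_word x w)) + fscale ?s (ad y (ad_word x w) + ad_word (bracket y x) w) + snoc (bracket y x) (leibniz_word w)
      \<approx> snoc y (ad x (leibniz_word w)) + fscale ?s (ad x (ad_word y w)) + snoc (bracket y x) (leibniz_word w)"
    by (intro tensor_eq_add tensor_eq_refl)
  then show ?case
    by (simp add: ad_word_snoc leibniz_word_snoc leib_snoc[OF ad_word_words] ad_snoc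
        fv.scale_right_distrib algebra_simps del: power_Suc)
qed simp

text \<open>In the recursion the two mixed terms are the commutator of the boundary with the action of
  the last letter.\<close>

lemma leib_leib_word: "leib (leibniz_word w) \<approx> 0"
proof (induction w rule: rev_induct)
  case (snoc x w)
  show ?case
  proof (cases "w = []")
    case False
    then obtain m where m: "length w = Suc m" by (cases w) auto
    have lw: "leibniz_word w \<in> words m" using leibniz_word_words[of w] m by simp
    have "snoc x (leib (leibniz_word w)) \<approx> 0"
      using descends_eq[OF descends_snoc snoc.IH] by simp
    moreover have "fscale ((- 1) ^ m) (leib (ad_word x w)) \<approx> fscale ((- 1) ^ m) (ad x (leibniz_word w))"
      by (rule tensor_eq_fscale[OF leib_ad_word])
    ultimately have "snoc x (leib (leibniz_word w)) + (fscale ((- 1) ^ m) (leib (ad_word x w))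
        - fscale ((- 1) ^ m) (ad x (leibniz_word w))) \<approx> 0 + (fscale ((- 1) ^ m) (ad x (leibniz_word w))
        - fscale ((- 1) ^ m) (ad x (leibniz_word w)))"
      by (intro tensor_eq_add tensor_eq_diff tensor_eq_refl)
    then show ?thesis
      by (simp add: leibniz_word_snoc leib_snoc[OF lw] m algebra_simps)
  qed simp
qed simp

lemma leib_leib: "leib (leib z) \<approx> 0"
  unfolding tensor_eq_def
  by (rule lin_into_subspace_UNIV[OF _ tensor_rels_subspace])
    (use leib_leib_word in \<open>auto intro!: lin_intros simp: tensor_eq_def\<close>)

end

section \<open>The relations of the exterior powers\<close>

text \<open>Representatives of the elements of \<open>alt_rel\<close>, in all degrees at once.\<close>

definition alt_rels :: "('k::field \<Rightarrow> 'a::ring \<Rightarrow> 'a) \<Rightarrow> ('a list \<Rightarrow>\<^sub>0 'k) set"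
  where "alt_rels sc = {x + y | x y. x \<in> tensor_rels sc \<and> y \<in> fv.span {fword w | w. \<not> distinct w}}"

lemma alt_rels_subspace: "fv.subspace (alt_rels sc)"
  unfolding alt_rels_def by (intro fv.subspace_sums tensor_rels_subspace fv.subspace_span)

lemma alt_rels_closed:
  shows alt_rels_zero: "0 \<in> alt_rels sc"
    and alt_rels_add: "x \<in> alt_rels sc \<Longrightarrow> y \<in> alt_rels sc \<Longrightarrow> x + y \<in> alt_rels sc"
    and alt_rels_diff: "x \<in> alt_rels sc \<Longrightarrow> y \<in> alt_rels sc \<Longrightarrow> x - y \<in> alt_rels sc"
    and alt_rels_fscale: "x \<in> alt_rels sc \<Longrightarrow> fscale c x \<in> alt_rels sc"
    and alt_rels_sum: "(\<And>i. i \<in> S \<Longrightarrow> h i \<in> alt_rels sc) \<Longrightarrow> sum h S \<in> alt_rels sc"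
  by (intro fv.subspace_0 fv.subspace_add fv.subspace_diff fv.subspace_neg fv.subspace_scale fv.subspace_sum
      alt_rels_subspace; assumption)+

lemma tensor_rels_alt_rels: "x \<in> tensor_rels sc \<Longrightarrow> x \<in> alt_rels sc"
  unfolding alt_rels_def using fv.span_zero by (force intro: exI[of _ x] exI[of _ 0])

lemma nondistinct_alt_rels: "\<not> distinct w \<Longrightarrow> fword w \<in> alt_rels sc"
  unfolding alt_rels_def by (force intro: fv.span_base exI[of _ 0])


lemma lin_alt_rels_into_subspace:
  assumes "lin F" "fv.subspace S" "x \<in> alt_rels sc" "\<And>y. y \<in> tensor_rels sc \<Longrightarrow> F y \<in> S"
    "\<And>w. \<not> distinct w \<Longrightarrow> F (fword w) \<in> S"
  shows "F x \<in> S"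
proof -
  obtain y z where "x = y + z" "y \<in> tensor_rels sc" "z \<in> fv.span {fword w | w. \<not> distinct w}"
    using assms(3) by (auto simp: alt_rels_def)
  moreover have "F z \<in> S" by (rule lin_span_into_subspace[OF assms(1,2) calculation(3)]) (use assms(5) in auto)
  ultimately show ?thesis
    using assms(1,4) fv.subspace_add[OF assms(2)] by (auto simp: lin_iff)
qed

context unital_algebra
begin

abbreviation alts where "alts \<equiv> alt_rels scale"

lemma alts_eqv: "x \<approx> y \<Longrightarrow> x \<in> alts \<longleftrightarrow> y \<in> alts"
  using alt_rels_add[of "x - y" scale y] alt_rels_add[of "y - x" scale x] tensor_eq_sym[of scale x y]
  by (auto simp: tensor_eq_def tensor_rels_alt_rels)

lemma alts_snoc: "z \<in> alts \<Longrightarrow> snoc x z \<in> alts"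
  by (rule lin_alt_rels_into_subspace[OF lin_lin_ext alt_rels_subspace])
    (use descends_snoc[of scale x] in \<open>auto simp: descends_def intro: tensor_rels_alt_rels nondistinct_alt_rels\<close>)

text \<open>Polarization of the relation that a repeated letter gives zero.\<close>

lemma alts_swap: "fword (u @ a # v @ b # w) + fword (u @ b # v @ a # w) \<in> alts"
proof -
  let ?f = "\<lambda>a b. fword (u @ a # v @ b # w)"
  have 1: "?f (a + b) c \<approx> ?f a c + ?f b c" for c
    by (rule mlin_tensor_eq_add[OF vs mlin_word])
  have 2: "?f c (a + b) \<approx> ?f c a + ?f c b" for c
    using mlin_tensor_eq_add[OF vs mlin_word[of scale "u @ c # v" w], of a b] by simp
  have "?f (a + b) (a + b) \<approx> ?f a (a + b) + ?f b (a + b)" by (rule 1)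
  also have "\<dots> \<approx> (?f a a + ?f a b) + (?f b a + ?f b b)" by (intro tensor_eq_add 2)
  finally have "(?f a a + ?f a b) + (?f b a + ?f b b) \<in> alts"
    using alts_eqv nondistinct_alt_rels[of "u @ (a + b) # v @ (a + b) # w" scale] by auto
  moreover have "?f a a \<in> alts" "?f b b \<in> alts" by (auto intro: nondistinct_alt_rels)
  ultimately have "(?f a a + ?f a b) + (?f b a + ?f b b) - ?f a a - ?f b b \<in> alts"
    by (intro alt_rels_diff)
  then show ?thesis by (simp add: algebra_simps)
qed

text \<open>The summands in which the action hits one of two equal letters cancel up to a transposition,
  and in the others the letter is still repeated.\<close>

lemma alts_ad_word:
  assumes "\<not> distinct w"
  shows "ad_word x w \<in> alts"
proof -
  obtain p q where pq: "p < q" "q < length w" "w ! p = w ! q"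
    using assms by (metis distinct_conv_nth linorder_neqE_nat)
  let ?f = "\<lambda>i. fword (w[i := bracket (w ! i) x]) :: 'a list \<Rightarrow>\<^sub>0 'k"
  have "?f i \<in> alts" if "i < length w" "i \<noteq> p" "i \<noteq> q" for i
  proof (rule nondistinct_alt_rels)
    have "w[i := bracket (w ! i) x] ! p = w[i := bracket (w ! i) x] ! q" using that pq by simp
    then show "\<not> distinct (w[i := bracket (w ! i) x])"
      using pq by (metis distinct_conv_nth length_list_update less_trans nat_neq_iff)
  qed
  then have "(\<Sum>i\<in>{..<length w} - {p, q}. ?f i) \<in> alts" by (intro alt_rels_sum) auto
  moreover have "?f p + ?f q \<in> alts"
  proof -
    obtain u v s a where w: "w = u @ a # v @ a # s" and p: "p = length u" and q: "q = length u + 1 + length v"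
    proof -
      let ?u = "take p w" and ?r = "drop (Suc p) w"
      have "w = ?u @ w ! p # ?r" by (rule id_take_nth_drop) (use pq in simp)
      moreover have "?r = take (q - Suc p) ?r @ w ! q # drop (Suc (q - Suc p)) ?r"
        using pq id_take_nth_drop[of "q - Suc p" ?r] by simp
      ultimately have "w = ?u @ w ! p # take (q - Suc p) ?r @ w ! p # drop (Suc (q - Suc p)) ?r"
        using pq(3) by simp
      moreover have "p = length ?u" "q = length ?u + 1 + length (take (q - Suc p) ?r)" using pq by auto
      ultimately show ?thesis using that by blast
    qed
    have eq: "?f p + ?f q = fword (u @ bracket a x # v @ a # s) + fword (u @ a # v @ bracket a x # s)"
      unfolding w p q by (simp add: list_update_append nth_append)
    show ?thesis unfolding eq by (rule alts_swap)
  qed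
  moreover have "ad_word x w = (\<Sum>i\<in>{..<length w} - {p, q}. ?f i) + (?f p + ?f q)"
  proof -
    have "(\<Sum>i<length w. ?f i) = ?f p + (\<Sum>i\<in>{..<length w} - {p}. ?f i)"
      by (rule sum.remove) (use pq in auto)
    also have "(\<Sum>i\<in>{..<length w} - {p}. ?f i) = ?f q + (\<Sum>i\<in>{..<length w} - {p} - {q}. ?f i)"
      by (rule sum.remove) (use pq in auto)
    also have "{..<length w} - {p} - {q} = {..<length w} - {p, q}" by auto
    finally show ?thesis by (simp only: ad_word_conv_sum add.assoc add.commute)
  qed
  ultimately show ?thesis by (simp only: alt_rels_add)
qed

lemma alts_ad: "z \<in> alts \<Longrightarrow> ad x z \<in> alts"
  by (rule lin_alt_rels_into_subspace[OF lin_lin_ext alt_rels_subspace])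
    (use respectful_ad[of x] in \<open>auto simp: descends_def intro: tensor_rels_alt_rels alts_ad_word\<close>)

lemma move_to_end: "\<exists>s. s \<in> {1, -1 :: 'k} \<and> fword (u @ x # v) - fscale s (fword (u @ v @ [x])) \<in> alts"
proof (induction v arbitrary: u)
  case Nil
  show ?case by (rule exI[of _ 1]) (simp add: alt_rels_zero)
next
  case (Cons y v)
  obtain s where s: "s \<in> {1, -1 :: 'k}" "fword ((u @ [y]) @ x # v) - fscale s (fword ((u @ [y]) @ v @ [x])) \<in> alts"
    using Cons.IH by blast
  have "fword (u @ x # [] @ y # v) + fword (u @ y # [] @ x # v) \<in> alts" by (rule alts_swap)
  from alt_rels_diff[OF this s(2)]
  have "fword (u @ x # y # v) - fscale (- s) (fword (u @ (y # v) @ [x])) \<in> alts" by simp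
  then show ?case using s(1) by (intro exI[of _ "- s"]) auto
qed

text \<open>If there is a repetition before the last letter, then the recursion of the boundary applies
  at once. Otherwise an earlier letter equals the last one, and it is moved to its side.\<close>

lemma alts_leibniz_word: "\<not> distinct w \<Longrightarrow> leibniz_word w \<in> alts"
proof (induction w rule: length_induct)
  case (1 w)
  have IH: "leib z \<in> alts" if "z \<in> alts" "z \<in> words n" "n < length w" for z n
  proof -
    \<comment> \<open>Only the part of \<open>z\<close> in degree \<open>n\<close> is covered by the induction hypothesis.\<close>
    have "leib (word_part n z) \<in> alts"
    proof (rule lin_alt_rels_into_subspace[OF _ alt_rels_subspace that(1), where F = "\<lambda>z. leib (word_part n z)"])
      show "leib (word_part n y) \<in> alts" if "y \<in> rels" for y
        using word_part_tensor_rels[OF that] respectful_leibniz by (auto simp: descends_def intro: tensor_rels_alt_rels)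
      show "leib (word_part n (fword u)) \<in> alts" if "\<not> distinct u" for u
        using 1 that \<open>n < length w\<close> by (auto simp: alt_rels_zero)
    qed (intro lin_intros)
    moreover have "word_part n z = z" by (rule word_part_words[OF that(2)])
    ultimately show ?thesis by simp
  qed
  obtain v x where w: "w = v @ [x]" using 1(2) by (cases w rule: rev_cases) auto
  show ?case
  proof (cases "distinct v")
    case False
    have "leibniz_word v \<in> alts" using 1 False w by auto
    then show ?thesis
      using alts_ad_word[OF False] by (auto simp: w leibniz_word_snoc intro!: alt_rels_closed alts_snoc)
  next
    case True
    then obtain u t where v: "v = u @ x # t" using 1(2) w by (auto simp: in_set_conv_decomp)
    obtain s where s: "fword v - fscale s (fword ((u @ t) @ [x])) \<in> alts" (is "?z \<in> _")
      using move_to_end[of u x t] v by auto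
    have zw: "?z \<in> words (length v)" using v by (auto intro!: words_closed)
    have "leib (snoc x ?z) \<in> alts"
      unfolding leib_snoc[OF zw] using IH[OF s zw] w alts_ad[OF s]
      by (auto intro!: alt_rels_closed alts_snoc simp del: lin_ext_simps)
    moreover have "leibniz_word ((u @ t) @ [x, x]) \<in> alts"
    proof -
      define r where "r = u @ t"
      \<comment> \<open>The two boundary terms with the bracket of a letter of \<open>r\<close> and one of the two copies of \<open>x\<close> cancel,
        and what remains ends with two copies of \<open>x\<close>.\<close>
      have eq: "leibniz_word ((r @ [x]) @ [x]) = snoc x (snoc x (leibniz_word r))
          + fscale ((- 1) ^ length r) (fword (r @ [bracket x x]))"
        unfolding leibniz_word_snoc by (simp add: ad_word_snoc fv.scale_right_distrib)
      have 1: "fword (r @ [bracket x x]) \<in> alts"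
        using mlin_zero_arg[OF vs mlin_word[of scale r "[]"]]
        by (simp add: bracket_def tensor_eq_def tensor_rels_alt_rels)
      have 2: "snoc x (snoc x y) \<in> alts" for y :: "'a list \<Rightarrow>\<^sub>0 'k"
        by (rule lin_into_subspace_UNIV[OF _ alt_rels_subspace]) (auto intro!: lin_intros nondistinct_alt_rels)
      have "leibniz_word ((r @ [x]) @ [x]) \<in> alts"
        unfolding eq by (intro alt_rels_add alt_rels_fscale 1 2)
      then show ?thesis by (simp add: r_def)
    qed
    ultimately have "leib (snoc x ?z) + fscale s (leibniz_word ((u @ t) @ [x, x])) \<in> alts"
      by (intro alt_rels_add alt_rels_fscale)
    then show ?thesis by (simp add: w)
  qed
qed

lemma alts_leib: "z \<in> alts \<Longrightarrow> leib z \<in> alts"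
  by (rule lin_alt_rels_into_subspace[OF lin_lin_ext alt_rels_subspace])
    (use respectful_leibniz in \<open>auto simp: descends_def intro: tensor_rels_alt_rels alts_leibniz_word\<close>)

end

section \<open>The Hochschild boundary and the cyclic operator on words\<close>

text \<open>The operations that make up the Hochschild boundary. They vanish on words that are too
  short, so that most identities between them hold for words of any length.\<close>

fun lmul_word :: "'a::ring \<Rightarrow> 'a list \<Rightarrow> 'a list \<Rightarrow>\<^sub>0 'k::field"
  where "lmul_word c [] = 0"
  | "lmul_word c (a # w) = fword ((c * a) # w)"

definition rmul_word :: "'a::ring \<Rightarrow> 'a list \<Rightarrow> 'a list \<Rightarrow>\<^sub>0 'k::field"
  where "rmul_word c w = (if w = [] then 0 else fword (butlast w @ [last w * c]))"

fun face_word :: "'a::ring list \<Rightarrow> 'a list \<Rightarrow>\<^sub>0 'k::field"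
  where "face_word (a # w) = lmul_word a w"
  | "face_word [] = 0"

text \<open>Usually called \<open>b'\<close>: the Hochschild boundary without the summand that multiplies the last
  letter into the first.\<close>

fun bar_word :: "'a::ring list \<Rightarrow> 'a list \<Rightarrow>\<^sub>0 'k::field"
  where "bar_word [] = 0"
  | "bar_word (a # w) = lmul_word a w - cons a (bar_word w)"

abbreviation "lmul c \<equiv> lin_ext (lmul_word c)"
abbreviation "rmul c \<equiv> lin_ext (rmul_word c)"
abbreviation "face \<equiv> lin_ext face_word"
abbreviation "bar \<equiv> lin_ext bar_word"

text \<open>On letters, where the sum \<open>hochschild_word\<close> is not zero, the value 0 is the boundary of the
  complex in degree 0.\<close>

definition hoch_word :: "'a::ring list \<Rightarrow> 'a list \<Rightarrow>\<^sub>0 'k::field"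
  where "hoch_word w = (if w = [] then 0
    else bar_word w + fscale ((- 1) ^ (length w - 1)) (lmul_word (last w) (butlast w)))"

definition cyc_word :: "'a list \<Rightarrow> 'a list \<Rightarrow>\<^sub>0 'k::field"
  where "cyc_word w = (if w = [] then 0 else fscale ((- 1) ^ (length w - 1)) (fword (last w # butlast w)))"

abbreviation "hoch \<equiv> lin_ext hoch_word"
abbreviation "cyc \<equiv> lin_ext cyc_word"

lemma rmul_word_snoc: "rmul_word c (w @ [a]) = fword (w @ [a * c])"
  by (simp add: rmul_word_def)

lemma hoch_word_snoc:
  "hoch_word (w @ [a]) = bar_word (w @ [a]) + fscale ((- 1) ^ length w) (lmul_word a w)"
  by (simp add: hoch_word_def)

lemma cyc_word_snoc: "cyc_word (w @ [a]) = fscale ((- 1) ^ length w) (fword (a # w))"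
  by (simp add: cyc_word_def)

lemma word_ops_Nil [simp]: "rmul_word c [] = 0" "hoch_word [] = 0" "cyc_word [] = 0"
  by (simp_all add: rmul_word_def hoch_word_def cyc_word_def)

lemma bar_cons: "bar (cons a z) = lmul a z - cons a (bar z)"
  by (rule lin_eq) (auto intro!: lin_intros)

lemma lmul_cons: "lmul a (cons b z) = cons (a * b) z"
  by (rule lin_eq) (auto intro!: lin_intros)

lemma rmul_snoc: "rmul c (snoc a z) = snoc (a * c) z"
  by (rule lin_eq) (auto intro!: lin_intros simp: rmul_word_snoc)

lemma lmul_lmul: "lmul a (lmul b z) = lmul (a * b) z" (is "?F z = ?G z")
proof (rule lin_eq[of ?F ?G])
  show "?F (fword w) = ?G (fword w)" for w
    by (cases w) (simp_all add: mult.assoc)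
qed (intro lin_intros)+

lemmas lmul_lmul_word = lmul_lmul[of _ _ "fword w" for w, unfolded lin_ext_fword]

lemma rmul_rmul: "rmul a (rmul b z) = rmul (b * a) z" (is "?F z = ?G z")
proof (rule lin_eq[of ?F ?G])
  show "?F (fword w) = ?G (fword w)" for w
    by (cases w rule: rev_cases) (simp_all add: rmul_word_snoc mult.assoc)
qed (intro lin_intros)+

lemmas rmul_rmul_word = rmul_rmul[of _ _ "fword w" for w, unfolded lin_ext_fword]

lemma bar_lmul: "bar (lmul a z) = lmul a (bar z)" (is "?F z = ?G z")
proof (rule lin_eq[of ?F ?G])
  show "?F (fword w) = ?G (fword w)" for w
    by (cases w) (simp_all add: lmul_lmul_word lmul_cons)
qed (intro lin_intros)+

lemmas bar_lmul_word = bar_lmul[of _ "fword w" for w, unfolded lin_ext_fword]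

lemma bar_bar: "bar (bar z) = 0" (is "?F z = 0")
proof (rule lin_eq[of ?F "\<lambda>_. 0"])
  show "?F (fword w) = 0" for w
  proof (induction w)
    case (Cons a w)
    then show ?case by (simp add: bar_cons bar_lmul_word)
  qed simp
qed (intro lin_intros)+

lemmas bar_bar_word = bar_bar[of "fword w" for w, unfolded lin_ext_fword]

lemma bar_word_snoc:
  fixes w :: "'a::ring list"
  shows "(bar_word (w @ [c]) :: 'a list \<Rightarrow>\<^sub>0 'k::field)
    = snoc c (bar_word w) - fscale ((- 1) ^ length w) (rmul_word c w)"
proof (induction w)
  case (Cons a w)
  show ?case
  proof (cases "w = []")
    case False
    then obtain b v where w: "w = b # v" by (cases w) auto
    have "rmul_word c (a # w) = cons a (rmul_word c w :: 'a list \<Rightarrow>\<^sub>0 'k)"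
      using False by (simp add: rmul_word_def)
    moreover have "lmul_word a (w @ [c]) = snoc c (lmul_word a w :: 'a list \<Rightarrow>\<^sub>0 'k)"
      by (simp add: w)
    ultimately show ?thesis using Cons by (simp add: cons_snoc)
  qed (simp add: rmul_word_def)
qed simp

lemma bar_snoc: "z \<in> words n \<Longrightarrow> bar (snoc c z) = snoc c (bar z) - fscale ((- 1) ^ n) (rmul c z)"
  by (rule lin_eq_on_words) (auto intro!: lin_intros simp: bar_word_snoc)

lemma hoch_snoc: "z \<in> words n \<Longrightarrow> hoch (snoc c z) = bar (snoc c z) + fscale ((- 1) ^ n) (lmul c z)"
  by (rule lin_eq_on_words) (auto intro!: lin_intros simp: hoch_word_snoc)

lemma cyc_snoc:
  assumes "z \<in> words n"
  shows "cyc (snoc c z) = fscale ((- 1) ^ n) (cons c z)"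
  by (rule lin_eq_on_words[OF _ _ assms]) (auto intro!: lin_intros simp: cyc_word_snoc)

lemma lmul_word_words: "lmul_word c w \<in> words (length w)"
  by (cases w) (auto simp: words_zero)

lemma bar_word_words: "bar_word w \<in> words (length w - 1)"
proof (induction w)
  case (Cons a w)
  show ?case
  proof (cases "w = []")
    case False
    then show ?thesis using cons_words[OF Cons, of a] by (auto intro!: words_diff lmul_word_words)
  qed (simp add: words_zero)
qed (simp add: words_zero)

lemma hoch_word_words: "hoch_word w \<in> words (length w - 1)"
  using lmul_word_words[of "last w" "butlast w"] bar_word_words[of w]
  by (auto simp: hoch_word_def words_zero intro!: words_add words_fscale)

lemma cyc_word_words: "cyc_word w \<in> words (length w)"
  by (cases w rule: rev_cases) (auto simp: words_zero cyc_word_snoc intro!: words_fscale)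

lemma bar_words: "z \<in> words (Suc n) \<Longrightarrow> bar z \<in> words n"
  by (rule lin_ext_words) (auto intro: subsetD[OF _ bar_word_words])

lemma hoch_words: "z \<in> words (Suc n) \<Longrightarrow> hoch z \<in> words n"
  by (rule lin_ext_words) (auto intro: subsetD[OF _ hoch_word_words])

lemma cyc_words: "z \<in> words n \<Longrightarrow> cyc z \<in> words n"
  by (rule lin_ext_words) (auto intro: subsetD[OF _ cyc_word_words])

lemma face_words: "z \<in> words (Suc n) \<Longrightarrow> face z \<in> words n"
proof (rule lin_ext_words)
  show "face_word w \<in> words n" if "length w = Suc n" for w :: "'a list"
    using that lmul_word_words[of "hd w" "tl w"] by (cases w) auto
qed

lemma bar_rmul: "bar (rmul c z) = rmul c (bar z)" (is "?F z = ?G z")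
proof (rule lin_eq[of ?F ?G])
  show "?F (fword w) = ?G (fword w)" for w
  proof (cases w rule: rev_cases)
    case (snoc u y)
    then show ?thesis by (simp add: rmul_word_snoc bar_word_snoc rmul_snoc rmul_rmul_word)
  qed simp
qed (intro lin_intros)+

lemmas bar_rmul_word = bar_rmul[of _ "fword w" for w, unfolded lin_ext_fword]

lemma bar_word_conv_sum:
  "bar_word w = (\<Sum>i<length w - 1. fscale ((- 1) ^ i) (fword (take i w @ [w ! i * w ! Suc i] @ drop (i + 2) w)))"
proof (induction w)
  case (Cons a w)
  show ?case
  proof (cases w)
    case (Cons b v)
    show ?thesis
      using Cons.IH by (simp add: Cons sum.lessThan_Suc_shift sum_negf del: sum.lessThan_Suc)
  qed simp
qed simp

lemma hochschild_word_eq: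
  fixes w :: "'a::ring list"
  assumes "length w \<ge> 2"
  shows "(hochschild_word w :: 'a list \<Rightarrow>\<^sub>0 'k::field) = hoch_word w"
proof -
  obtain v c where v: "w = v @ [c]" using assms by (cases w rule: rev_cases) auto
  then obtain a u where w: "w = a # u @ [c]" using assms by (cases v) auto
  have "(hochschild_word w :: 'a list \<Rightarrow>\<^sub>0 'k)
      = bar_word w + fscale ((- 1) ^ (length w - 1)) (fword ((last w * hd w) # tl (butlast w)))"
    unfolding hochschild_word_def Let_def bar_word_conv_sum ..
  also have "\<dots> = hoch_word w" by (simp add: w hoch_word_def)
  finally show ?thesis .
qed

text \<open>The operator \<open>b'\<close> has square zero and commutes with the multiplications at both ends. What is
  left are the two ways to multiply the last two letters into the first one.\<close>

lemma hoch_hoch: "hoch (hoch z) = 0" (is "?F z = 0")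
proof (rule lin_eq[of ?F "\<lambda>_. 0"])
  show "?F (fword w) = 0" for w
  proof (cases w rule: rev_cases)
    case (snoc v c)
    show ?thesis
    proof (cases v rule: rev_cases)
      case v: (snoc u y)
      let ?s = "\<lambda>x :: 'a list \<Rightarrow>\<^sub>0 'b. fscale ((- 1) ^ length u) x"
      have ss: "?s (?s x) = x" for x by (simp add: minus_one_power_if)
      have bv: "(bar_word v :: 'a list \<Rightarrow>\<^sub>0 'b) \<in> words (length u)" using bar_word_words[of v] v by simp
      have "hoch_word w = snoc c (bar_word v) + ?s (rmul_word c v) - ?s (lmul_word c v)"
        using v unfolding snoc hoch_word_snoc bar_word_snoc[of v] by simp
      then have "hoch (hoch_word w) = hoch (snoc c (bar_word v)) + ?s (hoch (rmul_word c v)) - ?s (hoch (lmul_word c v))"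
        by simp
      also have "hoch (snoc c (bar_word v)) = ?s (lmul c (bar_word v)) - ?s (rmul c (bar_word v))"
        by (simp add: hoch_snoc[OF bv] bar_snoc[OF bv] bar_bar_word)
      also have "hoch (rmul_word c v) = rmul c (bar_word v) + ?s (lmul_word (y * c) u)"
        unfolding bar_rmul_word[symmetric] by (simp add: v rmul_word_snoc hoch_word_snoc)
      also have "hoch (lmul_word c v) = lmul c (bar_word v) + ?s (lmul_word (y * c) u)"
      proof (cases u)
        case (Cons a u')
        then show ?thesis
          unfolding bar_lmul_word[symmetric] using v
          by (simp add: hoch_word_snoc[of "(c * a) # u'" y, simplified] mult.assoc)
      qed (simp add: v hoch_word_def)
      finally show ?thesis by (simp add: fv.scale_right_distrib)
    qed (simp add: snoc hoch_word_def)
  qed simp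
qed (intro lin_intros)+

text \<open>The identity \<open>b (1 - t) = (1 - t) b'\<close>: the summand of \<open>b\<close> that multiplies the last letter into
  the first is the first summand of \<open>b t\<close>.\<close>

lemma hoch_cyc: "hoch z - hoch (cyc z) = bar z - cyc (bar z)" (is "?F z = ?G z")
proof (rule lin_eq[of ?F ?G])
  show "?F (fword w) = ?G (fword w)" for w
  proof (cases w rule: rev_cases)
    case (snoc v c)
    show ?thesis
    proof (cases v rule: rev_cases)
      case v: (snoc u y)
      let ?s = "\<lambda>x :: 'a list \<Rightarrow>\<^sub>0 'b. fscale ((- 1) ^ length v) x"
      have ss: "?s (?s x) = x" for x by (simp add: minus_one_power_if)
      have bv: "(bar_word v :: 'a list \<Rightarrow>\<^sub>0 'b) \<in> words (length u)" using bar_word_words[of v] v by simp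
      have "hoch_word (c # v) = lmul_word c v - cons c (bar_word v) + ?s (fword ((y * c) # u))"
        using hoch_word_snoc[of "c # u" y] v by simp
      then have "hoch (cyc_word w) = ?s (lmul_word c v) - ?s (cons c (bar_word v)) + fword ((y * c) # u)"
        by (simp only: snoc cyc_word_snoc lin_ext_fscale lin_ext_fword fv.scale_right_distrib
            fv.scale_right_diff_distrib ss)
      moreover have "cyc (bar_word w) = - ?s (cons c (bar_word v)) + fword ((y * c) # u)"
      proof -
        have "(cyc (rmul_word c v) :: 'a list \<Rightarrow>\<^sub>0 'b) = fscale ((- 1) ^ length u) (fword ((y * c) # u))"
          by (simp add: v rmul_word_snoc cyc_word_snoc)
        moreover have "length v = Suc (length u)" by (simp add: v)
        ultimately show ?thesis
          by (simp add: snoc bar_word_snoc[of v] cyc_snoc[OF bv] minus_one_power_if)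
      qed
      ultimately show ?thesis
        using snoc by (simp add: hoch_word_snoc)
    qed (simp add: snoc hoch_word_def cyc_word_def)
  qed simp
qed (intro lin_intros)+

text \<open>The operator \<open>s\<close> that prepends the unit contracts the complex with the boundary \<open>b'\<close>.\<close>

lemma bar_cons_one:
  fixes z :: "'a::{ring,monoid_mult} list \<Rightarrow>\<^sub>0 'k::field"
  assumes "z \<in> words n" "n > 0"
  shows "bar (cons 1 z) = z - cons 1 (bar z)"
proof -
  have "lmul 1 z = z"
  proof (rule lin_eq_on_words[OF lin_lin_ext lin_ident assms(1)])
    show "lmul 1 (fword w) = (fword w :: 'a list \<Rightarrow>\<^sub>0 'k)" if "length w = n" for w :: "'a list"
      using that assms(2) by (cases w) auto
  qed
  then show ?thesis by (simp add: bar_cons)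
qed

section \<open>The norm\<close>

lemma cyc_pow_simps [simp]:
  "(cyc ^^ i) 0 = 0" "(cyc ^^ i) (x + y) = (cyc ^^ i) x + (cyc ^^ i) y"
  "(cyc ^^ i) (x - y) = (cyc ^^ i) x - (cyc ^^ i) y" "(cyc ^^ i) (- x) = - (cyc ^^ i) x"
  "(cyc ^^ i) (fscale c x) = fscale c ((cyc ^^ i) x)"
  "(cyc ^^ i) (sum h S) = (\<Sum>s\<in>S. (cyc ^^ i) (h s))"
  by (induction i) simp_all

lemma lin_cyc_pow: "lin F \<Longrightarrow> lin (\<lambda>z. (cyc ^^ i) (F z))"
  by (simp add: lin_iff)

lemma cyc_pow_words: "z \<in> words n \<Longrightarrow> (cyc ^^ i) z \<in> words n"
  by (induction i) (simp_all add: cyc_words)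

lemma cyc_pow_append:
  fixes u v :: "'a list"
  shows "(cyc ^^ length v) (fword (u @ v) :: 'a list \<Rightarrow>\<^sub>0 'k::field)
    = fscale ((- 1) ^ (length v * (length u + length v + 1))) (fword (v @ u))"
proof (induction v arbitrary: u)
  case (Cons a v)
  have "(cyc ^^ length (a # v)) (fword (u @ a # v) :: 'a list \<Rightarrow>\<^sub>0 'k)
      = cyc ((cyc ^^ length v) (fword ((u @ [a]) @ v)))"
    by simp
  also have "\<dots> = fscale ((- 1) ^ (length v * (length (u @ [a]) + length v + 1))) (cyc_word ((v @ u) @ [a]))"
    unfolding Cons by simp
  finally show ?case
    unfolding cyc_word_snoc by (simp add: minus_one_power_if)
qed simp

lemma cyc_pow_order: "z \<in> words n \<Longrightarrow> (cyc ^^ n) z = z"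
  by (rule lin_eq_on_words[OF lin_cyc_pow[OF lin_ident] lin_ident])
    (use cyc_pow_append[of _ "[]"] in \<open>auto simp: minus_one_power_if\<close>)

definition nrm :: "nat \<Rightarrow> ('a list \<Rightarrow>\<^sub>0 'k::field) \<Rightarrow> 'a list \<Rightarrow>\<^sub>0 'k"
  where "nrm n z = (\<Sum>i<n. (cyc ^^ i) z)"

lemma nrm_simps [simp]:
  "nrm n 0 = 0" "nrm n (x + y) = nrm n x + nrm n y" "nrm n (x - y) = nrm n x - nrm n y"
  "nrm n (fscale c x) = fscale c (nrm n x)" "nrm n (sum h S) = (\<Sum>s\<in>S. nrm n (h s))"
  by (simp_all add: nrm_def sum.distrib sum_subtractf fv.scale_sum_right)
    (simp add: sum.swap[of _ _ S])

lemma lin_nrm: "lin F \<Longrightarrow> lin (\<lambda>z. nrm n (F z))"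
  by (simp add: lin_iff)

lemma nrm_words: "z \<in> words n \<Longrightarrow> nrm m z \<in> words n"
  by (simp add: nrm_def cyc_pow_words words_sum)

lemma nrm_cyc:
  assumes "z \<in> words n"
  shows "nrm n (cyc z) = nrm n z"
proof -
  have "nrm n (cyc z) + z = (\<Sum>i<Suc n. (cyc ^^ i) z)"
    by (simp add: nrm_def sum.lessThan_Suc_shift funpow_swap1 del: sum.lessThan_Suc)
  also have "\<dots> = nrm n z + z" by (simp add: nrm_def cyc_pow_order[OF assms])
  finally show ?thesis by simp
qed

lemma cyc_nrm: "z \<in> words n \<Longrightarrow> cyc (nrm n z) = nrm n z"
  using nrm_cyc[of z n] by (simp add: nrm_def funpow_swap1)

lemma cyc_pow_nrm: "z \<in> words n \<Longrightarrow> (cyc ^^ i) (nrm n z) = nrm n z"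
  by (induction i) (simp_all add: cyc_nrm)

lemma nrm_cyc_pow: "z \<in> words n \<Longrightarrow> nrm n ((cyc ^^ i) z) = nrm n z"
  by (induction i) (simp_all add: nrm_cyc cyc_pow_words)

text \<open>Every summand of the boundary is a conjugate of the first one by a power of the cyclic
  operator.\<close>

lemma bar_conv_face:
  fixes z :: "'a::ring list \<Rightarrow>\<^sub>0 'k::field"
  assumes "z \<in> words (Suc n)"
  shows "bar z = (\<Sum>k<n. (cyc ^^ k) (face ((cyc ^^ (Suc n - k)) z)))"
proof (rule lin_eq_on_words[OF _ _ assms])
  fix w :: "'a list" assume w: "length w = Suc n"
  have "fscale ((- 1) ^ k) (fword (take k w @ [w ! k * w ! Suc k] @ drop (k + 2) w))
      = (cyc ^^ k) (face ((cyc ^^ (Suc n - k)) (fword w)) :: 'a list \<Rightarrow>\<^sub>0 'k)" if "k < n" for k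
  proof -
    define u v where "u = take k w" and "v = drop (k + 2) w"
    have uv: "w = u @ w ! k # w ! Suc k # v" "length u = k"
      using that w by (simp_all add: u_def v_def Cons_nth_drop_Suc)
    have lv: "Suc n - k = length (w ! k # w ! Suc k # v)" using that w by (simp add: v_def)
    have "(cyc ^^ (Suc n - k)) (fword w :: 'a list \<Rightarrow>\<^sub>0 'k)
        = fscale ((- 1) ^ (length v * (k + length v + 1))) (fword ((w ! k # w ! Suc k # v) @ u))"
      unfolding lv
      by (subst uv(1), subst cyc_pow_append, cases "even (length v)"; cases "even k")
        (simp_all add: uv(2) minus_one_power_if)
    then have "(cyc ^^ k) (face ((cyc ^^ (Suc n - k)) (fword w)) :: 'a list \<Rightarrow>\<^sub>0 'k)
        = fscale ((- 1) ^ (length v * (k + length v + 1)))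
          ((cyc ^^ k) (fword (((w ! k * w ! Suc k) # v) @ u)))"
      by simp
    also have "\<dots> = fscale ((- 1) ^ k) (fword (u @ (w ! k * w ! Suc k) # v))"
      using cyc_pow_append[of u "(w ! k * w ! Suc k) # v", where 'k = 'k]
      by (cases "even (length v)"; cases "even k") (simp_all add: uv(2) minus_one_power_if)
    finally show ?thesis by (simp add: u_def v_def)
  qed
  then show "bar (fword w :: 'a list \<Rightarrow>\<^sub>0 'k) = (\<Sum>k<n. (cyc ^^ k) (face ((cyc ^^ (Suc n - k)) (fword w))))"
    using w by (simp add: bar_word_conv_sum)
qed (intro lin_intros lin_cyc_pow)+

lemma hoch_conv_bar:
  assumes "z \<in> words (Suc n)"
  shows "hoch z = bar z + face (cyc z)" (is "?F z = ?G z")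
proof (rule lin_eq_on_words[of ?F ?G, OF _ _ assms])
  show "?F (fword w) = ?G (fword w)" if "length w = Suc n" for w
    using that by (cases w rule: rev_cases) (auto simp: hoch_word_snoc cyc_word_snoc)
qed (intro lin_intros)+

text \<open>The identity \<open>N b = b' N\<close>. Next to a norm the powers of the cyclic operator in the summands
  of the boundaries disappear, so that both sides are \<open>N\<close> times the first summand times \<open>N\<close>.\<close>

lemma nrm_hoch:
  assumes z: "z \<in> words (Suc n)"
  shows "nrm n (hoch z) = bar (nrm (Suc n) z)"
proof -
  have f: "face ((cyc ^^ i) z) \<in> words n" for i
    using z by (intro face_words cyc_pow_words)
  have "nrm n (hoch z) = (\<Sum>k<n. nrm n (face ((cyc ^^ (Suc n - k)) z))) + nrm n (face (cyc z))"
    using nrm_cyc_pow[OF f] z by (simp add: hoch_conv_bar bar_conv_face)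
  also have "\<dots> = (\<Sum>k<Suc n. nrm n (face ((cyc ^^ (Suc n - k)) z)))"
    by simp
  also have "\<dots> = (\<Sum>i<Suc n. nrm n (face ((cyc ^^ Suc i) z)))"
    by (subst sum.nat_diff_reindex[symmetric]) (simp add: Suc_diff_Suc)
  also have "\<dots> = nrm n (face (nrm (Suc n) (cyc z)))"
    unfolding nrm_def[of "Suc n"] by (simp add: funpow_swap1 del: sum.lessThan_Suc)
  also have "\<dots> = nrm n (face (nrm (Suc n) z))"
    by (simp only: nrm_cyc[OF z])
  also have "\<dots> = (\<Sum>k<n. (cyc ^^ k) (face ((cyc ^^ (Suc n - k)) (nrm (Suc n) z))))"
    using cyc_pow_nrm[OF z] by (simp add: nrm_def[of n])
  also have "\<dots> = bar (nrm (Suc n) z)"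
    using bar_conv_face[OF nrm_words[OF z]] by simp
  finally show ?thesis .
qed

lemma minus_cyc_pow: "z - (cyc ^^ i) z = (\<Sum>j<i. (cyc ^^ j) z) - cyc (\<Sum>j<i. (cyc ^^ j) z)"
proof (induction i)
  case (Suc i)
  have "z - (cyc ^^ Suc i) z = (z - (cyc ^^ i) z) + ((cyc ^^ i) z - cyc ((cyc ^^ i) z))" by simp
  then show ?case unfolding Suc by (simp add: algebra_simps)
qed simp

text \<open>Up to a factor, the norm projects onto the invariants of the cyclic operator, along the
  image of \<open>1 - t\<close>.\<close>

lemma nrm_complement:
  assumes "z \<in> words n"
  obtains y where "y \<in> words n" "fscale (of_nat n) z - nrm n z = y - cyc y"
proof
  let ?y = "\<Sum>i<n. \<Sum>j<i. (cyc ^^ j) z"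
  show "?y \<in> words n" using assms by (intro words_sum cyc_pow_words)
  have "fscale (of_nat n) z - nrm n z = (\<Sum>i<n. z - (cyc ^^ i) z)"
    by (simp add: nrm_def sum_subtractf) (metis card_lessThan fv.sum_constant_scale)
  also have "\<dots> = ?y - cyc ?y"
    unfolding minus_cyc_pow by (simp add: sum_subtractf)
  finally show "fscale (of_nat n) z - nrm n z = ?y - cyc ?y" .
qed

section \<open>Compatibility with the tensor relations\<close>

context unital_algebra
begin

lemma scale_mult_left_linear: "(a + scale c b) * x = a * x + scale c (b * x)"
  by (simp add: algebra_simps scale_mult_left)

lemma scale_mult_right_linear: "x * (a + scale c b) = x * a + scale c (x * b)"
  by (simp add: algebra_simps scale_mult_right)

lemma ml_lmul_word: "ml (\<lambda>a. lmul_word a w)"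
proof (cases w)
  case (Cons b v)
  show ?thesis
    unfolding Cons lmul_word.simps
    by (rule mlin_linear_arg[where g = "\<lambda>y. fword (y # v)"])
      (use mlin_word[of scale "[]" v] in \<open>auto simp: scale_mult_left_linear\<close>)
qed (simp add: mlin_zero)

lemma respectful_lmul: "respectful (lmul_word c)"
proof (rule descendsI)
  show "ml (\<lambda>a. lmul_word c (u @ a # v))" for u v
  proof (cases u)
    case Nil
    have "ml (\<lambda>a. fword ((c * a) # v))"
      by (rule mlin_linear_arg[where g = "\<lambda>y. fword (y # v)"])
        (use mlin_word[of scale "[]" v] in \<open>auto simp: scale_mult_right_linear\<close>)
    then show ?thesis using Nil by simp
  next
    case (Cons b u')
    then show ?thesis using mlin_word[of scale "(c * b) # u'" v] by simp
  qed
qed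

lemma respectful_bar: "respectful bar_word"
proof (rule descendsI)
  show "ml (\<lambda>a. bar_word (u @ a # v))" for u v
  proof (induction u)
    case Nil
    show ?case by (auto intro!: mlin_diff ml_lmul_word mlin_cons)
  next
    case (Cons b u)
    have "ml (\<lambda>a. lmul_word b (u @ a # v))"
      using mlin_lin_ext[OF respectful_lmul mlin_word[of scale u v], of b] by simp
    then show ?case using Cons by (auto intro!: mlin_diff mlin_lin_ext[OF descends_cons])
  qed
qed

lemma respectful_hoch: "respectful hoch_word"
proof (rule descendsI)
  fix u v
  have bar: "ml (\<lambda>a. bar_word (u @ a # v))"
    using mlin_lin_ext[OF respectful_bar mlin_word[of scale u v]] by simp
  show "ml (\<lambda>a. hoch_word (u @ a # v))"
  proof (cases v rule: rev_cases)
    case Nil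
    then show ?thesis using bar by (auto simp: hoch_word_snoc intro!: mlin_add mlin_fscale ml_lmul_word)
  next
    case (snoc v' c)
    have *: "ml (\<lambda>a. bar_word (u @ a # v) + fscale ((- 1) ^ (length u + Suc (length v'))) (lmul_word c (u @ a # v')))"
      using mlin_lin_ext[OF respectful_lmul mlin_word[of scale u v'], of c]
      by (intro mlin_add mlin_fscale bar) simp
    have eq: "hoch_word (u @ a # v) = bar_word (u @ a # v)
        + fscale ((- 1) ^ (length u + Suc (length v'))) (lmul_word c (u @ a # v'))" for a
      using hoch_word_snoc[of "u @ a # v'" c] snoc by simp
    show ?thesis unfolding eq by (rule *)
  qed
qed

lemma respectful_cyc: "respectful cyc_word"
proof (rule descendsI)
  fix u v
  show "ml (\<lambda>a. cyc_word (u @ a # v))"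
  proof (cases v rule: rev_cases)
    case Nil
    then show ?thesis using mlin_word[of scale "[]" u] by (auto simp: cyc_word_snoc intro!: mlin_fscale)
  next
    case (snoc v' c)
    have *: "ml (\<lambda>a. fscale ((- 1) ^ (length u + Suc (length v'))) (fword (c # u @ a # v')))"
      using mlin_word[of scale "c # u" v'] by (intro mlin_fscale) simp
    have eq: "cyc_word (u @ a # v) = fscale ((- 1) ^ (length u + Suc (length v'))) (fword (c # u @ a # v'))" for a
      using cyc_word_snoc[of "u @ a # v'" c] snoc by simp
    show ?thesis unfolding eq by (rule *)
  qed
qed

lemma eqv_cyc_pow: "x \<approx> y \<Longrightarrow> (cyc ^^ i) x \<approx> (cyc ^^ i) y"
  by (induction i) (auto intro: descends_eq[OF respectful_cyc])

lemma eqv_sum: "(\<And>i. i \<in> S \<Longrightarrow> f i \<approx> g i) \<Longrightarrow> sum f S \<approx> sum g S"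
  using tensor_rels_sum[of S "\<lambda>i. f i - g i" scale] by (simp add: tensor_eq_def sum_subtractf)

lemma eqv_nrm: "x \<approx> y \<Longrightarrow> nrm n x \<approx> nrm n y"
  unfolding nrm_def by (intro eqv_sum eqv_cyc_pow)

lemma eqv_nrm_invariant:
  assumes "cyc z \<approx> z"
  shows "nrm n z \<approx> fscale (of_nat n) z"
proof -
  have "(cyc ^^ i) z \<approx> z" for i
  proof (induction i)
    case (Suc i)
    from descends_eq[OF respectful_cyc Suc] assms show ?case by (auto intro: tensor_eq_trans)
  qed simp
  then have "nrm n z \<approx> (\<Sum>i<n. z)" unfolding nrm_def by (intro eqv_sum)
  then show ?thesis by (metis card_lessThan fv.sum_constant_scale)
qed

end

section \<open>Antisymmetrization as iterated insertion\<close>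

text \<open>Recursion along the word instead of a sum over positions: commutation rules with the other
  operators become inductions.\<close>

fun ins_word :: "'a \<Rightarrow> 'a list \<Rightarrow> 'a list \<Rightarrow>\<^sub>0 'k::field"
  where "ins_word x [] = fword [x]"
  | "ins_word x (c # u) = fword (x # c # u) - cons c (ins_word x u)"

abbreviation "ins x \<equiv> lin_ext (ins_word x)"

fun ins1_word :: "'a \<Rightarrow> 'a list \<Rightarrow> 'a list \<Rightarrow>\<^sub>0 'k::field"
  where "ins1_word x [] = 0"
  | "ins1_word x (a # u) = cons a (ins_word x u)"

abbreviation "ins1 x \<equiv> lin_ext (ins1_word x)"
abbreviation "antisymmetrize \<equiv> lin_ext antisym_word"

lemma ins_word_conv_sum:
  "ins_word x u = (\<Sum>b\<le>length u. fscale ((- 1) ^ b) (fword (take b u @ x # drop b u)))"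
proof (induction u)
  case (Cons c u)
  show ?case
    by (simp add: Cons sum.atMost_Suc_shift sum_negf del: sum.atMost_Suc)
qed simp

text \<open>The cycle that moves the entry at position \<open>N\<close> of a word of length \<open>N + 1\<close> to position \<open>b\<close>.\<close>

definition insertion_cycle :: "nat \<Rightarrow> nat \<Rightarrow> nat \<Rightarrow> nat"
  where "insertion_cycle N b i = (if i < b \<or> N < i then i else if i = b then N else i - 1)"

lemma insertion_cycle:
  assumes "b \<le> N"
  shows insertion_cycle_permutes: "insertion_cycle N b permutes {b..N}"
    and sign_insertion_cycle: "sign (insertion_cycle N b) = (- 1) ^ (N - b)"
proof -
  have "insertion_cycle N b permutes {b..N} \<and> sign (insertion_cycle N b) = (- 1) ^ (N - b)"
    using assms
  proof (induction rule: inc_induct)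
    case base
    have "insertion_cycle N N = id" by (auto simp: insertion_cycle_def)
    then show ?case by (metis diff_self_eq_0 permutes_id power_0 sign_id)
  next
    case (step b)
    have eq: "insertion_cycle N b = insertion_cycle N (Suc b) \<circ> transpose b (Suc b)"
      using step.hyps by (auto simp: insertion_cycle_def transpose_def fun_eq_iff)
    have "insertion_cycle N (Suc b) permutes {b..N}"
      by (rule permutes_subset[of _ "{Suc b..N}"]) (use step.IH in auto)
    moreover have "transpose b (Suc b) permutes {b..N}"
      by (rule permutes_swap_id) (use step.hyps in auto)
    moreover from calculation have "sign (insertion_cycle N b) = sign (insertion_cycle N (Suc b)) * - 1"
      unfolding eq by (subst sign_compose) (auto intro: permutes_imp_permutation[of "{b..N}"] simp: sign_swap_id)
    moreover have "N - b = Suc (N - Suc b)" using step.hyps by simp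
    moreover have "insertion_cycle N b permutes {b..N}"
      unfolding eq by (rule permutes_compose) fact+
    ultimately show ?case using step.IH by simp
  qed
  then show "insertion_cycle N b permutes {b..N}" "sign (insertion_cycle N b) = (- 1) ^ (N - b)" by auto
qed

lemma permute_list_insertion_cycle:
  assumes "b \<le> length w"
  shows "permute_list (insertion_cycle (length w) b) (w @ [x]) = take b w @ x # drop b w"
proof (rule nth_equalityI)
  fix i assume i: "i < length (permute_list (insertion_cycle (length w) b) (w @ [x]))"
  then have "permute_list (insertion_cycle (length w) b) (w @ [x]) ! i = (w @ [x]) ! insertion_cycle (length w) b i"
    by (simp add: permute_list_def del: upt_Suc)
  also have "\<dots> = (take b w @ x # drop b w) ! i"
  proof (cases i b rule: linorder_cases)
    case greater
    then obtain j where "i = Suc (b + j)" by (metis less_iff_Suc_add add_Suc_right)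
    then show ?thesis using i assms by (simp add: insertion_cycle_def nth_append)
  qed (use i assms in \<open>simp_all add: insertion_cycle_def nth_append\<close>)
  finally show "permute_list (insertion_cycle (length w) b) (w @ [x]) ! i = (take b w @ x # drop b w) ! i" .
qed (use assms in simp)

lemma permute_list_append_fixed:
  assumes "q permutes {1..<length w}"
  shows "permute_list q (w @ [x]) = permute_list q w @ [x]"
proof -
  have "q permutes {..<length w}" by (rule permutes_subset[OF assms]) auto
  then have "q i < length w" if "i < length w" for i
    using permutes_in_image[of q "{..<length w}" i] that by auto
  moreover have "q (length w) = length w" by (rule permutes_not_in[OF assms]) auto
  ultimately show ?thesis by (simp add: permute_list_def nth_append)
qed

text \<open>A permutation of \<open>{1..N}\<close> is determined by the position that it sends to \<open>N\<close> and by a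
  permutation of the rest.\<close>

lemma bij_betw_insertion_cycle:
  assumes "N \<ge> 1"
  shows "bij_betw (\<lambda>(b, q). q \<circ> insertion_cycle N b) ({1..N} \<times> {q. q permutes {1..<N}}) {p. p permutes {1..N}}"
  unfolding bij_betw_def
proof (intro conjI)
  have cyc: "insertion_cycle N b permutes {1..N}" if "b \<in> {1..N}" for b
    by (rule permutes_subset[OF insertion_cycle_permutes]) (use that in auto)
  have at: "insertion_cycle N b i = N \<longleftrightarrow> i = b" if "b \<in> {1..N}" for b i
    using that by (auto simp: insertion_cycle_def)
  have fix_N: "q i = N \<longleftrightarrow> i = N" if "q permutes {1..<N}" for q i
  proof -
    have "q N = N" by (rule permutes_not_in[OF that]) simp
    then show ?thesis using inj_eq[OF permutes_inj[OF that], of i N] by simp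
  qed
  show "inj_on (\<lambda>(b, q). q \<circ> insertion_cycle N b) ({1..N} \<times> {q. q permutes {1..<N}})"
  proof (rule inj_onI, clarify)
    fix b q b' q'
    assume b: "b \<in> {1..N}" "b' \<in> {1..N}" and q: "q permutes {1..<N}" "q' permutes {1..<N}"
      and eq: "q \<circ> insertion_cycle N b = q' \<circ> insertion_cycle N b'"
    have "(q \<circ> insertion_cycle N b) b = N" using at[OF b(1)] fix_N[OF q(1)] by simp
    then have "b' = b" using at[OF b(2)] fix_N[OF q(2)] by (simp add: eq)
    moreover have "q = q'"
    proof
      fix i
      have "q i = (q \<circ> insertion_cycle N b) (inv_into UNIV (insertion_cycle N b) i)"
        using permutes_inverses(1)[OF cyc[OF b(1)]] by simp
      also have "\<dots> = q' i"
        unfolding eq using permutes_inverses(1)[OF cyc[OF b(1)]] \<open>b' = b\<close> by simp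
      finally show "q i = q' i" .
    qed
    ultimately show "b = b' \<and> q = q'" by simp
  qed
  show "(\<lambda>(b, q). q \<circ> insertion_cycle N b) ` ({1..N} \<times> {q. q permutes {1..<N}}) = {p. p permutes {1..N}}"
  proof (intro equalityI subsetI)
    fix p assume "p \<in> {p. p permutes {1..N}}"
    then have p: "p permutes {1..N}" by simp
    define b where "b = inv_into UNIV p N"
    have b: "b \<in> {1..N}"
      using permutes_in_image[OF permutes_inv[OF p], of N] assms by (simp add: b_def)
    define q where "q = p \<circ> inv_into UNIV (insertion_cycle N b)"
    have q: "q permutes {1..N}"
      unfolding q_def by (rule permutes_compose[OF permutes_inv[OF cyc[OF b]] p])
    have "q N = N"
      using permutes_inv_eq[OF cyc[OF b], of N b] at[OF b, of b] permutes_inverses(1)[OF p, of N]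
      by (simp add: q_def b_def)
    then have "q x = x" if "x \<in> {1..N} - {1..<N}" for x
      using that by (cases "x = N") auto
    then have "q permutes {1..<N}" by (rule permutes_superset[OF q])
    moreover have "p = q \<circ> insertion_cycle N b"
      by (rule ext) (simp add: q_def permutes_inverses(2)[OF cyc[OF b]])
    ultimately show "p \<in> (\<lambda>(b, q). q \<circ> insertion_cycle N b) ` ({1..N} \<times> {q. q permutes {1..<N}})"
      using b by force
  next
    fix p assume "p \<in> (\<lambda>(b, q). q \<circ> insertion_cycle N b) ` ({1..N} \<times> {q. q permutes {1..<N}})"
    then obtain b q where p: "p = q \<circ> insertion_cycle N b" and b: "b \<in> {1..N}" and q: "q permutes {1..<N}" by auto
    have "q permutes {1..N}" by (rule permutes_subset[OF q]) auto
    then show "p \<in> {p. p permutes {1..N}}" using permutes_compose[OF cyc[OF b]] p by auto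
  qed
qed

lemma antisym_word_conv_sum:
  "antisym_word w = (\<Sum>\<sigma> | \<sigma> permutes {1..<length w}. fscale (of_int (sign \<sigma>)) (fword (permute_list \<sigma> w)))"
  unfolding antisym_word_def
  by (subst sum_permutations_inverse)
    (auto intro!: sum.cong simp: permutes_inv_inv
      sign_inverse[OF permutes_imp_permutation[of "{1..<length w}"], simplified])

lemma antisym_word_singleton [simp]: "antisym_word [x] = fword [x]"
  by (simp add: antisym_word_conv_sum)

lemma antisym_word_Nil [simp]: "antisym_word [] = fword []"
  by (simp add: antisym_word_conv_sum)

lemma antisym_word_words: "antisym_word w \<in> words (length w)"
  unfolding antisym_word_def by (auto intro!: words_sum words_fscale)

lemma antisym_words: "z \<in> words n \<Longrightarrow> antisymmetrize z \<in> words n"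
  by (rule lin_ext_words) (use antisym_word_words in auto)

text \<open>Summation over the position of the last letter. The sign compensates that the cycle from the
  last position to position \<open>b\<close> has length \<open>N - b + 1\<close>, whereas insertion counts positions from the
  front.\<close>

lemma antisym_word_snoc:
  fixes w :: "'a list"
  assumes "w \<noteq> []"
  shows "(antisym_word (w @ [x]) :: 'a list \<Rightarrow>\<^sub>0 'k::field) = fscale ((- 1) ^ (length w - 1)) (ins1 x (antisym_word w))"
proof -
  let ?N = "length w"
  let ?g = "insertion_cycle ?N"
  have N: "?N \<ge> 1" using assms by (cases w) auto
  have summand: "(fscale (of_int (sign (q \<circ> ?g b))) (fword (permute_list (q \<circ> ?g b) (w @ [x]))) :: 'a list \<Rightarrow>\<^sub>0 'k)
      = fscale (of_int (sign q)) (fscale ((- 1) ^ (?N - b)) (fword (take b (permute_list q w) @ x # drop b (permute_list q w))))"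
    if b: "b \<in> {1..?N}" and q: "q permutes {1..<?N}" for b q
  proof -
    have g: "?g b permutes {b..?N}" using b by (intro insertion_cycle_permutes) auto
    have "permute_list (q \<circ> ?g b) (w @ [x]) = permute_list (?g b) (permute_list q (w @ [x]))"
      by (rule permute_list_compose, rule permutes_subset[OF g]) auto
    also have "\<dots> = take b (permute_list q w) @ x # drop b (permute_list q w)"
      using permute_list_insertion_cycle[of b "permute_list q w" x] b
      by (simp add: permute_list_append_fixed[OF q])
    finally have 1: "permute_list (q \<circ> ?g b) (w @ [x]) = take b (permute_list q w) @ x # drop b (permute_list q w)" .
    have "sign (q \<circ> ?g b) = sign q * (- 1) ^ (?N - b)"
      using sign_compose[of q "?g b"] q g b sign_insertion_cycle[of b ?N]
      by (auto simp: permutation_permutes)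
    then show ?thesis by (simp add: 1)
  qed
  have inner: "(\<Sum>b\<in>{1..?N}. fscale ((- 1) ^ (?N - b)) (fword (take b v @ x # drop b v)))
      = fscale ((- 1) ^ (?N - 1)) (ins1_word x v :: 'a list \<Rightarrow>\<^sub>0 'k)" if "length v = ?N" for v
  proof -
    obtain a u where v: "v = a # u" and u: "?N = Suc (length u)" using \<open>length v = ?N\<close> N by (cases v) auto
    have "(\<Sum>b\<in>{1..?N}. fscale ((- 1) ^ (?N - b)) (fword (take b v @ x # drop b v)))
        = (\<Sum>b\<le>length u. fscale ((- 1) ^ (?N - Suc b)) (fword (take (Suc b) v @ x # drop (Suc b) v)) :: 'a list \<Rightarrow>\<^sub>0 'k)"
      by (rule sum.reindex_bij_witness[of _ Suc "\<lambda>b. b - 1"]) (auto simp: u)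
    also have "\<dots> = (\<Sum>b\<le>length u. fscale ((- 1) ^ length u) (cons a (fscale ((- 1) ^ b) (fword (take b u @ x # drop b u)))))"
      by (rule sum.cong) (auto simp: v u minus_one_power_if)
    also have "\<dots> = fscale ((- 1) ^ (?N - 1)) (ins1_word x v)"
      by (simp add: v u ins_word_conv_sum fv.scale_sum_right)
    finally show ?thesis .
  qed
  have "(antisym_word (w @ [x]) :: 'a list \<Rightarrow>\<^sub>0 'k)
      = (\<Sum>p | p permutes {1..?N}. fscale (of_int (sign p)) (fword (permute_list p (w @ [x]))))"
    by (simp add: antisym_word_conv_sum atLeastLessThanSuc_atLeastAtMost)
  also have "\<dots> = (\<Sum>(b, q)\<in>{1..?N} \<times> {q. q permutes {1..<?N}}.
      fscale (of_int (sign (q \<circ> ?g b))) (fword (permute_list (q \<circ> ?g b) (w @ [x]))))"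
    by (subst sum.reindex_bij_betw[OF bij_betw_insertion_cycle[OF N], symmetric]) (simp add: case_prod_unfold)
  also have "\<dots> = (\<Sum>(b, q)\<in>{1..?N} \<times> {q. q permutes {1..<?N}}.
      fscale (of_int (sign q)) (fscale ((- 1) ^ (?N - b)) (fword (take b (permute_list q w) @ x # drop b (permute_list q w)))))"
    by (intro sum.cong refl) (use summand in auto)
  also have "\<dots> = (\<Sum>q | q permutes {1..<?N}. fscale (of_int (sign q))
      (\<Sum>b\<in>{1..?N}. fscale ((- 1) ^ (?N - b)) (fword (take b (permute_list q w) @ x # drop b (permute_list q w)))))"
    by (simp add: sum.cartesian_product[symmetric] fv.scale_sum_right del: fv.scale_scale) (rule sum.swap)
  also have "\<dots> = (\<Sum>q | q permutes {1..<?N}. fscale (of_int (sign q))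
      (fscale ((- 1) ^ (?N - 1)) (ins1_word x (permute_list q w))))"
    by (simp only: inner length_permute_list)
  also have "\<dots> = fscale ((- 1) ^ (?N - 1)) (ins1 x (antisym_word w))"
    by (simp add: antisym_word_conv_sum fv.scale_sum_right mult.commute)
  finally show ?thesis .
qed

section \<open>Antisymmetrization is a chain map\<close>

lemma ins_cons: "ins x (cons c z) = cons x (cons c z) - cons c (ins x z)"
  by (rule lin_eq) (auto intro!: lin_intros)

lemma ins1_cons: "ins1 x (cons c z) = cons c (ins x z)"
  by (rule lin_eq) (auto intro!: lin_intros)

lemma ins_word_conv_ins1: "w \<noteq> [] \<Longrightarrow> ins_word x w = fword (x # w) - ins1_word x w"
  by (cases w) auto

lemma ins_conv_ins1:
  assumes "z \<in> words n" "n > 0"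
  shows "ins x z = cons x z - ins1 x z" (is "?F z = ?G z")
  by (rule lin_eq_on_words[of ?F ?G, OF _ _ assms(1)])
    (use assms(2) in \<open>auto intro!: lin_intros ins_word_conv_ins1\<close>)

lemma ins_word_snoc:
  "ins_word x (u @ [c]) = snoc c (ins_word x u) - fscale ((- 1) ^ length u) (fword (u @ [c, x]))"
proof (induction u)
  case (Cons a u)
  show ?case by (simp add: Cons cons_snoc)
qed simp

lemma ins1_word_snoc:
  "v \<noteq> [] \<Longrightarrow> ins1_word x (v @ [c]) = snoc c (ins1_word x v) + fscale ((- 1) ^ length v) (fword (v @ [c, x]))"
  by (cases v) (simp_all add: ins_word_snoc cons_snoc)

lemma ins_word_words: "ins_word x w \<in> words (Suc (length w))"
  by (induction w) (auto intro!: words_diff cons_words)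

lemma ins1_word_words: "ins1_word x w \<in> words (Suc (length w))"
  by (cases w) (auto intro!: cons_words ins_word_words words_zero)

lemma ins_words: "z \<in> words n \<Longrightarrow> ins x z \<in> words (Suc n)"
  by (rule lin_ext_words) (use ins_word_words in auto)

lemma ins1_lmul: "ins1 x (lmul c z) = lmul c (ins1 x z)" (is "?F z = ?G z")
proof (rule lin_eq[of ?F ?G])
  show "?F (fword w) = ?G (fword w)" for w
    by (cases w) (simp_all add: lmul_cons)
qed (intro lin_intros)+

lemmas ins1_lmul_word = ins1_lmul[of _ _ "fword w" for w, unfolded lin_ext_fword]

lemma antisymmetrize_snoc:
  assumes "z \<in> words n" "n > 0"
  shows "antisymmetrize (snoc x z) = fscale ((- 1) ^ (n - 1)) (ins1 x (antisymmetrize z))" (is "?F z = ?G z")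
proof (rule lin_eq_on_words[of ?F ?G, OF _ _ assms(1)])
  show "?F (fword w) = ?G (fword w)" if "length w = n" for w
    using that assms(2) antisym_word_snoc[of w x] by auto
qed (intro lin_intros)+

lemma ad_ins_word: "ad x (ins_word y w) = ins y (ad_word x w) + ins_word (bracket y x) w"
proof (induction w)
  case (Cons c w)
  show ?case by (simp add: Cons ad_cons ins_cons algebra_simps)
qed simp

lemma ad_ins1: "ad x (ins1 y z) = ins1 y (ad x z) + ins1 (bracket y x) z" (is "?F z = ?G z")
proof (rule lin_eq[of ?F ?G])
  show "?F (fword w) = ?G (fword w)" for w
    by (cases w) (simp_all add: ad_cons ins1_cons ad_ins_word)
qed (intro lin_intros)+

lemma antisym_ad_word: "antisymmetrize (ad_word x w) = ad x (antisym_word w)"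
proof (induction w rule: rev_induct)
  case (snoc y w)
  show ?case
  proof (cases "w = []")
    case False
    have aw: "ad_word x w \<in> words (length w)" by (rule ad_word_words)
    show ?thesis
      using False
      by (simp add: ad_word_snoc antisymmetrize_snoc[OF aw] antisym_word_snoc snoc ad_ins1 fv.scale_right_distrib)
  qed simp
qed simp

context unital_algebra
begin

lemma respectful_ins: "respectful (ins_word x)"
proof (rule descendsI)
  show "ml (\<lambda>a. ins_word x (u @ a # v))" for u v
  proof (induction u)
    case Nil
    show ?case using mlin_word[of scale "[x]" v] by (auto intro!: mlin_diff mlin_cons)
  next
    case (Cons b u)
    then show ?case
      using mlin_word[of scale "x # b # u" v] by (auto intro!: mlin_diff mlin_lin_ext[OF descends_cons])
  qed
qed

lemma respectful_ins1: "respectful (ins1_word x)"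
proof (rule descendsI)
  show "ml (\<lambda>a. ins1_word x (u @ a # v))" for u v
  proof (cases u)
    case (Cons b u')
    have "ml (\<lambda>a. ins_word x (u' @ a # v))"
      using mlin_lin_ext[OF respectful_ins mlin_word[of scale u' v], of x] by simp
    then show ?thesis using Cons by (auto intro!: mlin_lin_ext[OF descends_cons])
  qed (simp add: mlin_cons)
qed

lemma ml_ins_word: "ml (\<lambda>x. ins_word x w)"
proof (induction w)
  case Nil
  show ?case using mlin_word[of scale "[]" "[]"] by simp
next
  case (Cons c w)
  then show ?case
    using mlin_word[of scale "[]" "c # w"] by (auto intro!: mlin_diff mlin_lin_ext[OF descends_cons])
qed

lemma ml_ins1: "ml (\<lambda>x. ins1 x z)"
proof (rule mlin_of_words)
  show "ml (\<lambda>x. ins1_word x w)" for w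
    by (cases w) (auto intro!: mlin_zero mlin_lin_ext[OF descends_cons] ml_ins_word)
qed

lemma respectful_antisym: "respectful antisym_word"
proof (rule descendsI)
  fix u v
  show "ml (\<lambda>a. antisym_word (u @ a # v))"
  proof (induction v rule: rev_induct)
    case Nil
    show ?case
    proof (cases "u = []")
      case True
      then show ?thesis using mlin_word[of scale "[]" "[]"] by simp
    next
      case False
      then show ?thesis by (auto simp: antisym_word_snoc intro!: mlin_fscale ml_ins1)
    qed
  next
    case (snoc x v)
    have *: "ml (\<lambda>a. fscale ((- 1) ^ (length u + Suc (length v) - 1)) (ins1 x (antisym_word (u @ a # v))))"
      using snoc by (intro mlin_fscale mlin_lin_ext[OF respectful_ins1])
    have eq: "antisym_word (u @ a # v @ [x])
        = fscale ((- 1) ^ (length u + Suc (length v) - 1)) (ins1 x (antisym_word (u @ a # v)))" for a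
      using antisym_word_snoc[of "u @ a # v" x] by simp
    show ?case unfolding eq by (rule *)
  qed
qed

text \<open>Insertion of \<open>x\<close> behind the first letter is a homotopy from the action of \<open>x\<close> to zero. Without
  its last summand the boundary leaves over the left multiplication by \<open>x\<close>, which that summand
  cancels.\<close>

lemma bar_ins1: "bar (ins1_word x w) + ins1 x (bar_word w) \<approx> ad_word x w + lmul_word x w"
proof (induction w)
  case (Cons a w)
  show ?case
  proof (cases "w = []")
    case True
    have "fword [bracket a x + x * a] \<approx> fword [bracket a x] + fword [x * a]"
      using mlin_tensor_eq_add[OF vs mlin_word[of scale "[]" "[]"]] by simp
    then show ?thesis using True by (simp add: bar_cons bracket_def)
  next
    case False
    then obtain c u where w: "w = c # u" by (cases w) auto
    have bw: "ins x (bar_word w) = cons x (bar_word w) - ins1 x (bar_word w)"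
    proof (cases "u = []")
      case False
      then show ?thesis using bar_word_words[of w] w by (intro ins_conv_ins1) auto
    qed (simp add: w)
    have "bar (ins_word x w) + ins x (bar_word w)
        = lmul_word x w - (bar (ins1_word x w) + ins1 x (bar_word w))"
      using False by (simp add: ins_word_conv_ins1 bw bar_cons)
    also have "\<dots> \<approx> lmul_word x w - (ad_word x w + lmul_word x w)"
      by (rule tensor_eq_diff[OF tensor_eq_refl Cons])
    finally have *: "cons a (bar (ins_word x w) + ins x (bar_word w)) \<approx> cons a (- ad_word x w)"
      by (intro descends_eq[OF descends_cons]) simp
    have "bar (ins1_word x (a # w)) + ins1 x (bar_word (a # w))
        = (lmul a (ins_word x w) + ins1 x (lmul_word a w)) - cons a (bar (ins_word x w) + ins x (bar_word w))"
      by (simp add: bar_cons ins1_cons)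
    also have "lmul a (ins_word x w) + ins1 x (lmul_word a w) = fword ((a * x) # w)"
      using False by (simp add: ins_word_conv_ins1 ins1_lmul_word)
    also have "fword ((a * x) # w) - cons a (bar (ins_word x w) + ins x (bar_word w))
        \<approx> fword ((a * x) # w) - cons a (- ad_word x w)"
      by (intro tensor_eq_diff tensor_eq_refl *)
    also have "\<dots> = fword ((bracket a x + x * a) # w) + cons a (ad_word x w)"
      by (simp add: bracket_def)
    also have "\<dots> \<approx> fword (bracket a x # w) + fword ((x * a) # w) + cons a (ad_word x w)"
      using mlin_tensor_eq_add[OF vs mlin_word[of scale "[]" w]] by (intro tensor_eq_add) simp_all
    finally show ?thesis by (simp add: algebra_simps)
  qed
qed simp

lemma hoch_ins1: "hoch (ins1_word x w) + ins1 x (hoch_word w) \<approx> ad_word x w"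
proof (cases w rule: rev_cases)
  case (snoc v c)
  show ?thesis
  proof (cases "v = []")
    case True
    have "fword [bracket c x + x * c] \<approx> fword [bracket c x] + fword [x * c]"
      using mlin_tensor_eq_add[OF vs mlin_word[of scale "[]" "[]"]] by simp
    then have "fword [c * x] - fword [x * c] \<approx> (fword [bracket c x] + fword [x * c]) - fword [x * c]"
      by (intro tensor_eq_diff) (simp_all add: bracket_def)
    then show ?thesis using snoc True hoch_word_snoc[of "[c]" x] by (simp add: bar_cons hoch_word_def)
  next
    case False
    let ?s = "fscale ((- 1) ^ length v) :: ('a list \<Rightarrow>\<^sub>0 'k) \<Rightarrow> _"
    have ss: "?s (?s z) = z" for z by (simp add: minus_one_power_if)
    have iv: "ins1_word x v \<in> words (Suc (length v))" by (rule ins1_word_words)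
    have ins: "ins1_word x w = snoc c (ins1_word x v) + ?s (snoc x (fword w))"
      using False snoc by (simp add: ins1_word_snoc)
    have "hoch (ins1_word x w) = hoch (snoc c (ins1_word x v)) + ?s (hoch (snoc x (fword w)))"
      unfolding ins by simp
    also have "\<dots> = bar (ins1_word x w) - ?s (lmul c (ins1_word x v)) - lmul_word x w"
    proof -
      have "length w = Suc (length v)" using snoc by simp
      then show ?thesis unfolding hoch_snoc[OF iv] ins
        by (simp add: hoch_word_snoc fv.scale_right_diff_distrib ss)
    qed
    finally have "(hoch (ins1_word x w) + ins1 x (hoch_word w) :: 'a list \<Rightarrow>\<^sub>0 'k)
        = bar (ins1_word x w) + ins1 x (bar_word w) - lmul_word x w"
      using snoc by (simp add: hoch_word_snoc ins1_lmul_word)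
    also have "\<dots> \<approx> (ad_word x w + lmul_word x w) - lmul_word x w"
      by (intro tensor_eq_diff tensor_eq_refl bar_ins1)
    finally show ?thesis by simp
  qed
qed simp

lemma hoch_ins1_lin: "hoch (ins1 x z) + ins1 x (hoch z) \<approx> ad x z"
  unfolding tensor_eq_def
  by (rule lin_into_subspace_UNIV[OF _ tensor_rels_subspace, where F = "\<lambda>z. hoch (ins1 x z) + ins1 x (hoch z) - ad x z"])
    (intro lin_intros, use hoch_ins1 in \<open>simp add: tensor_eq_def\<close>)

text \<open>Induction over the last letter: antisymmetrization is iterated insertion, and the homotopy
  formula matches the recursion of the Leibniz boundary.\<close>

lemma hoch_antisym_word: "hoch (antisym_word w) \<approx> antisymmetrize (leibniz_word w)"
proof (induction w rule: rev_induct)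
  case (snoc x w)
  show ?case
  proof (cases "w = []")
    case False
    then obtain m where m: "length w = Suc m" by (cases w) auto
    let ?s = "fscale ((- 1) ^ m) :: ('a list \<Rightarrow>\<^sub>0 'k) \<Rightarrow> _"
    have "hoch (antisym_word (w @ [x])) = ?s ((hoch (ins1 x (antisym_word w)) + ins1 x (hoch (antisym_word w)))
        - ins1 x (hoch (antisym_word w)))"
      using False by (simp add: antisym_word_snoc m)
    also have "\<dots> \<approx> ?s (ad x (antisym_word w) - ins1 x (antisymmetrize (leibniz_word w)))"
      by (intro tensor_eq_fscale tensor_eq_diff hoch_ins1_lin descends_eq[OF respectful_ins1] snoc)
    also have "\<dots> = antisymmetrize (leibniz_word (w @ [x]))"
    proof (cases m)
      case 0
      then have "leibniz_word w = (0 :: 'a list \<Rightarrow>\<^sub>0 'k)" using m by (cases w) auto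
      then show ?thesis using m 0 by (simp add: leibniz_word_snoc antisym_ad_word)
    next
      case (Suc k)
      have lw: "(leibniz_word w :: 'a list \<Rightarrow>\<^sub>0 'k) \<in> words m" using leibniz_word_words[of w] m by simp
      show ?thesis
        using Suc m
        by (simp add: leibniz_word_snoc antisym_ad_word antisymmetrize_snoc[OF lw] fv.scale_right_diff_distrib)
    qed
    finally show ?thesis .
  qed (simp add: hoch_word_def)
qed simp

lemma hoch_antisymmetrize: "hoch (antisymmetrize z) \<approx> antisymmetrize (leib z)"
  unfolding tensor_eq_def
  by (rule lin_into_subspace_UNIV[OF _ tensor_rels_subspace, where F = "\<lambda>z. hoch (antisymmetrize z) - antisymmetrize (leib z)"])
    (intro lin_intros, use hoch_antisym_word in \<open>simp add: tensor_eq_def\<close>)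

end

section \<open>Antisymmetrization kills repeated letters modulo cyclic permutations\<close>

text \<open>The signed sum over all permutations of a word, built by inserting its letters one by one.\<close>

fun alt_word :: "'a list \<Rightarrow> 'a list \<Rightarrow>\<^sub>0 'k::field"
  where "alt_word [] = fword []"
  | "alt_word (x # v) = ins x (alt_word v)"

lemma alt_word_words: "alt_word w \<in> words (length w)"
  by (induction w) (auto intro: ins_words)

lemma ins_ins_word: "ins x (ins_word y w) = - ins y (ins_word x w)"
  by (induction w) (simp_all add: ins_cons algebra_simps)

lemma ins_ins: "ins x (ins y z) = - ins y (ins x z)" (is "?F z = ?G z")
proof (rule lin_eq[of ?F ?G])
  show "?F (fword w) = ?G (fword w)" for w using ins_ins_word by auto
qed (intro lin_intros)+

lemma alt_word_snoc:
  fixes v :: "'a list"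
  shows "(alt_word (v @ [x]) :: 'a list \<Rightarrow>\<^sub>0 'k::field) = fscale ((- 1) ^ length v) (ins x (alt_word v))"
proof (induction v)
  case (Cons y v)
  have "(alt_word ((y # v) @ [x]) :: 'a list \<Rightarrow>\<^sub>0 'k) = fscale ((- 1) ^ length v) (ins y (ins x (alt_word v)))"
    by (simp add: Cons)
  then show ?case unfolding ins_ins[of y x] by simp
qed simp

lemma antisym_word_Cons:
  fixes v :: "'a list"
  shows "(antisym_word (a # v) :: 'a list \<Rightarrow>\<^sub>0 'k::field) = cons a (alt_word v)"
proof (induction v rule: rev_induct)
  case (snoc x v)
  show ?case
    using antisym_word_snoc[of "a # v" x, where 'k = 'k] by (simp add: snoc ins1_cons alt_word_snoc)
qed simp

text \<open>Insertions of letters anticommute, so that those of the two equal letters can be made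
  adjacent, and the square of an insertion is its own negative, so that it vanishes in
  characteristic zero.\<close>

lemma alt_word_nondistinct:
  "\<not> distinct w \<Longrightarrow> alt_word w = (0 :: 'a list \<Rightarrow>\<^sub>0 'k::field_char_0)"
proof (induction w)
  case (Cons x w)
  have "ins x (alt_word v) = (0 :: 'a list \<Rightarrow>\<^sub>0 'k)" if "x \<in> set v" for v
    using that
  proof (induction v)
    case (Cons y v)
    show ?case
    proof (cases "x = y")
      case True
      let ?y = "ins x (ins x (alt_word v)) :: 'a list \<Rightarrow>\<^sub>0 'k"
      have "?y = - ?y" by (rule ins_ins)
      then have "?y + ?y = 0" by (metis add.right_inverse)
      then have "fscale 2 ?y = 0" using fv.scale_left_distrib[of 1 1 ?y] by simp
      then show ?thesis using True by simp
    next
      case False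
      then have "ins x (alt_word v) = (0 :: 'a list \<Rightarrow>\<^sub>0 'k)" using Cons by auto
      then show ?thesis by (simp add: ins_ins[of x y])
    qed
  qed simp
  then show ?case using Cons by auto
qed simp

text \<open>Rotating the inserted letter to the front turns the signs of the insertion into those of the
  cyclic operator.\<close>

lemma ins_conv_cyc:
  fixes z :: "'a list \<Rightarrow>\<^sub>0 'k::field"
  assumes "z \<in> words m"
  shows "ins a z = (\<Sum>p\<le>m. (cyc ^^ p) (cons a ((cyc ^^ (m - p)) z)))" (is "?F z = ?G z")
proof (rule lin_eq_on_words[of ?F ?G, OF _ _ assms])
  fix u :: "'a list" assume u: "length u = m"
  have "fscale ((- 1) ^ p) (fword (take p u @ a # drop p u))
      = (cyc ^^ p) (cons a ((cyc ^^ (m - p)) (fword u :: 'a list \<Rightarrow>\<^sub>0 'k)))" if "p \<le> m" for p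
  proof -
    define v w where "v = take p u" and "w = drop p u"
    have vw: "u = v @ w" "length v = p" "m - p = length w" "m = p + length w" using that u by (auto simp: v_def w_def)
    have "(cyc ^^ (m - p)) (fword u :: 'a list \<Rightarrow>\<^sub>0 'k) = fscale ((- 1) ^ (length w * (p + length w + 1))) (fword (w @ v))"
      unfolding vw(1,3) cyc_pow_append vw(2) ..
    moreover have "(cyc ^^ p) (fword ((a # w) @ v) :: 'a list \<Rightarrow>\<^sub>0 'k) = fscale ((- 1) ^ (p * (length w + p))) (fword (v @ a # w))"
      using cyc_pow_append[of v "a # w", where 'k = 'k]
      by (cases "even p"; cases "even (length w)") (simp_all add: vw(2) minus_one_power_if)
    ultimately show ?thesis
      by (cases "even p"; cases "even (length w)") (simp_all add: minus_one_power_if flip: v_def w_def)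
  qed
  then show "?F (fword u) = ?G (fword u)" using u by (simp add: ins_word_conv_sum)
qed (intro lin_intros lin_cyc_pow)+

text \<open>Every permutation of a word is a rotation of one that fixes the first letter, and the signs
  agree with those of the cyclic operator.\<close>

lemma alt_word_conv_nrm:
  fixes v :: "'a list"
  shows "(alt_word (a # v) :: 'a list \<Rightarrow>\<^sub>0 'k::field) = nrm (Suc (length v)) (antisym_word (a # v))"
proof (induction v arbitrary: a)
  case (Cons b v)
  let ?z = "alt_word (b # v) :: 'a list \<Rightarrow>\<^sub>0 'k"
  have "(cyc ^^ i) ?z = ?z" for i
    unfolding Cons by (rule cyc_pow_nrm) (use antisym_word_words[of "b # v"] in simp)
  then have "(\<Sum>p\<le>length (b # v). (cyc ^^ p) (cons a ((cyc ^^ (length (b # v) - p)) ?z)))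
      = nrm (Suc (length (b # v))) (cons a ?z)"
    by (simp only: nrm_def lessThan_Suc_atMost)
  then show ?case
    using ins_conv_cyc[where 'k = 'k, OF alt_word_words, of a "b # v"] by (simp only: antisym_word_Cons alt_word.simps)
qed (simp add: nrm_def)

text \<open>In characteristic zero a tensor with vanishing norm lies in the image of \<open>1 - t\<close>.\<close>

lemma antisym_nondistinct:
  fixes w :: "'a::ring list"
  assumes "\<not> distinct w"
  obtains y :: "'a list \<Rightarrow>\<^sub>0 'k::field_char_0" where "y \<in> words (length w)" "antisym_word w = y - cyc y"
proof -
  obtain a v where w: "w = a # v" using assms by (cases w) auto
  let ?x = "antisym_word w :: 'a list \<Rightarrow>\<^sub>0 'k"
  have "nrm (length w) ?x = 0"
    using alt_word_conv_nrm[of a v, where 'k = 'k] alt_word_nondistinct[OF assms, where 'k = 'k] by (simp add: w)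
  then obtain y where y: "y \<in> words (length w)" "fscale (of_nat (length w)) ?x = y - cyc y"
    using nrm_complement[OF antisym_word_words[of w]] by (metis diff_zero)
  let ?c = "inverse (of_nat (length w)) :: 'k"
  have "of_nat (length w) \<noteq> (0 :: 'k)" using w by (simp del: of_nat_Suc)
  then have "?x = fscale ?c (fscale (of_nat (length w)) ?x)" by simp
  also have "\<dots> = fscale ?c y - cyc (fscale ?c y)" unfolding y(2) by (simp add: fv.scale_right_diff_distrib)
  finally show ?thesis using that words_fscale[OF y(1)] by blast
qed

section \<open>Complexes in nonnegative degrees and their quotients\<close>

lemma zero_submodule: "kmod M \<Longrightarrow> submodule {\<zero>\<^bsub>M\<^esub>} scalar_ring M"
proof -
  assume M: "kmod M"
  interpret M: Module.module scalar_ring M by fact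
  show ?thesis by (rule kmod_submoduleI[OF M]) (use M.smult_r_null in auto)
qed

lemma nonneg_cx_nat:
  "chain (nonneg_cx M D) (int k) = M k" "bd (nonneg_cx M D) (int (Suc k)) = D k"
  "bd (nonneg_cx M D) 0 = (\<lambda>_. \<zero>\<^bsub>M 0\<^esub>)"
  by (simp_all add: nonneg_cx_def)

lemma nonneg_cx_negative:
  assumes "n < 0"
  shows "chain (nonneg_cx M D) n = (M 0)\<lparr>carrier := {\<zero>\<^bsub>M 0\<^esub>}\<rparr>" "bd (nonneg_cx M D) n = (\<lambda>_. \<zero>\<^bsub>M 0\<^esub>)"
  using assms by (simp_all add: nonneg_cx_def)

lemma int_degree_cases:
  fixes n :: int
  obtains (neg) "n < 0" | (zero) "n = 0" | (pos) k where "n = int (Suc k)"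
proof (cases "n \<le> 0")
  case False
  then have "n = int (Suc (nat (n - 1)))" by simp
  then show ?thesis using pos by blast
qed (use neg zero in force)

lemma int_Suc_minus: "int (Suc k) - 1 = int k"
  by simp

lemma zero_module:
  assumes "kmod M"
  shows zero_module_kmod: "kmod (M\<lparr>carrier := {\<zero>\<^bsub>M\<^esub>}\<rparr>)"
    and zero_module_add: "\<zero>\<^bsub>M\<^esub> \<oplus>\<^bsub>M\<^esub> \<zero>\<^bsub>M\<^esub> = \<zero>\<^bsub>M\<^esub>"
    and zero_module_smult: "c \<odot>\<^bsub>M\<^esub> \<zero>\<^bsub>M\<^esub> = \<zero>\<^bsub>M\<^esub>"
proof -
  interpret M: Module.module scalar_ring M by fact
  show "kmod (M\<lparr>carrier := {\<zero>\<^bsub>M\<^esub>}\<rparr>)" by (rule submodule_kmod[OF assms zero_submodule[OF assms]])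
  show "\<zero>\<^bsub>M\<^esub> \<oplus>\<^bsub>M\<^esub> \<zero>\<^bsub>M\<^esub> = \<zero>\<^bsub>M\<^esub>" by simp
  show "c \<odot>\<^bsub>M\<^esub> \<zero>\<^bsub>M\<^esub> = \<zero>\<^bsub>M\<^esub>" using M.smult_r_null[of c] by simp
qed

lemma is_complex_nonneg_cx:
  assumes M: "\<And>n. kmod (M n)" and D: "\<And>n. D n \<in> linear_maps (M (Suc n)) (M n)"
    and D_D: "\<And>n x. x \<in> carrier (M (Suc (Suc n))) \<Longrightarrow> D n (D (Suc n) x) = \<zero>\<^bsub>M n\<^esub>"
  shows "is_complex (nonneg_cx M D)"
  unfolding is_complex_def
proof (intro allI)
  let ?C = "nonneg_cx M D"
  fix n
  show "kmod (chain ?C n) \<and> bd ?C n \<in> linear_maps (chain ?C n) (chain ?C (n - 1))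
    \<and> (\<forall>x\<in>carrier (chain ?C n). bd ?C (n - 1) (bd ?C n x) = \<zero>\<^bsub>chain ?C (n - 1 - 1)\<^esub>)"
  proof (cases n rule: int_degree_cases)
    case neg
    then show ?thesis
      using linear_maps_const_zero[OF zero_module_kmod[OF M]] zero_module_kmod[OF M]
      by (simp add: nonneg_cx_negative)
  next
    case zero
    then show ?thesis
      using linear_maps_const_zero[OF zero_module_kmod[OF M]] M nonneg_cx_nat(1)[of M D 0]
      by (simp add: nonneg_cx_negative nonneg_cx_nat)
  next
    case (pos k)
    show ?thesis
    proof (cases k)
      case 0
      then show ?thesis
        using pos M[of 1] D[of 0] nonneg_cx_nat(1)[of M D 1] nonneg_cx_nat(1)[of M D 0] nonneg_cx_nat(2)[of M D 0]
        by (simp add: nonneg_cx_negative nonneg_cx_nat)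
    next
      case (Suc j)
      have deg: "n = int (Suc (Suc j))" "n - 1 = int (Suc j)" "n - 1 - 1 = int j" using pos Suc by auto
      show ?thesis
        unfolding deg(3) deg(2) unfolding deg(1) nonneg_cx_nat using M D D_D by (auto simp: nonneg_cx_nat(1))
    qed
  qed
qed

lemma is_chain_map_nonneg_cx:
  assumes M: "\<And>n. kmod (M n)" and M': "\<And>n. kmod (M' n)"
    and f: "\<And>k. f (int k) \<in> linear_maps (M k) (M' k)"
    and comm: "\<And>k x. x \<in> carrier (M (Suc k)) \<Longrightarrow> D' k (f (int (Suc k)) x) = f (int k) (D k x)"
    and neg: "\<And>n. n < 0 \<Longrightarrow> f n \<zero>\<^bsub>M 0\<^esub> = \<zero>\<^bsub>M' 0\<^esub>"
  shows "is_chain_map (nonneg_cx M D) (nonneg_cx M' D') f"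
  unfolding is_chain_map_def
proof (intro allI)
  let ?C = "nonneg_cx M D" and ?C' = "nonneg_cx M' D'"
  fix n
  show "f n \<in> linear_maps (chain ?C n) (chain ?C' n)
    \<and> (\<forall>x\<in>carrier (chain ?C n). bd ?C' n (f n x) = f (n - 1) (bd ?C n x))"
  proof (cases n rule: int_degree_cases)
    case neg
    then show ?thesis
      using assms(5)[of n] assms(5)[of "n - 1"]
      by (auto intro!: linear_mapsI simp: nonneg_cx_negative zero_module_add[OF M] zero_module_add[OF M']
          zero_module_smult[OF M] zero_module_smult[OF M'])
  next
    case zero
    then show ?thesis
      using f[of 0] neg[of "- 1"] nonneg_cx_nat(1)[of M D 0] nonneg_cx_nat(1)[of M' D' 0] by (simp add: nonneg_cx_nat)
  next
    case (pos k)
    show ?thesis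
      unfolding pos int_Suc_minus nonneg_cx_nat using f[of "Suc k"] comm by blast
  qed
qed

text \<open>Both short exact sequences of the theorem have this form: a complex in nonnegative degrees
  maps onto its quotient by a subcomplex.\<close>

locale subcomplex =
  fixes M :: "nat \<Rightarrow> ('k::field, 'm) module" and D :: "nat \<Rightarrow> 'm \<Rightarrow> 'm" and N :: "nat \<Rightarrow> 'm set"
  assumes M: "kmod (M n)" and D: "D n \<in> linear_maps (M (Suc n)) (M n)"
    and D_D: "x \<in> carrier (M (Suc (Suc n))) \<Longrightarrow> D n (D (Suc n) x) = \<zero>\<^bsub>M n\<^esub>"
    and N: "submodule (N n) scalar_ring (M n)" and D_N: "D n ` N (Suc n) \<subseteq> N n"
begin

abbreviation "Q n \<equiv> quot_module (M n) (N n)"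
abbreviation "DQ n \<equiv> induced (M n) (N n) (D n)"
abbreviation "C \<equiv> nonneg_cx M D"
abbreviation "CQ \<equiv> nonneg_cx Q DQ"
abbreviation "p \<equiv> \<lambda>n x. N (nat n) +>\<^bsub>M (nat n)\<^esub> x"

lemma Q: "kmod (Q n)"
  by (rule quot_kmod[OF M N])

lemma DQ_coset: "x \<in> carrier (M (Suc n)) \<Longrightarrow> DQ n (N (Suc n) +>\<^bsub>M (Suc n)\<^esub> x) = N n +>\<^bsub>M n\<^esub> D n x"
  by (rule induced_coset[OF M N M N D D_N])

lemma DQ: "DQ n \<in> linear_maps (Q (Suc n)) (Q n)"
  by (rule induced_linear[OF M N M N D D_N])

lemma coset_zero_eq: "N n +>\<^bsub>M n\<^esub> \<zero>\<^bsub>M n\<^esub> = N n"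
  by (rule coset_zero[OF M N])

lemma short_exact: "short_exact C CQ p"
proof
  show "is_complex C" by (rule is_complex_nonneg_cx) (fact M D D_D)+
  show "is_complex CQ"
  proof (rule is_complex_nonneg_cx)
    show "kmod (Q n)" "DQ n \<in> linear_maps (Q (Suc n)) (Q n)" for n by (rule Q DQ)+
    fix n z assume "z \<in> carrier (Q (Suc (Suc n)))"
    then obtain x where x: "x \<in> carrier (M (Suc (Suc n)))" "z = N (Suc (Suc n)) +>\<^bsub>M (Suc (Suc n))\<^esub> x"
      by (auto simp: a_rcosets_iff)
    then show "DQ n (DQ (Suc n) z) = \<zero>\<^bsub>Q n\<^esub>"
      using linear_maps_closed[OF D x(1)] by (simp add: DQ_coset D_D coset_zero_eq)
  qed
  show "is_chain_map C CQ p"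
  proof (rule is_chain_map_nonneg_cx[OF M Q])
    show "p (int k) \<in> linear_maps (M k) (Q k)" for k
      using coset_linear[OF M N, of k] by simp
    show "DQ k (p (int (Suc k)) x) = p (int k) (D k x)" if "x \<in> carrier (M (Suc k))" for k x
      using DQ_coset[OF that] unfolding nat_int .
  qed (simp add: coset_zero_eq)
  show "p n ` carrier (chain C n) = carrier (chain CQ n)" for n
  proof (cases "n < 0")
    case True
    then show ?thesis by (simp add: nonneg_cx_negative coset_zero_eq)
  next
    case False
    then obtain k where n: "n = int k" using zero_le_imp_eq_int[of n] by auto
    have "carrier (chain CQ n) = a_rcosets\<^bsub>M k\<^esub> N k" unfolding n nonneg_cx_nat by simp
    then show ?thesis unfolding n nonneg_cx_nat nat_int A_RCOSETS_def' by blast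
  qed
qed

end

text \<open>The maps that a homomorphism of algebras induces on the two short exact sequences have this
  form.\<close>

locale subcomplex_map = S: subcomplex M D N + S': subcomplex M' D' N'
  for M :: "nat \<Rightarrow> ('k::field, 'm) module" and D N and M' :: "nat \<Rightarrow> ('k, 'n) module" and D' N' +
  fixes h :: "nat \<Rightarrow> 'm \<Rightarrow> 'n"
  assumes h: "h n \<in> linear_maps (M n) (M' n)" and h_D: "x \<in> carrier (M (Suc n)) \<Longrightarrow> D' n (h (Suc n) x) = h n (D n x)"
    and h_N: "h n ` N n \<subseteq> N' n"
begin

abbreviation "hQ \<equiv> \<lambda>n. induced (M' n) (N' n) (h n)"

lemma hQ_coset: "x \<in> carrier (M n) \<Longrightarrow> hQ n (N n +>\<^bsub>M n\<^esub> x) = N' n +>\<^bsub>M' n\<^esub> h n x"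
  by (rule induced_coset[OF S.M S.N S'.M S'.N h h_N])

lemma hQ: "hQ n \<in> linear_maps (S.Q n) (S'.Q n)"
  by (rule induced_linear[OF S.M S.N S'.M S'.N h h_N])

lemma h_zero: "h n \<zero>\<^bsub>M n\<^esub> = \<zero>\<^bsub>M' n\<^esub>"
  by (rule linear_maps_zero[OF S.M S'.M h])

lemma short_exact_map: "short_exact_map S.C S.CQ S.p S'.C S'.CQ S'.p (\<lambda>n. h (nat n)) (\<lambda>n. hQ (nat n))"
proof (intro short_exact_map.intro short_exact_map_axioms.intro S.short_exact S'.short_exact)
  show "is_chain_map S.C S'.C (\<lambda>n. h (nat n))"
  proof (rule is_chain_map_nonneg_cx[OF S.M S'.M])
    show "D' k (h (nat (int (Suc k))) x) = h (nat (int k)) (D k x)" if "x \<in> carrier (M (Suc k))" for k x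
      unfolding nat_int by (rule h_D[OF that])
  qed (simp_all add: h h_zero)
  show "is_chain_map S.CQ S'.CQ (\<lambda>n. hQ (nat n))"
  proof (rule is_chain_map_nonneg_cx[OF S.Q S'.Q])
    show "S'.DQ k (hQ (nat (int (Suc k))) z) = hQ (nat (int k)) (S.DQ k z)" if "z \<in> carrier (S.Q (Suc k))" for k z
    proof -
      obtain x where "x \<in> carrier (M (Suc k))" "z = N (Suc k) +>\<^bsub>M (Suc k)\<^esub> x"
        using \<open>z \<in> carrier (S.Q (Suc k))\<close> by (auto simp: a_rcosets_iff)
      then show ?thesis
        unfolding nat_int using linear_maps_closed[OF h] linear_maps_closed[OF S.D]
        by (simp add: hQ_coset S.DQ_coset S'.DQ_coset h_D)
    qed
    show "hQ (nat n) \<zero>\<^bsub>S.Q 0\<^esub> = \<zero>\<^bsub>S'.Q 0\<^esub>" if "n < 0" for n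
      using hQ_coset[of "\<zero>\<^bsub>M 0\<^esub>" 0] that S.coset_zero_eq[of 0] S'.coset_zero_eq[of 0] h_zero[of 0]
        abelian_group.axioms(1)[OF kmod_abelian_group[OF S.M], THEN abelian_monoid.zero_closed] by simp
  qed (simp add: hQ)
  show "hQ (nat n) (S.p n x) = S'.p n (h (nat n) x)" if "x \<in> carrier (chain S.C n)" for n x
  proof (rule hQ_coset)
    show "x \<in> carrier (M (nat n))"
    proof (cases "n < 0")
      case True
      then show ?thesis
        using that abelian_group.axioms(1)[OF kmod_abelian_group[OF S.M], THEN abelian_monoid.zero_closed, of 0]
        by (simp add: nonneg_cx_negative)
    next
      case False
      then obtain k where "n = int k" using zero_le_imp_eq_int[of n] by auto
      then show ?thesis using that by (simp add: nonneg_cx_nat)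
    qed
  qed
qed

end

section \<open>Shifts\<close>

lemma shift_cx_simps [simp]: "chain (shift_cx r C) n = chain C (n + r)" "bd (shift_cx r C) n = bd C (n + r)"
  by (simp_all add: shift_cx_def)

lemma int_shift: "(n :: int) - 1 + r = n + r - 1" "(n :: int) + 1 + r = n + r + 1"
  by simp_all

lemma homology_shift_cx: "homology (shift_cx r C) n = homology C (n + r)"
  unfolding homology_def cycles_def boundaries_def shift_cx_simps int_shift ..

lemma hom_class_shift_cx: "hom_class (shift_cx r C) n = hom_class C (n + r)"
  unfolding hom_class_def boundaries_def shift_cx_simps int_shift ..

lemma hom_map_shift_cx: "hom_map (shift_cx r C) n f = hom_map C (n + r) f"
  unfolding hom_map_def hom_class_shift_cx ..

lemma ker_cx_shift_cx: "ker_cx (shift_cx r C) (shift_cx r D) (\<lambda>n. p (n + r)) = shift_cx r (ker_cx C D p)"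
  by (simp add: ker_cx_def shift_cx_def)

lemma connecting_shift_cx:
  "connecting (shift_cx r C) (shift_cx r D) (\<lambda>n. p (n + r)) n = connecting C D p (n + r)"
  unfolding connecting_def ker_cx_shift_cx hom_class_shift_cx shift_cx_simps int_shift ..

lemma is_chain_map_shift_cx:
  assumes "is_chain_map C D f"
  shows "is_chain_map (shift_cx r C) (shift_cx r D) (\<lambda>n. f (n + r))"
  using is_chain_mapD[OF assms] by (auto simp: is_chain_map_def int_shift)

lemma is_complex_shift_cx:
  assumes "is_complex C"
  shows "is_complex (shift_cx r C)"
  unfolding is_complex_def shift_cx_simps int_shift using is_complexD[OF assms] by blast

lemma short_exact_shift_cx:
  assumes "short_exact C D p"
  shows "short_exact (shift_cx r C) (shift_cx r D) (\<lambda>n. p (n + r))"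
proof -
  interpret short_exact C D p by fact
  show ?thesis
    by unfold_locales (auto intro: is_complex_shift_cx is_chain_map_shift_cx C D p simp: surj)
qed

lemma short_exact_map_shift_cx:
  assumes "short_exact_map C D p C' D' p' f g"
  shows "short_exact_map (shift_cx r C) (shift_cx r D) (\<lambda>n. p (n + r)) (shift_cx r C') (shift_cx r D') (\<lambda>n. p' (n + r))
    (\<lambda>n. f (n + r)) (\<lambda>n. g (n + r))"
proof -
  interpret short_exact_map C D p C' D' p' f g by fact
  show ?thesis
    by (intro short_exact_map.intro short_exact_map_axioms.intro short_exact_shift_cx is_chain_map_shift_cx
        S.short_exact_axioms S'.short_exact_axioms f g) (simp add: square)
qed

text \<open>Since the projection is surjective, the map of the quotients inherits from \<open>f\<close> that it
  commutes with the boundaries.\<close>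

lemma short_exact_mapI:
  assumes S: "short_exact C D p" and S': "short_exact C' D' p'" and f: "is_chain_map C C' f"
    and g: "\<And>n. g n \<in> linear_maps (chain D n) (chain D' n)"
    and square: "\<And>n x. x \<in> carrier (chain C n) \<Longrightarrow> g n (p n x) = p' n (f n x)"
  shows "short_exact_map C D p C' D' p' f g"
proof (intro short_exact_map.intro short_exact_map_axioms.intro S S' f square)
  interpret S: short_exact C D p by fact
  interpret S': short_exact C' D' p' by fact
  show "is_chain_map D D' g"
    unfolding is_chain_map_def
  proof (intro allI conjI ballI g)
    fix n z assume "z \<in> carrier (chain D n)"
    then obtain x where x: "x \<in> carrier (chain C n)" "z = p n x" using S.surj[of n] by auto
    have fx: "f n x \<in> carrier (chain C' n)" using linear_maps_closed[OF chain_map_linear[OF f] x(1)] .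
    have bx: "bd C n x \<in> carrier (chain C (n - 1))" using linear_maps_closed[OF complex_bd[OF S.C] x(1)] .
    have "bd D' n (g n z) = p' (n - 1) (f (n - 1) (bd C n x))"
      using x by (simp add: square chain_map_bd[OF S'.p fx] chain_map_bd[OF f])
    also have "\<dots> = g (n - 1) (bd D n z)"
      using x square[OF bx] by (simp add: chain_map_bd[OF S.p])
    finally show "bd D' n (g n z) = g (n - 1) (bd D n z)" .
  qed
qed

section \<open>The Leibniz and the Hochschild short exact sequences\<close>

context unital_algebra
begin

lemma tensors: "tensors scale"
  by unfold_locales

abbreviation "T \<equiv> tensor_power scale"
abbreviation "cls \<equiv> tensor_class scale"

lemma tensor_class_equiv: "x \<in> words n \<Longrightarrow> y \<in> words n \<Longrightarrow> x \<approx> y \<Longrightarrow> cls n x = cls n y"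
  by (simp add: tensor_class_eq_iff)

lemma linear_via_class:
  assumes "lin G" "\<And>x. x \<in> words m \<Longrightarrow> G x \<in> words n" "\<And>x. x \<in> words m \<Longrightarrow> F (cls m x) = cls n (G x)"
  shows "F \<in> linear_maps (T m) (T n)"
proof (rule linear_mapsI)
  fix z assume "z \<in> carrier (T m)"
  then obtain x where x: "x \<in> words m" "z = cls m x" by (rule tensor_cases)
  show "F z \<in> carrier (T n)" using x assms by (simp add: tensor_class_closed)
  show "F (c \<odot>\<^bsub>T m\<^esub> z) = c \<odot>\<^bsub>T n\<^esub> F z" for c
    using x assms by (simp add: tensor_class_smult words_fscale lin_iff)
  fix z' assume "z' \<in> carrier (T m)"
  then obtain x' where "x' \<in> words m" "z' = cls m x'" by (rule tensor_cases)
  then show "F (z \<oplus>\<^bsub>T m\<^esub> z') = F z \<oplus>\<^bsub>T n\<^esub> F z'"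
    using x assms by (simp add: tensor_class_add words_add lin_iff)
qed

lemma
  shows leibniz_bd_class: "x \<in> words (Suc n) \<Longrightarrow> leibniz_bd scale n (cls (Suc n) x) = cls n (leib x)"
    and leibniz_bd_linear: "leibniz_bd scale n \<in> linear_maps (T (Suc n)) (T n)"
proof -
  have w: "leibniz_word w \<in> words n" if "length w = Suc n" for w :: "'a list"
    using leibniz_word_words[of w] that by simp
  show "x \<in> words (Suc n) \<Longrightarrow> leibniz_bd scale n (cls (Suc n) x) = cls n (leib x)"
    unfolding leibniz_bd_def by (rule tensor_map_class[OF tensors tensors respectful_leibniz refl w])
  show "leibniz_bd scale n \<in> linear_maps (T (Suc n)) (T n)"
    unfolding leibniz_bd_def by (rule tensor_map_linear[OF tensors tensors respectful_leibniz refl w])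
qed

lemma alt_rel_submodule: "submodule (alt_rel scale n) scalar_ring (T n)"
proof -
  have "fv.span {fword w | w. length w = n \<and> \<not> distinct w} \<subseteq> (words n :: ('a list \<Rightarrow>\<^sub>0 'k) set)"
    by (rule fv.span_minimal[OF _ words_subspace]) auto
  then have "submodule (fv.span {fword w | w. length w = n \<and> \<not> distinct w}) scalar_ring
      (word_module n :: ('k, 'a list \<Rightarrow>\<^sub>0 'k) module)"
    by (intro subspace_submodule_words fv.subspace_span)
  from submodule_image[OF word_module_kmod tensor_power_kmod tensor_class_linear this]
  show ?thesis by (simp add: alt_rel_def tensor_class_def[abs_def])
qed

lemma alt_rel_iff:
  assumes x: "x \<in> words n"
  shows "cls n x \<in> alt_rel scale n \<longleftrightarrow> x \<in> alts"
proof
  let ?S = "fv.span {fword w | w. length w = n \<and> \<not> distinct w} :: ('a list \<Rightarrow>\<^sub>0 'k) set"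
  have S: "?S \<subseteq> words n" by (rule fv.span_minimal[OF _ words_subspace]) auto
  have rel: "alt_rel scale n = cls n ` ?S" by (simp add: alt_rel_def tensor_class_def[abs_def])
  have S_alts: "?S \<subseteq> alts"
    by (rule fv.span_minimal[OF _ alt_rels_subspace]) (auto intro: nondistinct_alt_rels)
  show "x \<in> alts" if cls: "cls n x \<in> alt_rel scale n"
  proof -
    obtain y where y: "y \<in> ?S" "cls n x = cls n y" using cls rel by auto
    then have "x \<approx> y" using S x tensor_class_eq_iff by blast
    then show ?thesis using alts_eqv y(1) S_alts by blast
  qed
  show "cls n x \<in> alt_rel scale n" if alts: "x \<in> alts"
  proof -
    obtain r y where xy: "x = r + y" and r: "r \<in> rels" and y: "y \<in> fv.span {fword w | w. \<not> distinct w}"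
      using alts by (auto simp: alt_rels_def)
    have "word_part n y \<in> ?S"
    proof (rule lin_span_into_subspace[OF lin_lin_ext fv.subspace_span y])
      show "word_part n b \<in> ?S" if b: "b \<in> {fword w | w. \<not> distinct w}" for b :: "'a list \<Rightarrow>\<^sub>0 'k"
      proof -
        obtain w where w: "b = fword w" "\<not> distinct w" using b by blast
        show ?thesis
        proof (cases "length w = n")
          case True
          then have "fword w \<in> ?S" using w(2) by (intro fv.span_base) blast
          then show ?thesis using True w by simp
        next
          case False
          have "0 \<in> ?S" by (rule fv.span_zero)
          then show ?thesis using False w by simp
        qed
      qed
    qed
    moreover have "x \<approx> word_part n y"
    proof -
      have "x = word_part n r + word_part n y" using word_part_words[OF x] xy by simp
      then have "x - word_part n y = word_part n r" by (rule iffD2[OF diff_eq_eq])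
      then show ?thesis using word_part_tensor_rels[OF r, of n] by (simp add: tensor_eq_def)
    qed
    ultimately show ?thesis
      unfolding rel using x S tensor_class_equiv by (metis (no_types, lifting) image_eqI subsetD)
  qed
qed

lemma leibniz_subcomplex: "subcomplex T (leibniz_bd scale) (alt_rel scale)"
proof (rule subcomplex.intro)
  show "kmod (T n)" for n by (rule tensor_power_kmod)
  show "leibniz_bd scale n \<in> linear_maps (T (Suc n)) (T n)" for n by (rule leibniz_bd_linear)
  show "submodule (alt_rel scale n) scalar_ring (T n)" for n by (rule alt_rel_submodule)
  show "leibniz_bd scale n (leibniz_bd scale (Suc n) z) = \<zero>\<^bsub>T n\<^esub>" if z: "z \<in> carrier (T (Suc (Suc n)))" for n z
  proof -
    obtain x where x: "x \<in> words (Suc (Suc n))" "z = cls (Suc (Suc n)) x" using tensor_cases[OF z] .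
    then have "leibniz_bd scale n (leibniz_bd scale (Suc n) z) = cls n (leib (leib x))"
      by (simp add: leibniz_bd_class leib_words)
    also have "\<dots> = cls n 0"
      by (intro tensor_class_equiv leib_leib leib_words words_zero x)
    finally show ?thesis by (simp add: tensor_class_zero)
  qed
  show "leibniz_bd scale n ` alt_rel scale (Suc n) \<subseteq> alt_rel scale n" for n
  proof (intro subsetI, elim imageE)
    fix y z assume y: "y = leibniz_bd scale n z" and z: "z \<in> alt_rel scale (Suc n)"
    then have "z \<in> carrier (T (Suc n))" using submodule_subset[OF tensor_power_kmod alt_rel_submodule] by blast
    then obtain x where x: "x \<in> words (Suc n)" "z = cls (Suc n) x" by (rule tensor_cases)
    then show "y \<in> alt_rel scale n"
      using y z by (simp add: leibniz_bd_class alt_rel_iff alts_leib leib_words)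
  qed
qed

lemma leibniz_short_exact: "short_exact (CL_cx scale) (Lie_cx scale) (pi1 scale)"
  using subcomplex.short_exact[OF leibniz_subcomplex]
  by (simp add: CL_cx_def Lie_cx_def pi1_def[abs_def] ext_power_def[abs_def])

lemma
  assumes "n > 0"
  shows hochschild_bd_class: "x \<in> words (Suc n) \<Longrightarrow> hochschild_bd scale n (cls (Suc n) x) = cls n (hoch x)"
    and hochschild_bd_linear: "hochschild_bd scale n \<in> linear_maps (T (Suc n)) (T n)"
proof -
  have w: "hoch_word w \<in> words n" if "length w = Suc n" for w :: "'a list"
    using hoch_word_words[of w] that by simp
  have eq: "hochschild_word w = hoch_word w" if "length w = Suc n" for w :: "'a list"
    using that assms by (intro hochschild_word_eq) auto
  show "x \<in> words (Suc n) \<Longrightarrow> hochschild_bd scale n (cls (Suc n) x) = cls n (hoch x)"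
    unfolding hochschild_bd_def by (rule tensor_map_class[OF tensors tensors respectful_hoch eq w])
  show "hochschild_bd scale n \<in> linear_maps (T (Suc n)) (T n)"
    unfolding hochschild_bd_def by (rule tensor_map_linear[OF tensors tensors respectful_hoch eq w])
qed

lemma cyc_op_class:
  assumes "n > 0" "x \<in> words n"
  shows "cyc_op scale n (cls n x) = cls n (cyc x)"
  unfolding cyc_op_def
proof (rule tensor_map_class[OF tensors tensors respectful_cyc _ _ assms(2)])
  show "fscale ((- 1) ^ (length w - 1)) (fword (last w # butlast w)) = cyc_word w" if "length w = n" for w :: "'a list"
    using that assms(1) by (auto simp: cyc_word_def)
  show "cyc_word w \<in> words n" if "length w = n" for w :: "'a list" using cyc_word_words[of w] that by simp
qed

lemma one_minus_cyc_class:
  assumes "n > 0" "x \<in> words n"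
  shows "one_minus_cyc scale n (cls n x) = cls n (x - cyc x)"
  using assms by (simp add: one_minus_cyc_def cyc_op_class tensor_class_minus cyc_words)

lemma one_minus_cyc_linear: "n > 0 \<Longrightarrow> one_minus_cyc scale n \<in> linear_maps (T n) (T n)"
  by (rule linear_via_class[where G = "\<lambda>x. x - cyc x"])
    (auto intro!: lin_intros words_diff cyc_words simp: one_minus_cyc_class)

lemma cyc_rel_submodule: "n > 0 \<Longrightarrow> submodule (cyc_rel scale n) scalar_ring (T n)"
  unfolding cyc_rel_def
  by (rule submodule_image[OF tensor_power_kmod tensor_power_kmod one_minus_cyc_linear
      Module.module.carrier_is_submodule[OF tensor_power_kmod]])

lemma cyc_rel_cases:
  assumes "z \<in> cyc_rel scale n" "n > 0"
  obtains y where "y \<in> words n" "z = cls n (y - cyc y)"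
proof -
  obtain u where "u \<in> carrier (T n)" "z = one_minus_cyc scale n u" using assms(1) by (auto simp: cyc_rel_def)
  then show ?thesis using that assms(2) by (elim tensor_cases) (auto simp: one_minus_cyc_class)
qed

lemma cyc_relI: "n > 0 \<Longrightarrow> y \<in> words n \<Longrightarrow> cls n (y - cyc y) \<in> cyc_rel scale n"
  unfolding cyc_rel_def by (rule image_eqI[of _ _ "cls n y"]) (auto simp: one_minus_cyc_class tensor_class_closed)

lemma cyc_rel_iff:
  assumes "n > 0" "x \<in> words n"
  shows "cls n x \<in> cyc_rel scale n \<longleftrightarrow> (\<exists>y\<in>words n. x \<approx> y - cyc y)"
proof
  assume "cls n x \<in> cyc_rel scale n"
  then obtain y where "y \<in> words n" "cls n x = cls n (y - cyc y)" using cyc_rel_cases assms(1) by blast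
  then show "\<exists>y\<in>words n. x \<approx> y - cyc y" using assms by (auto simp: tensor_class_eq_iff words_diff cyc_words)
next
  assume "\<exists>y\<in>words n. x \<approx> y - cyc y"
  then obtain y where "y \<in> words n" "x \<approx> y - cyc y" by blast
  then show "cls n x \<in> cyc_rel scale n"
    using assms cyc_relI[of n y] tensor_class_equiv[of x n "y - cyc y"] by (simp add: words_diff cyc_words)
qed

lemma hochschild_subcomplex:
  "subcomplex (\<lambda>n. T (n + 1)) (\<lambda>n. hochschild_bd scale (n + 1)) (\<lambda>n. cyc_rel scale (n + 1))"
proof (rule subcomplex.intro)
  show "kmod (T (n + 1))" for n by (rule tensor_power_kmod)
  show "hochschild_bd scale (n + 1) \<in> linear_maps (T (Suc n + 1)) (T (n + 1))" for n
    using hochschild_bd_linear[of "n + 1"] by simp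
  show "submodule (cyc_rel scale (n + 1)) scalar_ring (T (n + 1))" for n
    by (rule cyc_rel_submodule) simp
  show "hochschild_bd scale (n + 1) (hochschild_bd scale (Suc n + 1) z) = \<zero>\<^bsub>T (n + 1)\<^esub>"
    if z: "z \<in> carrier (T (Suc (Suc n) + 1))" for n z
  proof -
    obtain x where x: "x \<in> words (Suc (Suc (Suc n)))" "z = cls (Suc (Suc (Suc n))) x"
      using tensor_cases[OF z] by auto
    then show ?thesis
      by (simp add: hochschild_bd_class hoch_words hoch_hoch tensor_class_zero)
  qed
  show "(\<lambda>x. hochschild_bd scale (n + 1) x) ` cyc_rel scale (Suc n + 1) \<subseteq> cyc_rel scale (n + 1)" for n
  proof (intro subsetI, elim imageE)
    fix y z assume y: "y = hochschild_bd scale (n + 1) z" and "z \<in> cyc_rel scale (Suc n + 1)"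
    then obtain x where x: "x \<in> words (Suc (Suc n))" "z = cls (Suc (Suc n)) (x - cyc x)"
      using cyc_rel_cases[of z "Suc n + 1"] by auto
    then have "y = cls (Suc n) (bar x - cyc (bar x))"
      using y by (simp add: hochschild_bd_class words_diff cyc_words hoch_cyc)
    then show "y \<in> cyc_rel scale (n + 1)"
      using cyc_relI[of "Suc n" "bar x"] bar_words[OF x(1)] by simp
  qed
qed

lemma hochschild_short_exact: "short_exact (CHH_cx scale) (cyclic_cx scale) (pi2 scale)"
  using subcomplex.short_exact[OF hochschild_subcomplex]
  by (simp add: CHH_cx_def cyclic_cx_def pi2_def[abs_def])

lemma tensor_map_antisym:
  shows tensor_map_antisym_class: "x \<in> words n \<Longrightarrow> tensor_map scale n antisym_word (cls n x) = cls n (antisymmetrize x)"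
    and tensor_map_antisym_linear: "tensor_map scale n antisym_word \<in> linear_maps (T n) (T n)"
proof -
  have w: "antisym_word w \<in> words n" if "length w = n" for w :: "'a list"
    using antisym_word_words[of w] that by simp
  show "x \<in> words n \<Longrightarrow> tensor_map scale n antisym_word (cls n x) = cls n (antisymmetrize x)"
    by (rule tensor_map_class[OF tensors tensors respectful_antisym refl w])
  show "tensor_map scale n antisym_word \<in> linear_maps (T n) (T n)"
    by (rule tensor_map_linear[OF tensors tensors respectful_antisym refl w])
qed

lemma CHH_cx_nat:
  "chain (CHH_cx scale) (int k) = T (Suc k)" "bd (CHH_cx scale) (int (Suc k)) = hochschild_bd scale (Suc k)"
  "bd (CHH_cx scale) 0 = (\<lambda>_. \<zero>\<^bsub>T 1\<^esub>)"
  unfolding CHH_cx_def nonneg_cx_nat by simp_all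

lemma CL_cx_nat:
  "chain (CL_cx scale) (int k) = T k" "bd (CL_cx scale) (int (Suc k)) = leibniz_bd scale k"
  unfolding CL_cx_def nonneg_cx_nat by simp_all

lemma CHH_cx_negative:
  assumes "n < 0"
  shows "chain (CHH_cx scale) n = (T 1)\<lparr>carrier := {\<zero>\<^bsub>T 1\<^esub>}\<rparr>" "bd (CHH_cx scale) n = (\<lambda>_. \<zero>\<^bsub>T 1\<^esub>)"
  unfolding CHH_cx_def nonneg_cx_negative[OF assms] by simp_all

lemma cyclic_cx_nat:
  "chain (cyclic_cx scale) (int k) = quot_module (T (Suc k)) (cyc_rel scale (Suc k))"
  "bd (cyclic_cx scale) (int (Suc k)) = induced (T (Suc k)) (cyc_rel scale (Suc k)) (hochschild_bd scale (Suc k))"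
  "bd (cyclic_cx scale) 0 = (\<lambda>_. cyc_rel scale 1)"
  unfolding cyclic_cx_def nonneg_cx_nat by simp_all

lemma cyclic_cx_negative:
  assumes "n < 0"
  shows "chain (cyclic_cx scale) n = (quot_module (T 1) (cyc_rel scale 1))\<lparr>carrier := {cyc_rel scale 1}\<rparr>"
    "bd (cyclic_cx scale) n = (\<lambda>_. cyc_rel scale 1)"
  unfolding cyclic_cx_def nonneg_cx_negative[OF assms] by simp_all

lemma phi_chain_map: "is_chain_map (shift_cx 1 (CL_cx scale)) (CHH_cx scale) (phi scale)"
  unfolding is_chain_map_def shift_cx_simps
proof (intro allI)
  interpret H: short_exact "CHH_cx scale" "cyclic_cx scale" "pi2 scale" by (rule hochschild_short_exact)
  fix n
  show "phi scale n \<in> linear_maps (chain (CL_cx scale) (n + 1)) (chain (CHH_cx scale) n)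
    \<and> (\<forall>x\<in>carrier (chain (CL_cx scale) (n + 1)). bd (CHH_cx scale) n (phi scale n x) = phi scale (n - 1) (bd (CL_cx scale) (n + 1) x))"
  proof (cases n rule: int_degree_cases)
    case neg
    then show ?thesis
      using linear_maps_const_zero[OF complex_kmod[OF H.C, of n]] by (simp add: phi_def CHH_cx_negative)
  next
    case zero
    then show ?thesis
      using tensor_map_antisym_linear[of 1] CHH_cx_nat(1)[of 0] CL_cx_nat(1)[of 1]
      by (simp add: phi_def CHH_cx_nat(3) CHH_cx_negative)
  next
    case (pos k)
    have deg: "n + 1 = int (Suc (Suc k))" "n - 1 = int k" "phi scale n = tensor_map scale (Suc (Suc k)) antisym_word"
      "phi scale (int k) = tensor_map scale (Suc k) antisym_word"
      using pos by (simp_all add: phi_def nat_add_distrib)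
    have "hochschild_bd scale (Suc k) (tensor_map scale (Suc (Suc k)) antisym_word z)
        = tensor_map scale (Suc k) antisym_word (leibniz_bd scale (Suc k) z)" if z: "z \<in> carrier (T (Suc (Suc k)))" for z
    proof -
      obtain x where x: "x \<in> words (Suc (Suc k))" "z = cls (Suc (Suc k)) x" using tensor_cases[OF z] .
      then show ?thesis
        using tensor_class_equiv[OF _ _ hoch_antisymmetrize, of x "Suc k"]
        by (simp add: tensor_map_antisym_class hochschild_bd_class leibniz_bd_class antisym_words hoch_words leib_words)
    qed
    then show ?thesis
      unfolding deg unfolding pos CL_cx_nat CHH_cx_nat using tensor_map_antisym_linear by blast
  qed
qed

end

locale unital_algebra_char_0 = unital_algebra scale
  for scale :: "'k::field_char_0 \<Rightarrow> 'a::{ring,monoid_mult} \<Rightarrow> 'a"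
begin

lemma antisymmetrize_alts:
  assumes "x \<in> words n" "x \<in> alts"
  shows "\<exists>y\<in>words n. antisymmetrize x \<approx> y - cyc y"
proof -
  have "fv.subspace {x. \<exists>y\<in>words n. antisymmetrize (word_part n x) \<approx> y - cyc y}" (is "fv.subspace ?S")
    unfolding fv.subspace_def
  proof (intro conjI ballI allI)
    show "0 \<in> ?S" by (auto intro: bexI[of _ 0] simp: words_zero)
    fix x x' c assume "x \<in> ?S" "x' \<in> ?S"
    then obtain y y' where y: "y \<in> words n" "antisymmetrize (word_part n x) \<approx> y - cyc y"
      "y' \<in> words n" "antisymmetrize (word_part n x') \<approx> y' - cyc y'" by auto
    have "antisymmetrize (word_part n x) + antisymmetrize (word_part n x') \<approx> (y - cyc y) + (y' - cyc y')"
      by (intro tensor_eq_add y)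
    then show "x + x' \<in> ?S" using y by (auto intro!: bexI[of _ "y + y'"] words_add simp: algebra_simps)
    have "fscale c (antisymmetrize (word_part n x)) \<approx> fscale c (y - cyc y)" by (intro tensor_eq_fscale y)
    then show "fscale c x \<in> ?S"
      using y by (auto intro!: bexI[of _ "fscale c y"] words_fscale simp: fv.scale_right_diff_distrib)
  qed
  then have "x \<in> ?S"
  proof (rule lin_alt_rels_into_subspace[OF lin_ident _ assms(2)])
    show "r \<in> ?S" if "r \<in> rels" for r
    proof -
      have "antisymmetrize (word_part n r) \<in> rels"
        using respectful_antisym word_part_tensor_rels[OF that] by (simp add: descends_def)
      then show ?thesis by (auto intro!: bexI[of _ 0] words_zero simp: tensor_eq_def)
    qed
    show "fword w \<in> ?S" if nd: "\<not> distinct w" for w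
    proof (cases "length w = n")
      case True
      obtain y :: "'a list \<Rightarrow>\<^sub>0 'k" where "y \<in> words (length w)" "antisym_word w = y - cyc y"
        using antisym_nondistinct[OF nd] .
      then show ?thesis using True by (auto intro!: bexI[of _ y])
    qed (auto intro!: bexI[of _ 0] words_zero)
  qed
  then show ?thesis using word_part_words[OF assms(1)] by simp
qed

lemma tensor_map_antisym_alt_rel:
  assumes "n > 0"
  shows "tensor_map scale n antisym_word ` alt_rel scale n \<subseteq> cyc_rel scale n"
proof (intro subsetI, elim imageE)
  fix y z assume y: "y = tensor_map scale n antisym_word z" and z: "z \<in> alt_rel scale n"
  then have "z \<in> carrier (T n)" using submodule_subset[OF tensor_power_kmod alt_rel_submodule] by blast
  then obtain x where x: "x \<in> words n" "z = cls n x" by (rule tensor_cases)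
  then show "y \<in> cyc_rel scale n"
    using y z antisymmetrize_alts[of x n] assms
    by (simp add: tensor_map_antisym_class alt_rel_iff cyc_rel_iff antisym_words)
qed

lemma theta_square:
  "short_exact_map (shift_cx 1 (CL_cx scale)) (shift_cx 1 (Lie_cx scale)) (\<lambda>n. pi1 scale (n + 1))
    (CHH_cx scale) (cyclic_cx scale) (pi2 scale) (phi scale) (theta scale)"
proof (rule short_exact_mapI[OF short_exact_shift_cx[OF leibniz_short_exact] hochschild_short_exact phi_chain_map])
  interpret H: short_exact "CHH_cx scale" "cyclic_cx scale" "pi2 scale" by (rule hochschild_short_exact)
  have ind: "induced (T n) (cyc_rel scale n) (tensor_map scale n antisym_word) (alt_rel scale n +>\<^bsub>T n\<^esub> x)
      = cyc_rel scale n +>\<^bsub>T n\<^esub> tensor_map scale n antisym_word x" if "n > 0" "x \<in> carrier (T n)" for n x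
    using that by (intro induced_coset tensor_power_kmod alt_rel_submodule cyc_rel_submodule
        tensor_map_antisym_linear tensor_map_antisym_alt_rel)
  have lin: "induced (T n) (cyc_rel scale n) (tensor_map scale n antisym_word)
      \<in> linear_maps (ext_power scale n) (quot_module (T n) (cyc_rel scale n))" if "n > 0" for n
    unfolding ext_power_def using that
    by (intro induced_linear tensor_power_kmod alt_rel_submodule cyc_rel_submodule
        tensor_map_antisym_linear tensor_map_antisym_alt_rel)
  fix n
  have "(theta scale n \<in> linear_maps (chain (Lie_cx scale) (n + 1)) (chain (cyclic_cx scale) n))
    \<and> (\<forall>x\<in>carrier (chain (CL_cx scale) (n + 1)). theta scale n (pi1 scale (n + 1) x) = pi2 scale n (phi scale n x))"
  proof (cases "n < 0")
    case True
    have "cyc_rel scale 1 +>\<^bsub>T 1\<^esub> \<zero>\<^bsub>T 1\<^esub> = cyc_rel scale 1"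
      by (rule coset_zero[OF tensor_power_kmod cyc_rel_submodule]) simp
    then show ?thesis
      using True linear_maps_const_zero[OF complex_kmod[OF H.D, of n]]
      by (simp add: theta_def phi_def pi2_def CHH_cx_negative cyclic_cx_negative)
  next
    case False
    then obtain k where n: "n = int k" using zero_le_imp_eq_int[of n] by auto
    have deg: "n + 1 = int (Suc k)" "theta scale n = induced (T (Suc k)) (cyc_rel scale (Suc k)) (tensor_map scale (Suc k) antisym_word)"
      "phi scale n = tensor_map scale (Suc k) antisym_word"
      using n by (simp_all add: theta_def phi_def)
    show ?thesis
      unfolding deg unfolding n CL_cx_nat cyclic_cx_nat pi1_def pi2_def nat_int Lie_cx_def nonneg_cx_nat
      using lin[of "Suc k"] ind[of "Suc k"] by simp
  qed
  then show "theta scale n \<in> linear_maps (chain (shift_cx 1 (Lie_cx scale)) n) (chain (cyclic_cx scale) n)"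
    "\<And>x. x \<in> carrier (chain (shift_cx 1 (CL_cx scale)) n) \<Longrightarrow> theta scale n (pi1 scale (n + 1) x) = pi2 scale n (phi scale n x)"
    by simp_all
qed

end

section \<open>Connes' isomorphism\<close>

lemma hom_map_bij:
  assumes C: "is_complex C" and D: "is_complex D" and f: "homology_compatible C m D n f"
    and inj: "\<And>x. x \<in> cycles C m \<Longrightarrow> f x \<in> boundaries D n \<Longrightarrow> x \<in> boundaries C m"
    and surj: "\<And>y. y \<in> cycles D n \<Longrightarrow> \<exists>x\<in>cycles C m. hom_class D n (f x) = hom_class D n y"
  shows "bij_betw (hom_map D n f) (carrier (homology C m)) (carrier (homology D n))"
  unfolding bij_betw_def
proof (intro conjI)
  note f_class = hom_map_hom_class[OF C D f]
  have lin: "f \<in> linear_maps (chain C m) (chain D n)" using f by (simp add: homology_compatible_def)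
  show "inj_on (hom_map D n f) (carrier (homology C m))"
  proof (rule inj_onI)
    fix z z' assume z: "z \<in> carrier (homology C m)" and z': "z' \<in> carrier (homology C m)"
      and eq: "hom_map D n f z = hom_map D n f z'"
    obtain x where x: "x \<in> cycles C m" "z = hom_class C m x" using homology_cases[OF C z] .
    obtain x' where x': "x' \<in> cycles C m" "z' = hom_class C m x'" using homology_cases[OF C z'] .
    have "x \<ominus>\<^bsub>chain C m\<^esub> x' \<in> cycles C m"
      by (rule submodule_minus_closed[OF complex_kmod[OF C] cycles_submodule[OF C] x(1) x'(1)])
    moreover have "f (x \<ominus>\<^bsub>chain C m\<^esub> x') \<in> boundaries D n"
    proof -
      have "f (x \<ominus>\<^bsub>chain C m\<^esub> x') = f x \<ominus>\<^bsub>chain D n\<^esub> f x'"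
        by (rule linear_maps_minus[OF complex_kmod[OF C] complex_kmod[OF D] lin]) (use x x' in \<open>auto simp: cycles_iff\<close>)
      then show ?thesis
        using eq x x' f_class hom_class_eq_iff[OF D homology_compatible_cycles[OF f x(1)] homology_compatible_cycles[OF f x'(1)]]
        by simp
    qed
    ultimately have "x \<ominus>\<^bsub>chain C m\<^esub> x' \<in> boundaries C m" by (rule inj)
    then show "z = z'" using hom_class_eq_iff[OF C x(1) x'(1)] x(2) x'(2) by simp
  qed
next
  show "hom_map D n f ` carrier (homology C m) = carrier (homology D n)"
  proof (intro equalityI subsetI)
    fix w assume "w \<in> hom_map D n f ` carrier (homology C m)"
    then show "w \<in> carrier (homology D n)" using linear_maps_closed[OF hom_map_linear[OF C D f]] by auto
  next
    fix w assume w: "w \<in> carrier (homology D n)"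
    obtain y where y: "y \<in> cycles D n" "w = hom_class D n y" using homology_cases[OF D w] .
    obtain x where x: "x \<in> cycles C m" "hom_class D n (f x) = hom_class D n y" using surj[OF y(1)] by blast
    then have "w = hom_map D n f (hom_class C m x)"
      using y hom_map_hom_class[OF C D f x(1)] by simp
    then show "w \<in> hom_map D n f ` carrier (homology C m)" using hom_class_closed[OF C x(1)] by blast
  qed
qed

context unital_algebra_char_0
begin

lemma eqv_divide:
  assumes "fscale (of_nat n) x \<approx> y" "n > 0"
  shows "x \<approx> fscale (inverse (of_nat n)) y"
proof -
  have "x = fscale (inverse (of_nat n)) (fscale (of_nat n) x)" using assms(2) by simp
  also have "\<dots> \<approx> fscale (inverse (of_nat n)) y" by (rule tensor_eq_fscale[OF assms(1)])
  finally show ?thesis .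
qed

text \<open>In characteristic zero the periodic sequence of the operators \<open>1 - t\<close> and \<open>N\<close> is exact. This
  is one half of it, and the next lemma is the other.\<close>

lemma nrm_kernel:
  assumes "z \<in> words n" "n > 0" "nrm n z \<approx> 0"
  shows "\<exists>y\<in>words n. z \<approx> y - cyc y"
proof -
  obtain y where y: "y \<in> words n" "fscale (of_nat n) z - nrm n z = y - cyc y"
    using nrm_complement[OF assms(1)] .
  have "fscale (of_nat n) z = (y - cyc y) + nrm n z" unfolding y(2)[symmetric] by simp
  also have "\<dots> \<approx> (y - cyc y) + 0" by (intro tensor_eq_add tensor_eq_refl assms(3))
  finally have "fscale (of_nat n) z \<approx> y - cyc y" by simp
  from eqv_divide[OF this assms(2)] show ?thesis
    using words_fscale[OF y(1)] by (auto simp: fv.scale_right_diff_distrib intro!: bexI[of _ "fscale (inverse (of_nat n)) y"])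
qed

lemma cyc_invariant_nrm:
  assumes "n > 0" "z - cyc z \<approx> 0"
  shows "z \<approx> nrm n (fscale (inverse (of_nat n)) z)"
proof -
  have "cyc z \<approx> z" using assms(2) tensor_eq_sym[of scale "z" "cyc z"] by (simp add: tensor_eq_def)
  then have "fscale (of_nat n) z \<approx> nrm n z" using eqv_nrm_invariant tensor_eq_sym by blast
  from eqv_divide[OF this assms(1)] show ?thesis by simp
qed

lemma hoch_letters:
  assumes "x \<in> words (Suc 0)"
  shows "hoch x = 0" (is "?F x = 0")
proof (rule lin_eq_on_words[of ?F "\<lambda>_. 0", OF _ _ assms])
  show "?F (fword w) = 0" if "length w = Suc 0" for w
    using that by (cases w) (auto simp: hoch_word_def)
qed (intro lin_intros)+

lemma norm_op_class:
  assumes "n > 0" "x \<in> words n"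
  shows "norm_op scale n (cls n x) = cls n (nrm n x)"
proof -
  have "(cyc_op scale n ^^ i) (cls n x) = cls n ((cyc ^^ i) x)" for i
    using assms by (induction i) (simp_all add: cyc_op_class cyc_pow_words)
  then show ?thesis
    using tensor_class_finsum[of n "\<lambda>i. (cyc ^^ i) x" n] cyc_pow_words[OF assms(2)] by (simp add: norm_op_def nrm_def)
qed

lemma unit_op_class: "x \<in> words n \<Longrightarrow> unit_op scale (Suc n) (cls n x) = cls (Suc n) (cons 1 x)"
  unfolding unit_op_def by (rule tensor_map_class[OF tensors tensors descends_cons refl]) simp_all

definition connes_word :: "nat \<Rightarrow> ('a list \<Rightarrow>\<^sub>0 'k) \<Rightarrow> 'a list \<Rightarrow>\<^sub>0 'k"
  where "connes_word n x = cons 1 (nrm n x) - cyc (cons 1 (nrm n x))"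

lemma cons_nrm_words: "x \<in> words n \<Longrightarrow> cons 1 (nrm n x) \<in> words (Suc n)"
  by (intro cons_words nrm_words)

lemma connes_word_words: "x \<in> words n \<Longrightarrow> connes_word n x \<in> words (Suc n)"
  unfolding connes_word_def by (intro words_diff cyc_words cons_nrm_words)

definition cyc_class :: "nat \<Rightarrow> ('a list \<Rightarrow>\<^sub>0 'k) \<Rightarrow> ('a, 'k) tensor set"
  where "cyc_class n x = cyc_rel scale n +>\<^bsub>T n\<^esub> cls n x"

lemma pi2_class: "pi2 scale (int k) (cls (Suc k) x) = cyc_class (Suc k) x"
  by (simp add: pi2_def cyc_class_def)

lemma cyc_class_eq_zero_iff:
  assumes "n > 0" "x \<in> words n"
  shows "cyc_class n x = cyc_rel scale n \<longleftrightarrow> (\<exists>y\<in>words n. x \<approx> y - cyc y)"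
  unfolding cyc_class_def cyc_rel_iff[OF assms, symmetric]
  by (rule coset_eq_zero_iff[OF tensor_power_kmod cyc_rel_submodule[OF assms(1)] tensor_class_closed[OF assms(2)]])

lemma cyc_class_eq_iff:
  assumes "n > 0" "x \<in> words n" "x' \<in> words n"
  shows "cyc_class n x = cyc_class n x' \<longleftrightarrow> (\<exists>y\<in>words n. x - x' \<approx> y - cyc y)"
proof -
  have "cyc_class n x = cyc_class n x' \<longleftrightarrow> cls n x \<ominus>\<^bsub>T n\<^esub> cls n x' \<in> cyc_rel scale n"
    unfolding cyc_class_def using assms
    by (intro coset_eq_iff tensor_power_kmod cyc_rel_submodule tensor_class_closed)
  then show ?thesis using assms by (simp add: tensor_class_minus cyc_rel_iff words_diff)
qed

lemma cyc_class_cases: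
  assumes "z \<in> carrier (quot_module (T n) (cyc_rel scale n))"
  obtains x where "x \<in> words n" "z = cyc_class n x"
proof -
  obtain u where "u \<in> carrier (T n)" "z = cyc_rel scale n +>\<^bsub>T n\<^esub> u" using assms by (auto simp: a_rcosets_iff)
  then show ?thesis using that by (elim tensor_cases) (simp add: cyc_class_def)
qed

lemma cyc_class_closed: "x \<in> words n \<Longrightarrow> cyc_class n x \<in> carrier (quot_module (T n) (cyc_rel scale n))"
  using tensor_class_closed by (auto simp: a_rcosets_iff cyc_class_def)

lemma cyclic_bd_class:
  assumes "x \<in> words (Suc (Suc k))"
  shows "bd (cyclic_cx scale) (int (Suc k)) (cyc_class (Suc (Suc k)) x) = cyc_class (Suc k) (hoch x)"
  using subcomplex.DQ_coset[OF hochschild_subcomplex, of "cls (Suc (Suc k)) x" k] assms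
  unfolding cyclic_cx_nat by (simp add: cyc_class_def hochschild_bd_class tensor_class_closed)

lemma ker_pi2_carrier: "carrier (chain (ker_pi2_cx scale) (int k)) = cyc_rel scale (Suc k)"
  using a_kernel_coset[OF tensor_power_kmod cyc_rel_submodule[of "Suc k"]]
  unfolding ker_pi2_cx_def ker_cx_simps CHH_cx_nat cyclic_cx_nat pi2_def[abs_def] by simp

lemma ker_pi2_bd: "bd (ker_pi2_cx scale) = bd (CHH_cx scale)"
  by (simp add: ker_pi2_cx_def)

lemma ker_pi2_zero: "\<zero>\<^bsub>chain (ker_pi2_cx scale) n\<^esub> = \<zero>\<^bsub>chain (CHH_cx scale) n\<^esub>"
  by (simp add: ker_pi2_cx_def)

interpretation H: short_exact "CHH_cx scale" "cyclic_cx scale" "pi2 scale"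
  by (rule hochschild_short_exact)

lemma ker_pi2_complex: "is_complex (ker_pi2_cx scale)"
  unfolding ker_pi2_cx_def by (rule H.ker_complex)

lemma cyclic_cycle_iff:
  assumes x: "x \<in> words (Suc k)"
  shows "cyc_class (Suc k) x \<in> cycles (cyclic_cx scale) (int k) \<longleftrightarrow> (\<exists>u\<in>words k. hoch x \<approx> u - cyc u)"
proof (cases k)
  case 0
  have "bd (cyclic_cx scale) 0 (cyc_class (Suc 0) x) = \<zero>\<^bsub>chain (cyclic_cx scale) (- 1)\<^esub>"
    by (simp add: cyclic_cx_nat(3) cyclic_cx_negative)
  then have "cyc_class (Suc k) x \<in> cycles (cyclic_cx scale) (int k)"
    using 0 cyc_class_closed[OF x] cyclic_cx_nat(1)[of 0] by (simp add: cycles_iff)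
  moreover have "\<exists>u\<in>words k. hoch x \<approx> u - cyc u"
    using hoch_letters[of x] x 0 by (auto intro!: bexI[of _ 0] simp: words_zero)
  ultimately show ?thesis by blast
next
  case (Suc j)
  have "cyc_class (Suc k) x \<in> cycles (cyclic_cx scale) (int k) \<longleftrightarrow> cyc_class k (hoch x) = cyc_rel scale k"
    unfolding cycles_iff Suc int_Suc_minus cyclic_bd_class[OF x[unfolded Suc]] cyclic_cx_nat(1)
    using cyc_class_closed[OF x] Suc by simp
  then show ?thesis using Suc x by (simp add: cyc_class_eq_zero_iff hoch_words)
qed

lemma cyclic_boundary_iff:
  assumes x: "x \<in> words (Suc k)"
  shows "cyc_class (Suc k) x \<in> boundaries (cyclic_cx scale) (int k) \<longleftrightarrow>
    (\<exists>v\<in>words (Suc (Suc k)). \<exists>y\<in>words (Suc k). x - hoch v \<approx> y - cyc y)"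
proof -
  have "cyc_class (Suc k) x \<in> boundaries (cyclic_cx scale) (int k) \<longleftrightarrow>
      (\<exists>z\<in>carrier (quot_module (T (Suc (Suc k))) (cyc_rel scale (Suc (Suc k)))).
        cyc_class (Suc k) x = bd (cyclic_cx scale) (int (Suc k)) z)"
    using cyclic_cx_nat(1)[of "Suc k"] by (simp add: boundaries_iff add.commute)
  also have "\<dots> \<longleftrightarrow> (\<exists>v\<in>words (Suc (Suc k)). cyc_class (Suc k) x = cyc_class (Suc k) (hoch v))"
    using cyclic_bd_class cyc_class_closed by (metis cyc_class_cases)
  finally show ?thesis using x by (auto simp: cyc_class_eq_iff hoch_words)
qed

lemma ker_pi2_cases:
  assumes "z \<in> carrier (chain (ker_pi2_cx scale) (int k))"
  obtains y where "y \<in> words (Suc k)" "z = cls (Suc k) (y - cyc y)"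
  using assms cyc_rel_cases unfolding ker_pi2_carrier by blast

lemma ker_pi2_bd_class:
  assumes "y \<in> words (Suc (Suc k))"
  shows "bd (CHH_cx scale) (int (Suc k)) (cls (Suc (Suc k)) (y - cyc y)) = cls (Suc k) (bar y - cyc (bar y))"
  unfolding CHH_cx_nat using assms by (simp add: hochschild_bd_class words_diff cyc_words hoch_cyc)

lemma ker_pi2_cycle_iff:
  assumes "y \<in> words (Suc (Suc k))"
  shows "cls (Suc (Suc k)) (y - cyc y) \<in> cycles (ker_pi2_cx scale) (int (Suc k)) \<longleftrightarrow> bar y - cyc (bar y) \<approx> 0"
proof -
  have "cls (Suc (Suc k)) (y - cyc y) \<in> cycles (ker_pi2_cx scale) (int (Suc k))
      \<longleftrightarrow> cls (Suc k) (bar y - cyc (bar y)) = cls (Suc k) 0"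
    unfolding cycles_iff ker_pi2_carrier ker_pi2_bd ker_pi2_zero int_Suc_minus ker_pi2_bd_class[OF assms]
      CHH_cx_nat(1) tensor_class_zero using cyc_relI[OF _ assms] by simp
  then show ?thesis using assms by (simp add: tensor_class_eq_iff words_diff cyc_words bar_words words_zero)
qed

lemma ker_pi2_boundary_iff:
  assumes "z \<in> words (Suc (Suc k))"
  shows "cls (Suc (Suc k)) z \<in> boundaries (ker_pi2_cx scale) (int (Suc k)) \<longleftrightarrow>
    (\<exists>v\<in>words (Suc (Suc (Suc k))). z \<approx> bar v - cyc (bar v))"
proof -
  have "cls (Suc (Suc k)) z \<in> boundaries (ker_pi2_cx scale) (int (Suc k)) \<longleftrightarrow>
      (\<exists>c\<in>carrier (chain (ker_pi2_cx scale) (int (Suc (Suc k)))). cls (Suc (Suc k)) z = bd (CHH_cx scale) (int (Suc (Suc k))) c)"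
    by (simp add: boundaries_iff ker_pi2_bd add.commute)
  also have "\<dots> \<longleftrightarrow> (\<exists>v\<in>words (Suc (Suc (Suc k))). cls (Suc (Suc k)) z = cls (Suc (Suc k)) (bar v - cyc (bar v)))"
    unfolding ker_pi2_carrier using ker_pi2_bd_class cyc_relI by (metis cyc_rel_cases zero_less_Suc)
  finally show ?thesis using assms by (auto simp: tensor_class_eq_iff words_diff cyc_words bar_words)
qed

lemma connes_op_linear_on_tensors:
  "(\<lambda>x. one_minus_cyc scale (Suc (Suc k)) (unit_op scale (Suc (Suc k)) (norm_op scale (Suc k) x)))
    \<in> linear_maps (T (Suc k)) (T (Suc (Suc k)))"
  "x \<in> words (Suc k) \<Longrightarrow> one_minus_cyc scale (Suc (Suc k)) (unit_op scale (Suc (Suc k)) (norm_op scale (Suc k) (cls (Suc k) x)))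
    = cls (Suc (Suc k)) (connes_word (Suc k) x)"
proof -
  have *: "one_minus_cyc scale (Suc (Suc k)) (unit_op scale (Suc (Suc k)) (norm_op scale (Suc k) (cls (Suc k) x)))
    = cls (Suc (Suc k)) (connes_word (Suc k) x)" if "x \<in> words (Suc k)" for x
    using that by (simp add: norm_op_class unit_op_class one_minus_cyc_class nrm_words cons_words connes_word_def)
  then show "x \<in> words (Suc k) \<Longrightarrow> one_minus_cyc scale (Suc (Suc k)) (unit_op scale (Suc (Suc k)) (norm_op scale (Suc k) (cls (Suc k) x)))
    = cls (Suc (Suc k)) (connes_word (Suc k) x)" by blast
  show "(\<lambda>x. one_minus_cyc scale (Suc (Suc k)) (unit_op scale (Suc (Suc k)) (norm_op scale (Suc k) x)))
    \<in> linear_maps (T (Suc k)) (T (Suc (Suc k)))"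
    by (rule linear_via_class[where G = "connes_word (Suc k)", OF _ connes_word_words *])
      (auto simp: connes_word_def[abs_def] intro!: lin_intros lin_nrm)
qed

lemma
  shows connes_op_class: "x \<in> words (Suc k) \<Longrightarrow>
      connes_op scale (int (Suc k)) (cyc_class (Suc k) x) = cls (Suc (Suc k)) (connes_word (Suc k) x)"
    and connes_op_linear: "connes_op scale (int (Suc k)) \<in> linear_maps (quot_module (T (Suc k)) (cyc_rel scale (Suc k))) (T (Suc (Suc k)))"
proof -
  have op: "connes_op scale (int (Suc k))
      = descend (\<lambda>x. one_minus_cyc scale (Suc (Suc k)) (unit_op scale (Suc (Suc k)) (norm_op scale (Suc k) x)))"
    unfolding connes_op_def nat_int by simp
  have zero: "one_minus_cyc scale (Suc (Suc k)) (unit_op scale (Suc (Suc k)) (norm_op scale (Suc k) z)) = \<zero>\<^bsub>T (Suc (Suc k))\<^esub>"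
    if z: "z \<in> cyc_rel scale (Suc k)" for z
  proof -
    obtain y where y: "y \<in> words (Suc k)" "z = cls (Suc k) (y - cyc y)" using cyc_rel_cases[OF z] by blast
    then have "connes_word (Suc k) (y - cyc y) = 0" by (simp add: connes_word_def nrm_cyc)
    then show ?thesis
      using y connes_op_linear_on_tensors(2)[of "y - cyc y" k] by (simp add: words_diff cyc_words tensor_class_zero)
  qed
  note arg = tensor_power_kmod cyc_rel_submodule[of "Suc k"] tensor_power_kmod connes_op_linear_on_tensors(1) zero
  show "x \<in> words (Suc k) \<Longrightarrow>
      connes_op scale (int (Suc k)) (cyc_class (Suc k) x) = cls (Suc (Suc k)) (connes_word (Suc k) x)"
    unfolding op cyc_class_def using descend_coset[OF arg] connes_op_linear_on_tensors(2)[of x k] tensor_class_closed by simp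
  show "connes_op scale (int (Suc k)) \<in> linear_maps (quot_module (T (Suc k)) (cyc_rel scale (Suc k))) (T (Suc (Suc k)))"
    unfolding op using descend_linear[OF arg] by simp
qed

text \<open>In general \<open>b' s N x = N x - s b' N x\<close>, and \<open>b' N x = N b x\<close> vanishes since \<open>x\<close> is a cycle
  modulo the image of \<open>1 - t\<close>.\<close>

lemma bar_cons_nrm:
  assumes x: "x \<in> words (Suc k)" and u: "u \<in> words k" "hoch x \<approx> u - cyc u"
  shows "bar (cons 1 (nrm (Suc k) x)) \<approx> nrm (Suc k) x"
proof -
  have "nrm k (hoch x) \<approx> nrm k (u - cyc u)" by (rule eqv_nrm[OF u(2)])
  then have "cons 1 (bar (nrm (Suc k) x)) \<approx> cons 1 0"
    using nrm_cyc[OF u(1)] by (intro descends_eq[OF descends_cons]) (simp add: nrm_hoch[OF x])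
  then have "nrm (Suc k) x - cons 1 (bar (nrm (Suc k) x)) \<approx> nrm (Suc k) x - 0"
    by (intro tensor_eq_diff) simp_all
  then show ?thesis using bar_cons_one[OF nrm_words[OF x]] by simp
qed

text \<open>On cycles, \<open>b (1 - t) s N x = (1 - t) b' s N x = (1 - t) N x = 0\<close>. On boundaries,
  \<open>s N b v = s b' N v = N v - b' s N v\<close>, and \<open>1 - t\<close> maps this to the boundary of \<open>- (1 - t) s N v\<close>.\<close>

lemma connes_op_compatible:
  "homology_compatible (cyclic_cx scale) (int k) (ker_pi2_cx scale) (int (Suc k)) (connes_op scale (int (Suc k)))"
  unfolding homology_compatible_def
proof (intro conjI subsetI)
  let ?c = "connes_op scale (int (Suc k))"
  have chain: "chain (ker_pi2_cx scale) (int (Suc k)) = (T (Suc (Suc k)))\<lparr>carrier := cyc_rel scale (Suc (Suc k))\<rparr>"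
    using ker_pi2_carrier[of "Suc k"] unfolding ker_pi2_cx_def ker_cx_simps CHH_cx_nat by simp
  have "?c z \<in> cyc_rel scale (Suc (Suc k))" if z: "z \<in> carrier (quot_module (T (Suc k)) (cyc_rel scale (Suc k)))" for z
  proof -
    obtain x where "x \<in> words (Suc k)" "z = cyc_class (Suc k) x" using cyc_class_cases[OF z] .
    then show ?thesis
      using cyc_relI[of "Suc (Suc k)" "cons 1 (nrm (Suc k) x)"] cons_nrm_words[of x "Suc k"] by (simp add: connes_op_class connes_word_def del: of_nat_Suc)
  qed
  then show "?c \<in> linear_maps (chain (cyclic_cx scale) (int k)) (chain (ker_pi2_cx scale) (int (Suc k)))"
    unfolding chain cyclic_cx_nat using connes_op_linear[of k] by (auto simp: linear_maps_def simp del: of_nat_Suc)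
next
  let ?c = "connes_op scale (int (Suc k))"
  fix w assume "w \<in> ?c ` cycles (cyclic_cx scale) (int k)"
  then obtain z where z: "z \<in> cycles (cyclic_cx scale) (int k)" "w = ?c z" by blast
  then have "z \<in> carrier (quot_module (T (Suc k)) (cyc_rel scale (Suc k)))" by (simp add: cycles_iff cyclic_cx_nat)
  then obtain x where x: "x \<in> words (Suc k)" "z = cyc_class (Suc k) x" by (rule cyc_class_cases)
  obtain u where u: "u \<in> words k" "hoch x \<approx> u - cyc u" using z(1) x by (auto simp: cyclic_cycle_iff)
  have b: "bar (cons 1 (nrm (Suc k) x)) \<approx> nrm (Suc k) x" by (rule bar_cons_nrm[OF x(1) u])
  have "bar (cons 1 (nrm (Suc k) x)) - cyc (bar (cons 1 (nrm (Suc k) x))) \<approx> nrm (Suc k) x - cyc (nrm (Suc k) x)"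
    by (intro tensor_eq_diff b descends_eq[OF respectful_cyc])
  then show "w \<in> cycles (ker_pi2_cx scale) (int (Suc k))"
    unfolding z(2) x(2) connes_op_class[OF x(1)] connes_word_def ker_pi2_cycle_iff[OF cons_nrm_words[OF x(1)]]
    by (simp add: cyc_nrm[OF x(1)])
next
  let ?c = "connes_op scale (int (Suc k))"
  fix w assume "w \<in> ?c ` boundaries (cyclic_cx scale) (int k)"
  then obtain z where z: "z \<in> boundaries (cyclic_cx scale) (int k)" "w = ?c z" by blast
  then have "z \<in> carrier (quot_module (T (Suc k)) (cyc_rel scale (Suc k)))"
    using boundaries_subset_cycles[OF H.D, of "int k"] by (auto simp: cycles_iff cyclic_cx_nat)
  then obtain x where x: "x \<in> words (Suc k)" "z = cyc_class (Suc k) x" by (rule cyc_class_cases)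
  obtain v y where v: "v \<in> words (Suc (Suc k))" and y: "y \<in> words (Suc k)" and xv: "x - hoch v \<approx> y - cyc y"
    using z(1) x by (auto simp: cyclic_boundary_iff)
  let ?n = "nrm (Suc (Suc k)) v"
  have n: "?n \<in> words (Suc (Suc k))" by (rule nrm_words[OF v])
  have "nrm (Suc k) (x - hoch v) \<approx> nrm (Suc k) (y - cyc y)" by (rule eqv_nrm[OF xv])
  then have "nrm (Suc k) x \<approx> bar ?n" using nrm_hoch[OF v] nrm_cyc[OF y] by (simp add: tensor_eq_def)
  then have "cons 1 (nrm (Suc k) x) \<approx> cons 1 (bar ?n)" by (rule descends_eq[OF descends_cons])
  also have "cons 1 (bar ?n) = ?n - bar (cons 1 ?n)" using bar_cons_one[OF n] by simp
  finally have s: "cons 1 (nrm (Suc k) x) \<approx> ?n - bar (cons 1 ?n)" .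
  have "connes_word (Suc k) x \<approx> (?n - bar (cons 1 ?n)) - cyc (?n - bar (cons 1 ?n))"
    unfolding connes_word_def by (intro tensor_eq_diff s descends_eq[OF respectful_cyc])
  also have "\<dots> = bar (- cons 1 ?n) - cyc (bar (- cons 1 ?n))"
    by (simp add: cyc_nrm[OF v])
  finally show "w \<in> boundaries (ker_pi2_cx scale) (int (Suc k))"
    unfolding z(2) x(2) connes_op_class[OF x(1)] ker_pi2_boundary_iff[OF connes_word_words[OF x(1)]]
    using cons_words[OF n] words_uminus by blast
qed

text \<open>If \<open>(1 - t) s N x = b (1 - t) v = (1 - t) b' v\<close>, then \<open>s N x - b' v\<close> is invariant and
  therefore a norm \<open>N y\<close>. Applying \<open>b'\<close> gives \<open>N x = N b y\<close>, so that \<open>x - b y\<close> lies in the image of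
  \<open>1 - t\<close>.\<close>

lemma connes_op_injective:
  assumes z: "z \<in> cycles (cyclic_cx scale) (int k)"
    and b: "connes_op scale (int (Suc k)) z \<in> boundaries (ker_pi2_cx scale) (int (Suc k))"
  shows "z \<in> boundaries (cyclic_cx scale) (int k)"
proof -
  from z have "z \<in> carrier (quot_module (T (Suc k)) (cyc_rel scale (Suc k)))" by (simp add: cycles_iff cyclic_cx_nat)
  then obtain x where x: "x \<in> words (Suc k)" "z = cyc_class (Suc k) x" by (rule cyc_class_cases)
  obtain u where u: "u \<in> words k" "hoch x \<approx> u - cyc u" using z x by (auto simp: cyclic_cycle_iff)
  obtain v where v: "v \<in> words (Suc (Suc (Suc k)))" "connes_word (Suc k) x \<approx> bar v - cyc (bar v)"
    using b unfolding x(2) connes_op_class[OF x(1)] ker_pi2_boundary_iff[OF connes_word_words[OF x(1)]] by blast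
  let ?r = "cons 1 (nrm (Suc k) x) - bar v"
  have r: "?r \<in> words (Suc (Suc k))" by (intro words_diff cons_nrm_words x bar_words v)
  have "connes_word (Suc k) x - (bar v - cyc (bar v)) \<approx> (bar v - cyc (bar v)) - (bar v - cyc (bar v))"
    by (intro tensor_eq_diff v tensor_eq_refl)
  then have "?r - cyc ?r \<approx> 0" by (simp add: connes_word_def algebra_simps)
  then have "?r \<approx> nrm (Suc (Suc k)) (fscale (inverse (of_nat (Suc (Suc k)))) ?r)" (is "_ \<approx> nrm _ ?y")
    by (intro cyc_invariant_nrm) simp_all
  then have "bar ?r \<approx> bar (nrm (Suc (Suc k)) ?y)" by (rule descends_eq[OF respectful_bar])
  also have "\<dots> = nrm (Suc k) (hoch ?y)" by (rule nrm_hoch[OF words_fscale[OF r], symmetric])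
  finally have "bar (cons 1 (nrm (Suc k) x)) \<approx> nrm (Suc k) (hoch ?y)" by (simp add: bar_bar)
  with bar_cons_nrm[OF x(1) u] have "nrm (Suc k) x \<approx> nrm (Suc k) (hoch ?y)"
    by (blast intro: tensor_eq_trans tensor_eq_sym)
  then have "nrm (Suc k) (x - hoch ?y) \<approx> 0" by (simp add: tensor_eq_def)
  moreover have y: "hoch ?y \<in> words (Suc k)" by (intro hoch_words words_fscale r)
  ultimately show ?thesis
    unfolding x(2) cyclic_boundary_iff[OF x(1)] using nrm_kernel[of "x - hoch ?y" "Suc k"] words_diff[OF x(1) y] words_fscale[OF r]
    by blast
qed

text \<open>If \<open>(1 - t) y\<close> is a cycle, then \<open>b' y\<close> is invariant and therefore a norm \<open>N x\<close>. As
  \<open>N b x = b' b' y = 0\<close>, the tensor \<open>x\<close> is a cycle modulo the image of \<open>1 - t\<close>, and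
  \<open>s N x = s b' y = y - b' s y\<close> shows that Connes' operator takes it to
  \<open>(1 - t) y - b (1 - t) s y\<close>.\<close>

lemma connes_op_surjective:
  assumes z: "z \<in> cycles (ker_pi2_cx scale) (int (Suc k))"
  shows "\<exists>w\<in>cycles (cyclic_cx scale) (int k). hom_class (ker_pi2_cx scale) (int (Suc k)) (connes_op scale (int (Suc k)) w)
    = hom_class (ker_pi2_cx scale) (int (Suc k)) z"
proof -
  from z have "z \<in> carrier (chain (ker_pi2_cx scale) (int (Suc k)))" by (simp add: cycles_iff del: of_nat_Suc)
  then obtain y where y: "y \<in> words (Suc (Suc k))" "z = cls (Suc (Suc k)) (y - cyc y)" by (rule ker_pi2_cases)
  have inv: "bar y - cyc (bar y) \<approx> 0" using z y by (simp add: ker_pi2_cycle_iff del: of_nat_Suc)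
  let ?x = "fscale (inverse (of_nat (Suc k))) (bar y)"
  have x: "?x \<in> words (Suc k)" by (intro words_fscale bar_words y)
  have nx: "bar y \<approx> nrm (Suc k) ?x" by (rule cyc_invariant_nrm[OF _ inv]) simp
  have "\<exists>u\<in>words k. hoch ?x \<approx> u - cyc u"
  proof (cases "k = 0")
    case True
    then show ?thesis using hoch_letters[of ?x] x by (auto intro!: bexI[of _ 0] simp: words_zero)
  next
    case False
    have "nrm k (hoch ?x) = bar (nrm (Suc k) ?x)" by (rule nrm_hoch[OF x])
    also have "\<dots> \<approx> bar (bar y)" by (rule descends_eq[OF respectful_bar tensor_eq_sym[OF nx]])
    finally have "nrm k (hoch ?x) \<approx> 0" by (simp add: bar_bar)
    then show ?thesis using False by (intro nrm_kernel hoch_words x) simp_all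
  qed
  then have cyc: "cyc_class (Suc k) ?x \<in> cycles (cyclic_cx scale) (int k)" by (rule iffD2[OF cyclic_cycle_iff[OF x]])
  have "cons 1 (nrm (Suc k) ?x) \<approx> cons 1 (bar y)" by (rule descends_eq[OF descends_cons tensor_eq_sym[OF nx]])
  also have "cons 1 (bar y) = y - bar (cons 1 y)" using bar_cons_one[OF y(1)] by simp
  finally have s: "cons 1 (nrm (Suc k) ?x) \<approx> y - bar (cons 1 y)" .
  have "connes_word (Suc k) ?x \<approx> (y - bar (cons 1 y)) - cyc (y - bar (cons 1 y))"
    unfolding connes_word_def by (intro tensor_eq_diff s descends_eq[OF respectful_cyc])
  from tensor_eq_diff[OF this tensor_eq_refl[of _ "y - cyc y"]]
  have diff: "connes_word (Suc k) ?x - (y - cyc y) \<approx> bar (- cons 1 y) - cyc (bar (- cons 1 y))"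
    by (simp add: algebra_simps)
  have op: "connes_op scale (int (Suc k)) (cyc_class (Suc k) ?x) = cls (Suc (Suc k)) (connes_word (Suc k) ?x)"
    by (rule connes_op_class[OF x])
  have cw: "connes_word (Suc k) ?x \<in> words (Suc (Suc k))" "y - cyc y \<in> words (Suc (Suc k))"
    using connes_word_words[OF x] y(1) by (auto intro: words_diff cyc_words)
  have "cls (Suc (Suc k)) (connes_word (Suc k) ?x - (y - cyc y)) \<in> boundaries (ker_pi2_cx scale) (int (Suc k))"
    unfolding ker_pi2_boundary_iff[OF words_diff[OF cw]]
    using diff words_uminus[OF cons_words[OF y(1)]] by blast
  moreover have cc: "connes_op scale (int (Suc k)) (cyc_class (Suc k) ?x) \<in> cycles (ker_pi2_cx scale) (int (Suc k))"
    by (rule homology_compatible_cycles[OF connes_op_compatible cyc])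
  moreover have "connes_op scale (int (Suc k)) (cyc_class (Suc k) ?x) \<ominus>\<^bsub>chain (ker_pi2_cx scale) (int (Suc k))\<^esub> z
      = cls (Suc (Suc k)) (connes_word (Suc k) ?x - (y - cyc y))"
  proof -
    have "cls (Suc (Suc k)) (connes_word (Suc k) ?x) \<in> cyc_rel scale (Suc (Suc k))"
      unfolding connes_word_def by (rule cyc_relI[OF _ cons_nrm_words[OF x]]) simp
    moreover have "z \<in> cyc_rel scale (Suc (Suc k))"
      unfolding y(2) by (rule cyc_relI[OF _ y(1)]) simp
    ultimately have "cls (Suc (Suc k)) (connes_word (Suc k) ?x) \<ominus>\<^bsub>(T (Suc (Suc k)))\<lparr>carrier := cyc_rel scale (Suc (Suc k))\<rparr>\<^esub> z
        = cls (Suc (Suc k)) (connes_word (Suc k) ?x) \<ominus>\<^bsub>T (Suc (Suc k))\<^esub> z"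
      by (rule submodule_minus[OF tensor_power_kmod cyc_rel_submodule[OF zero_less_Suc]])
    moreover have "chain (ker_pi2_cx scale) (int (Suc k)) = (T (Suc (Suc k)))\<lparr>carrier := cyc_rel scale (Suc (Suc k))\<rparr>"
      using ker_pi2_carrier[of "Suc k"] unfolding ker_pi2_cx_def ker_cx_simps CHH_cx_nat by simp
    ultimately show ?thesis unfolding op using y(2) cw by (simp add: tensor_class_minus)
  qed
  ultimately have "hom_class (ker_pi2_cx scale) (int (Suc k)) (connes_op scale (int (Suc k)) (cyc_class (Suc k) ?x))
      = hom_class (ker_pi2_cx scale) (int (Suc k)) z"
    using hom_class_eq_iff[OF ker_pi2_complex cc z] by simp
  then show ?thesis using cyc by blast
qed

lemma trivial_homology:
  assumes C: "is_complex C" and "carrier (chain C n) = {\<zero>\<^bsub>chain C n\<^esub>}"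
  shows "carrier (homology C n) = {\<zero>\<^bsub>homology C n\<^esub>}"
proof -
  have "z = \<zero>\<^bsub>homology C n\<^esub>" if z: "z \<in> carrier (homology C n)" for z
  proof -
    obtain x where x: "x \<in> cycles C n" "z = hom_class C n x" using homology_cases[OF C z] .
    then have "x = \<zero>\<^bsub>chain C n\<^esub>" using assms(2) by (simp add: cycles_iff)
    then have "x \<in> boundaries C n" using submodule_zero[OF complex_kmod[OF C] boundaries_submodule[OF C]] by simp
    then show ?thesis using hom_class_eq_zero_iff[OF C x(1)] x(2) by simp
  qed
  moreover have "\<zero>\<^bsub>homology C n\<^esub> \<in> carrier (homology C n)"
    using kmod_abelian_group[OF homology_kmod[OF C]] abelian_group.axioms(1) abelian_monoid.zero_closed by blast
  ultimately show ?thesis by blast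
qed

lemma connes_iso_lemma:
  shows connes_compatible: "homology_compatible (cyclic_cx scale) (n - 1) (ker_pi2_cx scale) n (connes_op scale n)"
    and connes_iso_linear: "connes_iso scale n \<in> linear_maps (HC scale (n - 1)) (homology (ker_pi2_cx scale) n)"
    and connes_iso_bij: "bij_betw (connes_iso scale n) (carrier (HC scale (n - 1))) (carrier (homology (ker_pi2_cx scale) n))"
proof -
  have "homology_compatible (cyclic_cx scale) (n - 1) (ker_pi2_cx scale) n (connes_op scale n)
    \<and> bij_betw (connes_iso scale n) (carrier (HC scale (n - 1))) (carrier (homology (ker_pi2_cx scale) n))"
  proof (cases "n \<le> 0")
    case True
    \<comment> \<open>Both complexes vanish here, in degree 0 because the cyclic operator fixes letters.\<close>
    have cyc0: "carrier (chain (cyclic_cx scale) (n - 1)) = {\<zero>\<^bsub>chain (cyclic_cx scale) (n - 1)\<^esub>}"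
      using True by (simp add: cyclic_cx_negative)
    have ker0: "carrier (chain (ker_pi2_cx scale) n) = {\<zero>\<^bsub>chain (ker_pi2_cx scale) n\<^esub>}"
    proof (cases "n = 0")
      case True
      have "cyc x = x" if "x \<in> words (Suc 0)" for x :: "'a list \<Rightarrow>\<^sub>0 'k"
        using cyc_pow_order[OF that] by simp
      then have "cyc_rel scale (Suc 0) = {cls (Suc 0) 0}"
        using cyc_rel_cases[of _ "Suc 0"] cyc_relI[of "Suc 0" 0] by (force simp: words_zero)
      then show ?thesis
        using True ker_pi2_carrier[of 0] CHH_cx_nat(1)[of 0] by (simp add: ker_pi2_zero tensor_class_zero)
    next
      case False
      then have n: "n < 0" using \<open>n \<le> 0\<close> by simp
      have "\<zero>\<^bsub>chain (ker_pi2_cx scale) n\<^esub> \<in> carrier (chain (ker_pi2_cx scale) n)"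
        using kmod_abelian_group[OF complex_kmod[OF ker_pi2_complex]] abelian_group.axioms(1) abelian_monoid.zero_closed by blast
      moreover have "carrier (chain (ker_pi2_cx scale) n) \<subseteq> carrier (chain (CHH_cx scale) n)"
        by (auto simp: ker_pi2_cx_def a_kernel_def')
      ultimately show ?thesis using n by (auto simp: CHH_cx_negative ker_pi2_zero)
    qed
    have zero: "\<zero>\<^bsub>chain (ker_pi2_cx scale) n\<^esub> = \<zero>\<^bsub>T 1\<^esub>"
      using True CHH_cx_nat(1)[of 0] by (cases "n = 0") (simp_all add: ker_pi2_zero CHH_cx_negative)
    have zb: "\<zero>\<^bsub>chain (ker_pi2_cx scale) n\<^esub> \<in> boundaries (ker_pi2_cx scale) n"
      by (rule submodule_zero[OF complex_kmod[OF ker_pi2_complex] boundaries_submodule[OF ker_pi2_complex]])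
    have op: "connes_op scale n = (\<lambda>_. \<zero>\<^bsub>chain (ker_pi2_cx scale) n\<^esub>)"
      using True by (simp add: connes_op_def zero)
    have comp: "homology_compatible (cyclic_cx scale) (n - 1) (ker_pi2_cx scale) n (connes_op scale n)"
      unfolding homology_compatible_def op
      using linear_maps_const_zero[OF complex_kmod[OF ker_pi2_complex]] zb boundaries_subset_cycles[OF ker_pi2_complex]
      by auto
    have "connes_iso scale n \<in> linear_maps (HC scale (n - 1)) (homology (ker_pi2_cx scale) n)"
      unfolding connes_iso_def HC_def by (rule hom_map_linear[OF H.D ker_pi2_complex comp])
    then show ?thesis
      using comp trivial_homology[OF H.D cyc0] trivial_homology[OF ker_pi2_complex ker0] linear_maps_closed
      by (fastforce simp: HC_def bij_betw_def)
  next
    case False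
    then have "n = int (Suc (nat (n - 1)))" by simp
    then obtain k where n: "n = int (Suc k)" by blast
    have "bij_betw (hom_map (ker_pi2_cx scale) (int (Suc k)) (connes_op scale (int (Suc k))))
        (carrier (homology (cyclic_cx scale) (int k))) (carrier (homology (ker_pi2_cx scale) (int (Suc k))))"
      by (rule hom_map_bij[OF H.D ker_pi2_complex connes_op_compatible connes_op_injective connes_op_surjective])
    then show ?thesis
      unfolding n int_Suc_minus connes_iso_def HC_def using connes_op_compatible by blast
  qed
  then show comp: "homology_compatible (cyclic_cx scale) (n - 1) (ker_pi2_cx scale) n (connes_op scale n)"
    and "bij_betw (connes_iso scale n) (carrier (HC scale (n - 1))) (carrier (homology (ker_pi2_cx scale) n))"
    by blast+
  show "connes_iso scale n \<in> linear_maps (HC scale (n - 1)) (homology (ker_pi2_cx scale) n)"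
    unfolding connes_iso_def HC_def by (rule hom_map_linear[OF H.D ker_pi2_complex comp])
qed

end

section \<open>Functoriality\<close>

lemma hom_map_square:
  assumes C: "is_complex C" and D: "is_complex D" and D': "is_complex D'" and E: "is_complex E"
    and f: "homology_compatible C m D n f" and g: "homology_compatible D n E q g"
    and f': "homology_compatible C m D' n' f'" and g': "homology_compatible D' n' E q g'"
    and square: "\<And>x. x \<in> carrier (chain C m) \<Longrightarrow> g (f x) = g' (f' x)"
    and z: "z \<in> carrier (homology C m)"
  shows "hom_map E q g (hom_map D n f z) = hom_map E q g' (hom_map D' n' f' z)"
proof -
  obtain x where x: "x \<in> cycles C m" "z = hom_class C m x" using homology_cases[OF C z] .
  then show ?thesis
    using homology_compatible_cycles[OF f x(1)] homology_compatible_cycles[OF f' x(1)] square[of x]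
    by (simp add: hom_map_hom_class[OF C D f] hom_map_hom_class[OF C D' f']
        hom_map_hom_class[OF D E g] hom_map_hom_class[OF D' E g'] cycles_iff)
qed

lemma inv_into_square:
  assumes "bij_betw i U X" "bij_betw i' V Y" "\<And>u. u \<in> U \<Longrightarrow> \<beta> u \<in> V" "\<And>u. u \<in> U \<Longrightarrow> i' (\<beta> u) = \<alpha> (i u)" "x \<in> X"
  shows "\<beta> (inv_into U i x) = inv_into V i' (\<alpha> x)"
proof -
  have u: "inv_into U i x \<in> U" "i (inv_into U i x) = x"
    using bij_betwE[OF bij_betw_inv_into[OF assms(1)]] bij_betw_inv_into_right[OF assms(1)] assms(5) by auto
  then have "i' (\<beta> (inv_into U i x)) = \<alpha> x" using assms(4) by simp
  then show ?thesis using bij_betw_inv_into_left[OF assms(2) assms(3)[OF u(1)]] by simp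
qed

abbreviation word_map :: "('a \<Rightarrow> 'b) \<Rightarrow> ('a list \<Rightarrow>\<^sub>0 'k::field) \<Rightarrow> 'b list \<Rightarrow>\<^sub>0 'k"
  where "word_map f \<equiv> lin_ext (\<lambda>w. fword (map f w))"

lemma word_map_cons: "word_map f (cons a z) = cons (f a) (word_map f z)"
  by (rule lin_eq) (auto intro!: lin_intros)

lemma word_map_snoc: "word_map f (snoc a z) = snoc (f a) (word_map f z)"
  by (rule lin_eq) (auto intro!: lin_intros)

lemma word_map_words: "z \<in> words n \<Longrightarrow> word_map f z \<in> words n"
  by (rule lin_ext_words) auto

lemma word_map_cyc: "word_map f (cyc z) = cyc (word_map f z)" (is "?F z = ?G z")
proof (rule lin_eq[of ?F ?G])
  show "?F (fword w) = ?G (fword w)" for w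
    by (cases w rule: rev_cases) (simp_all add: cyc_word_snoc)
qed (intro lin_intros)+

lemma word_map_nrm: "word_map f (nrm n z) = nrm n (word_map f z)"
proof -
  have "word_map f ((cyc ^^ i) z) = (cyc ^^ i) (word_map f z)" for i
    by (induction i) (simp_all add: word_map_cyc)
  then show ?thesis by (simp add: nrm_def)
qed

lemma word_map_ins_word: "word_map f (ins_word x w) = ins_word (f x) (map f w)"
  by (induction w) (simp_all add: word_map_cons)

lemma word_map_ins1: "word_map f (ins1 x z) = ins1 (f x) (word_map f z)" (is "?F z = ?G z")
proof (rule lin_eq[of ?F ?G])
  show "?F (fword w) = ?G (fword w)" for w
    by (cases w) (simp_all add: word_map_cons word_map_ins_word)
qed (intro lin_intros)+

lemma word_map_antisymmetrize: "word_map f (antisymmetrize z) = antisymmetrize (word_map f z)" (is "?F z = ?G z")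
proof (rule lin_eq[of ?F ?G])
  show "?F (fword w) = ?G (fword w)" for w
  proof (induction w rule: rev_induct)
    case (snoc x w)
    then show ?case
      by (cases "w = []") (simp_all add: antisym_word_snoc word_map_ins1)
  qed simp
qed (intro lin_intros)+

locale algebra_map = A: unital_algebra_char_0 sc + B: unital_algebra_char_0 sc'
  for sc :: "'k::field_char_0 \<Rightarrow> 'a::{ring,monoid_mult} \<Rightarrow> 'a" and sc' :: "'k \<Rightarrow> 'b::{ring,monoid_mult} \<Rightarrow> 'b" +
  fixes f :: "'a \<Rightarrow> 'b"
  assumes f: "unital_algebra_hom sc sc' f"
begin

lemma f_hom:
  shows f_mult: "f (x * y) = f x * f y" and f_one: "f 1 = 1" and f_linear: "f (a + sc c b) = f a + sc' c (f b)"
    and f_bracket: "f (bracket x y) = bracket (f x) (f y)"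
proof -
  have lin: "Vector_Spaces.linear sc sc' f" and m: "\<And>x y. f (x * y) = f x * f y" and one: "f 1 = 1"
    using f by (auto simp: unital_algebra_hom_def)
  interpret L: Vector_Spaces.linear sc sc' f by fact
  show "f (x * y) = f x * f y" "f 1 = 1" "f (a + sc c b) = f a + sc' c (f b)"
    by (simp_all add: m one L.add L.scale)
  show "f (bracket x y) = bracket (f x) (f y)" by (simp add: bracket_def L.diff m)
qed

lemma word_map_ad: "word_map f (ad x z) = ad (f x) (word_map f z)" (is "?F z = ?G z")
proof (rule lin_eq[of ?F ?G])
  show "?F (fword w) = ?G (fword w)" for w
    by (induction w) (simp_all add: word_map_cons f_bracket)
qed (intro lin_intros)+

lemma word_map_leib: "word_map f (leib z) = leib (word_map f z)" (is "?F z = ?G z")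
proof (rule lin_eq[of ?F ?G])
  show "?F (fword w) = ?G (fword w)" for w
  proof (induction w rule: rev_induct)
    case (snoc x w)
    then show ?case
      using word_map_ad[of x "fword w"] by (simp add: leibniz_word_snoc word_map_snoc)
  qed simp
qed (intro lin_intros)+

lemma word_map_lmul_word: "word_map f (lmul_word c w) = lmul_word (f c) (map f w)"
  by (cases w) (simp_all add: f_mult)

lemma word_map_bar_word: "word_map f (bar_word w) = bar_word (map f w)"
  by (induction w) (simp_all add: word_map_cons word_map_lmul_word)

lemma word_map_hoch: "word_map f (hoch z) = hoch (word_map f z)" (is "?F z = ?G z")
proof (rule lin_eq[of ?F ?G])
  show "?F (fword w) = ?G (fword w)" for w
    using word_map_bar_word[of w]
    by (cases w rule: rev_cases) (simp_all add: hoch_word_snoc word_map_lmul_word)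
qed (intro lin_intros)+

lemma descends_word_map: "descends sc sc' (\<lambda>w. fword (map f w))"
proof (rule descendsI)
  show "mlin sc sc' (\<lambda>a. fword (map f (u @ a # v)))" for u v
    using mlin_linear_arg[OF mlin_word[of sc' "map f u" "map f v"], of f sc] by (simp add: f_linear)
qed

lemma
  shows tensor_fun_class: "x \<in> words n \<Longrightarrow> tensor_fun sc' f n (A.cls n x) = B.cls n (word_map f x)"
    and tensor_fun_linear: "tensor_fun sc' f n \<in> linear_maps (A.T n) (B.T n)"
proof -
  have w: "fword (map f w) \<in> words n" if "length w = n" for w using that by simp
  show "x \<in> words n \<Longrightarrow> tensor_fun sc' f n (A.cls n x) = B.cls n (word_map f x)"
    unfolding tensor_fun_def by (rule tensor_map_class[OF A.tensors B.tensors descends_word_map refl w])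
  show "tensor_fun sc' f n \<in> linear_maps (A.T n) (B.T n)"
    unfolding tensor_fun_def by (rule tensor_map_linear[OF A.tensors B.tensors descends_word_map refl w])
qed

lemma tensor_fun_zero: "tensor_fun sc' f n \<zero>\<^bsub>A.T n\<^esub> = \<zero>\<^bsub>B.T n\<^esub>"
  by (rule linear_maps_zero[OF A.tensor_power_kmod B.tensor_power_kmod tensor_fun_linear])

lemma word_map_alts:
  assumes "x \<in> A.alts"
  shows "word_map f x \<in> B.alts"
proof (rule lin_alt_rels_into_subspace[OF lin_lin_ext alt_rels_subspace assms])
  show "word_map f y \<in> B.alts" if "y \<in> A.rels" for y
    using descends_word_map that by (auto simp: descends_def intro: tensor_rels_alt_rels)
  show "word_map f (fword w) \<in> B.alts" if "\<not> distinct w" for w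
    using that distinct_map[of f w] by (auto intro: nondistinct_alt_rels)
qed

lemma leibniz_subcomplex_map:
  "subcomplex_map A.T (leibniz_bd sc) (alt_rel sc) B.T (leibniz_bd sc') (alt_rel sc') (tensor_fun sc' f)"
proof (intro subcomplex_map.intro subcomplex_map_axioms.intro A.leibniz_subcomplex B.leibniz_subcomplex tensor_fun_linear)
  show "leibniz_bd sc' n (tensor_fun sc' f (Suc n) z) = tensor_fun sc' f n (leibniz_bd sc n z)"
    if z: "z \<in> carrier (A.T (Suc n))" for n z
  proof -
    obtain x where "x \<in> words (Suc n)" "z = A.cls (Suc n) x" using A.tensor_cases[OF z] .
    then show ?thesis
      by (simp add: tensor_fun_class A.leibniz_bd_class B.leibniz_bd_class word_map_words leib_words word_map_leib)
  qed
  show "tensor_fun sc' f n ` alt_rel sc n \<subseteq> alt_rel sc' n" for n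
  proof (intro subsetI, elim imageE)
    fix y z assume y: "y = tensor_fun sc' f n z" and z: "z \<in> alt_rel sc n"
    then have "z \<in> carrier (A.T n)" using submodule_subset[OF A.tensor_power_kmod A.alt_rel_submodule] by blast
    then obtain x where "x \<in> words n" "z = A.cls n x" by (rule A.tensor_cases)
    then show "y \<in> alt_rel sc' n"
      using y z by (simp add: tensor_fun_class A.alt_rel_iff B.alt_rel_iff word_map_words word_map_alts)
  qed
qed

lemma hochschild_subcomplex_map:
  "subcomplex_map (\<lambda>n. A.T (n + 1)) (\<lambda>n. hochschild_bd sc (n + 1)) (\<lambda>n. cyc_rel sc (n + 1))
    (\<lambda>n. B.T (n + 1)) (\<lambda>n. hochschild_bd sc' (n + 1)) (\<lambda>n. cyc_rel sc' (n + 1)) (\<lambda>n. tensor_fun sc' f (n + 1))"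
proof (intro subcomplex_map.intro subcomplex_map_axioms.intro A.hochschild_subcomplex B.hochschild_subcomplex tensor_fun_linear)
  show "hochschild_bd sc' (n + 1) (tensor_fun sc' f (Suc n + 1) z) = tensor_fun sc' f (n + 1) (hochschild_bd sc (n + 1) z)"
    if z: "z \<in> carrier (A.T (Suc n + 1))" for n z
  proof -
    obtain x where "x \<in> words (Suc (Suc n))" "z = A.cls (Suc (Suc n)) x" using A.tensor_cases[OF z] by auto
    then show ?thesis
      by (simp add: tensor_fun_class A.hochschild_bd_class B.hochschild_bd_class word_map_words hoch_words word_map_hoch)
  qed
  show "tensor_fun sc' f (n + 1) ` cyc_rel sc (n + 1) \<subseteq> cyc_rel sc' (n + 1)" for n
  proof (intro subsetI, elim imageE)
    fix y z assume y: "y = tensor_fun sc' f (n + 1) z" and "z \<in> cyc_rel sc (n + 1)"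
    then obtain x where "x \<in> words (n + 1)" "z = A.cls (n + 1) (x - cyc x)" using A.cyc_rel_cases by (metis zero_less_Suc Suc_eq_plus1)
    then show "y \<in> cyc_rel sc' (n + 1)"
      using y B.cyc_relI[of "n + 1" "word_map f x"]
      by (simp add: tensor_fun_class words_diff cyc_words word_map_words word_map_cyc)
  qed
qed

abbreviation "F \<equiv> \<lambda>n. tensor_fun sc' f (nat n)"
abbreviation "FQ \<equiv> \<lambda>n. induced (B.T (nat n)) (alt_rel sc' (nat n)) (tensor_fun sc' f (nat n))"
abbreviation "F1 \<equiv> \<lambda>n. tensor_fun sc' f (nat n + 1)"
abbreviation "F1Q \<equiv> \<lambda>n. induced (B.T (nat n + 1)) (cyc_rel sc' (nat n + 1)) (tensor_fun sc' f (nat n + 1))"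

lemma leibniz_map:
  "short_exact_map (CL_cx sc) (Lie_cx sc) (pi1 sc) (CL_cx sc') (Lie_cx sc') (pi1 sc') F FQ"
  using subcomplex_map.short_exact_map[OF leibniz_subcomplex_map]
  by (simp add: CL_cx_def Lie_cx_def pi1_def[abs_def] ext_power_def[abs_def])

lemma hochschild_map:
  "short_exact_map (CHH_cx sc) (cyclic_cx sc) (pi2 sc) (CHH_cx sc') (cyclic_cx sc') (pi2 sc') F1 F1Q"
  using subcomplex_map.short_exact_map[OF hochschild_subcomplex_map]
  by (simp add: CHH_cx_def cyclic_cx_def pi2_def[abs_def])

end

section \<open>The map of long exact sequences\<close>

text \<open>Tensors of \<open>n + 1\<close> letters have the degree \<open>n + 1\<close> in the Leibniz complex and the degree \<open>n\<close> in
  the Hochschild complex. The shift puts them into the same degree.\<close>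

lemma leibniz_les_conv:
  "leibniz_les sc = ses_les (shift_cx 1 (CL_cx sc)) (shift_cx 1 (Lie_cx sc)) (\<lambda>n. pi1 sc (n + 1))"
  by (simp add: leibniz_les_def ses_les_def Hrel_def HL_def[abs_def] HLie_def[abs_def] rel_cx_def
      connecting_shift_cx fun_eq_iff homology_shift_cx hom_map_shift_cx ker_cx_shift_cx add.commute)

lemma connes_les_conv:
  "connes_les sc = transport_les (ses_les (CHH_cx sc) (cyclic_cx sc) (pi2 sc)) (\<lambda>n. HC sc (n - 1)) (connes_iso sc)"
  by (simp add: connes_les_def transport_les_def ses_les_def HH_def[abs_def] HC_def[abs_def] connes_iso_inv_def)

context unital_algebra_char_0
begin

lemma leibniz_is_les: "is_les (leibniz_les scale)"
  unfolding leibniz_les_conv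
  by (intro short_exact.is_les_ses_les short_exact_shift_cx leibniz_short_exact)

lemma connes_transport:
  "les_transport (ses_les (CHH_cx scale) (cyclic_cx scale) (pi2 scale)) (\<lambda>n. HC scale (n - 1)) (connes_iso scale)"
proof -
  interpret H: short_exact "CHH_cx scale" "cyclic_cx scale" "pi2 scale" by (rule hochschild_short_exact)
  show ?thesis
  proof (rule les_transport.intro)
    show "is_les (ses_les (CHH_cx scale) (cyclic_cx scale) (pi2 scale))" by (rule H.is_les_ses_les)
    show "kmod (HC scale (n - 1))" for n unfolding HC_def by (rule homology_kmod[OF H.D])
    show "connes_iso scale n \<in> linear_maps (HC scale (n - 1)) (X_les (ses_les (CHH_cx scale) (cyclic_cx scale) (pi2 scale)) n)" for n
      using connes_iso_linear[of n] by (simp add: ses_les_def ker_pi2_cx_def)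
    show "bij_betw (connes_iso scale n) (carrier (HC scale (n - 1)))
        (carrier (X_les (ses_les (CHH_cx scale) (cyclic_cx scale) (pi2 scale)) n))" for n
      using connes_iso_bij[of n] by (simp add: ses_les_def ker_pi2_cx_def)
  qed
qed

lemma connes_is_les: "is_les (connes_les scale)"
  unfolding connes_les_conv by (rule les_transport.is_les_transport_les[OF connes_transport])

lemma leibniz_connes_les_map:
  "is_les_map (leibniz_les scale) (connes_les scale) (alpha_star scale) (phi_star scale) (theta_star scale)"
proof -
  have "is_les_map (leibniz_les scale) (connes_les scale)
      (\<lambda>n. inv_into (carrier (HC scale (n - 1))) (connes_iso scale n)
        \<circ> hom_map (ker_cx (CHH_cx scale) (cyclic_cx scale) (pi2 scale)) n (phi scale n))
      (\<lambda>n. hom_map (CHH_cx scale) n (phi scale n)) (\<lambda>n. hom_map (cyclic_cx scale) n (theta scale n))"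
    unfolding leibniz_les_conv connes_les_conv
    by (rule les_transport.is_les_map_into_transport[OF connes_transport short_exact_map.is_les_map_ses_les[OF theta_square]])
  then show ?thesis
    by (simp add: alpha_star_def[abs_def] phi_star_def[abs_def] theta_star_def[abs_def] connes_iso_inv_def
        ker_pi2_cx_def)
qed

end

context algebra_map
begin

lemma leibniz_shift_map:
  "short_exact_map (shift_cx 1 (CL_cx sc)) (shift_cx 1 (Lie_cx sc)) (\<lambda>n. pi1 sc (n + 1))
    (shift_cx 1 (CL_cx sc')) (shift_cx 1 (Lie_cx sc')) (\<lambda>n. pi1 sc' (n + 1)) (\<lambda>n. F (n + 1)) (\<lambda>n. FQ (n + 1))"
  by (rule short_exact_map_shift_cx[OF leibniz_map])

lemma Hrel_fun_conv:
  "Hrel_fun sc' f (n - 1) = hom_map (ker_cx (shift_cx 1 (CL_cx sc')) (shift_cx 1 (Lie_cx sc')) (\<lambda>n. pi1 sc' (n + 1))) n (F (n + 1))"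
  by (simp add: Hrel_fun_def rel_cx_def ker_cx_shift_cx hom_map_shift_cx add.commute)

lemma HL_fun_conv: "HL_fun sc' f (n + 1) = hom_map (shift_cx 1 (CL_cx sc')) n (F (n + 1))"
  by (simp add: HL_fun_def hom_map_shift_cx)

lemma HLie_fun_conv: "HLie_fun sc' f (n + 1) = hom_map (shift_cx 1 (Lie_cx sc')) n (FQ (n + 1))"
  by (simp add: HLie_fun_def hom_map_shift_cx)

lemma leibniz_les_natural:
  "is_les_map (leibniz_les sc) (leibniz_les sc')
    (\<lambda>n. Hrel_fun sc' f (n - 1)) (\<lambda>n. HL_fun sc' f (n + 1)) (\<lambda>n. HLie_fun sc' f (n + 1))"
  unfolding leibniz_les_conv Hrel_fun_conv HL_fun_conv HLie_fun_conv
  by (rule short_exact_map.is_les_map_ses_les[OF leibniz_shift_map])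

interpretation H: short_exact_map "CHH_cx sc" "cyclic_cx sc" "pi2 sc" "CHH_cx sc'" "cyclic_cx sc'" "pi2 sc'" F1 F1Q
  by (rule hochschild_map)

lemma connes_op_natural:
  assumes z: "z \<in> carrier (chain (cyclic_cx sc) (n - 1))"
  shows "connes_op sc' n (F1Q (n - 1) z) = F1 n (connes_op sc n z)"
proof (cases "n \<le> 0")
  case True
  then show ?thesis using tensor_fun_zero[of 1] by (simp add: connes_op_def)
next
  case False
  then have "n = int (Suc (nat (n - 1)))" by simp
  then obtain k where n: "n = int (Suc k)" by blast
  obtain x where x: "x \<in> words (Suc k)" "z = A.cyc_class (Suc k) x"
    using z A.cyc_class_cases unfolding n int_Suc_minus A.cyclic_cx_nat by blast
  have "F1Q (int k) (pi2 sc (int k) (A.cls (Suc k) x)) = pi2 sc' (int k) (F1 (int k) (A.cls (Suc k) x))"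
    by (rule H.square) (use x A.tensor_class_closed in \<open>simp add: A.CHH_cx_nat\<close>)
  then have "F1Q (int k) (A.cyc_class (Suc k) x) = B.cyc_class (Suc k) (word_map f x)"
    using x by (simp add: A.pi2_class B.pi2_class tensor_fun_class)
  moreover have "word_map f (A.connes_word (Suc k) x) = B.connes_word (Suc k) (word_map f x)"
    by (simp add: A.connes_word_def B.connes_word_def word_map_cyc word_map_cons word_map_nrm f_one)
  ultimately show ?thesis
    unfolding n int_Suc_minus x(2) A.connes_op_class[OF x(1)]
    using x B.connes_op_class[OF word_map_words[OF x(1)]] tensor_fun_class[OF A.connes_word_words[OF x(1)]]
    by (simp add: nat_add_distrib)
qed

lemma connes_iso_natural:
  assumes z: "z \<in> carrier (HC sc (n - 1))"
  shows "connes_iso sc' n (HC_fun sc' f (n - 1) z) = hom_map (ker_pi2_cx sc') n (F1 n) (connes_iso sc n z)"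
  unfolding connes_iso_def HC_fun_def
  by (rule hom_map_square[OF H.S.D H.S'.D A.ker_pi2_complex B.ker_pi2_complex H.g_compatible B.connes_compatible
      A.connes_compatible H.ker_compatible[folded ker_pi2_cx_def] connes_op_natural z[unfolded HC_def]])

lemma HC_fun_linear: "HC_fun sc' f n \<in> linear_maps (HC sc n) (HC sc' n)"
  unfolding HC_fun_def HC_def by (rule hom_map_linear[OF H.S.D H.S'.D H.g_compatible])

lemma connes_les_natural:
  "is_les_map (connes_les sc) (connes_les sc') (\<lambda>n. HC_fun sc' f (n - 1)) (HH_fun sc' f) (HC_fun sc' f)"
proof -
  have "is_les_map (ses_les (CHH_cx sc) (cyclic_cx sc) (pi2 sc)) (ses_les (CHH_cx sc') (cyclic_cx sc') (pi2 sc'))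
      (\<lambda>n. hom_map (ker_pi2_cx sc') n (F1 n)) (HH_fun sc' f) (HC_fun sc' f)"
    using H.is_les_map_ses_les by (simp add: HH_fun_def[abs_def] HC_fun_def[abs_def] ker_pi2_cx_def)
  from is_les_map_transport[OF A.connes_transport B.connes_transport this HC_fun_linear connes_iso_natural]
  show ?thesis unfolding connes_les_conv .
qed

interpretation L: short_exact_map "shift_cx 1 (CL_cx sc)" "shift_cx 1 (Lie_cx sc)" "\<lambda>n. pi1 sc (n + 1)"
  "shift_cx 1 (CL_cx sc')" "shift_cx 1 (Lie_cx sc')" "\<lambda>n. pi1 sc' (n + 1)" "\<lambda>n. F (n + 1)" "\<lambda>n. FQ (n + 1)"
  by (rule leibniz_shift_map)

interpretation P: short_exact_map "shift_cx 1 (CL_cx sc)" "shift_cx 1 (Lie_cx sc)" "\<lambda>n. pi1 sc (n + 1)"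
  "CHH_cx sc" "cyclic_cx sc" "pi2 sc" "phi sc" "theta sc"
  by (rule A.theta_square)

interpretation P': short_exact_map "shift_cx 1 (CL_cx sc')" "shift_cx 1 (Lie_cx sc')" "\<lambda>n. pi1 sc' (n + 1)"
  "CHH_cx sc'" "cyclic_cx sc'" "pi2 sc'" "phi sc'" "theta sc'"
  by (rule B.theta_square)

lemma phi_natural:
  assumes z: "z \<in> carrier (chain (shift_cx 1 (CL_cx sc)) n)"
  shows "phi sc' n (F (n + 1) z) = F1 n (phi sc n z)"
proof (cases "n < 0")
  case True
  then show ?thesis using tensor_fun_zero[of 1] by (simp add: phi_def A.CHH_cx_negative B.CHH_cx_negative)
next
  case False
  then obtain k where n: "n = int k" using zero_le_imp_eq_int[of n] by auto
  have deg: "n + 1 = int (Suc k)" "nat (n + 1) = Suc k" "nat n = k" using n by simp_all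
  have "z \<in> carrier (A.T (Suc k))" using z unfolding shift_cx_simps deg(1) A.CL_cx_nat .
  then obtain x where "x \<in> words (Suc k)" "z = A.cls (Suc k) x" by (rule A.tensor_cases)
  then show ?thesis
    using False unfolding phi_def deg
    by (simp add: nat_add_distrib A.tensor_map_antisym_class B.tensor_map_antisym_class tensor_fun_class antisym_words word_map_words
        word_map_antisymmetrize)
qed

lemma theta_natural:
  assumes z: "z \<in> carrier (chain (shift_cx 1 (Lie_cx sc)) n)"
  shows "theta sc' n (FQ (n + 1) z) = F1Q n (theta sc n z)"
proof -
  obtain x where x: "x \<in> carrier (chain (shift_cx 1 (CL_cx sc)) n)" "z = pi1 sc (n + 1) x"
    using z L.S.surj[of n] by auto
  have "theta sc' n (FQ (n + 1) z) = pi2 sc' n (phi sc' n (F (n + 1) x))"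
    unfolding x(2) L.square[OF x(1)]
    by (rule P'.square[OF linear_maps_closed[OF chain_map_linear[OF L.f] x(1)]])
  also have "\<dots> = F1Q n (pi2 sc n (phi sc n x))"
    unfolding phi_natural[OF x(1)]
    by (rule H.square[OF linear_maps_closed[OF chain_map_linear[OF P.f] x(1)], symmetric])
  finally show ?thesis unfolding x(2) P.square[OF x(1)] .
qed

lemma phi_star_natural:
  assumes "x \<in> carrier (HL sc (n + 1))"
  shows "phi_star sc' n (HL_fun sc' f (n + 1) x) = HH_fun sc' f n (phi_star sc n x)"
  unfolding phi_star_def HL_fun_conv HH_fun_def
  by (rule hom_map_square[OF L.S.C L.S'.C H.S.C H.S'.C L.f_compatible P'.f_compatible P.f_compatible H.f_compatible phi_natural])
    (use assms in \<open>simp_all add: homology_shift_cx HL_def\<close>)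

lemma theta_star_natural:
  assumes "x \<in> carrier (HLie sc (n + 1))"
  shows "theta_star sc' n (HLie_fun sc' f (n + 1) x) = HC_fun sc' f n (theta_star sc n x)"
  unfolding theta_star_def HLie_fun_conv HC_fun_def
  by (rule hom_map_square[OF L.S.D L.S'.D H.S.D H.S'.D L.g_compatible P'.g_compatible P.g_compatible H.g_compatible theta_natural])
    (use assms in \<open>simp_all add: homology_shift_cx HLie_def\<close>)

lemma alpha_star_natural:
  assumes x: "x \<in> carrier (Hrel sc (n - 1))"
  shows "alpha_star sc' n (Hrel_fun sc' f (n - 1) x) = HC_fun sc' f (n - 1) (alpha_star sc n x)"
proof -
  have x': "x \<in> carrier (homology L.S.K n)"
    using x by (simp add: Hrel_def rel_cx_def homology_shift_cx ker_cx_shift_cx add.commute)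
  have K: "carrier (chain L.S.K n) \<subseteq> carrier (chain (shift_cx 1 (CL_cx sc)) n)"
    by (auto simp: a_kernel_def')
  have "hom_map (ker_pi2_cx sc') n (phi sc' n) (Hrel_fun sc' f (n - 1) x)
      = hom_map (ker_pi2_cx sc') n (F1 n) (hom_map (ker_pi2_cx sc) n (phi sc n) x)"
    unfolding Hrel_fun_conv ker_pi2_cx_def
    by (rule hom_map_square[OF L.S.ker_complex L.S'.ker_complex H.S.ker_complex H.S'.ker_complex L.ker_compatible
        P'.ker_compatible P.ker_compatible H.ker_compatible phi_natural x']) (use K in blast)
  moreover have "hom_map (ker_pi2_cx sc) n (phi sc n) x \<in> carrier (homology (ker_pi2_cx sc) n)"
    using linear_maps_closed[OF hom_map_linear[OF L.S.ker_complex H.S.ker_complex P.ker_compatible] x']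
    by (simp add: ker_pi2_cx_def)
  ultimately show ?thesis
    using inv_into_square[where \<beta> = "HC_fun sc' f (n - 1)" and \<alpha> = "hom_map (ker_pi2_cx sc') n (F1 n)",
        OF A.connes_iso_bij[of n] B.connes_iso_bij[of n] linear_maps_closed[OF HC_fun_linear] connes_iso_natural]
    by (simp add: alpha_star_def connes_iso_inv_def)
qed

end

theorem proposition2p1:
  fixes scale :: "'k::field_char_0 \<Rightarrow> 'a::{ring,monoid_mult} \<Rightarrow> 'a"
  assumes A: "unital_algebra scale"
  shows
    "(\<forall>n. connes_iso scale n \<in> linear_maps (HC scale (n - 1)) (homology (ker_pi2_cx scale) n)
        \<and> bij_betw (connes_iso scale n)
            (carrier (HC scale (n - 1))) (carrier (homology (ker_pi2_cx scale) n)))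
     \<and> is_les (leibniz_les scale)
     \<and> is_les (connes_les scale)
     \<and> is_les_map (leibniz_les scale) (connes_les scale)
         (alpha_star scale) (phi_star scale) (theta_star scale)
     \<and> (\<forall>(scale' :: 'k \<Rightarrow> 'b::{ring,monoid_mult} \<Rightarrow> 'b) (f :: 'a \<Rightarrow> 'b).
          unital_algebra scale' \<longrightarrow> unital_algebra_hom scale scale' f \<longrightarrow>
            is_les_map (leibniz_les scale) (leibniz_les scale')
              (\<lambda>n. Hrel_fun scale' f (n - 1)) (\<lambda>n. HL_fun scale' f (n + 1))
              (\<lambda>n. HLie_fun scale' f (n + 1))
          \<and> is_les_map (connes_les scale) (connes_les scale')
              (\<lambda>n. HC_fun scale' f (n - 1)) (HH_fun scale' f) (HC_fun scale' f)
          \<and> (\<forall>n. (\<forall>x\<in>carrier (Hrel scale (n - 1)).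
                    alpha_star scale' n (Hrel_fun scale' f (n - 1) x)
                      = HC_fun scale' f (n - 1) (alpha_star scale n x))
                \<and> (\<forall>x\<in>carrier (HL scale (n + 1)).
                    phi_star scale' n (HL_fun scale' f (n + 1) x)
                      = HH_fun scale' f n (phi_star scale n x))
                \<and> (\<forall>x\<in>carrier (HLie scale (n + 1)).
                    theta_star scale' n (HLie_fun scale' f (n + 1) x)
                      = HC_fun scale' f n (theta_star scale n x))))"
proof -
  interpret A: unital_algebra_char_0 scale by (rule unital_algebra_char_0.intro[OF A])
  have natural: "is_les_map (leibniz_les scale) (leibniz_les scale')
              (\<lambda>n. Hrel_fun scale' f (n - 1)) (\<lambda>n. HL_fun scale' f (n + 1))
              (\<lambda>n. HLie_fun scale' f (n + 1))
          \<and> is_les_map (connes_les scale) (connes_les scale')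
              (\<lambda>n. HC_fun scale' f (n - 1)) (HH_fun scale' f) (HC_fun scale' f)
          \<and> (\<forall>n. (\<forall>x\<in>carrier (Hrel scale (n - 1)).
                    alpha_star scale' n (Hrel_fun scale' f (n - 1) x)
                      = HC_fun scale' f (n - 1) (alpha_star scale n x))
                \<and> (\<forall>x\<in>carrier (HL scale (n + 1)).
                    phi_star scale' n (HL_fun scale' f (n + 1) x)
                      = HH_fun scale' f n (phi_star scale n x))
                \<and> (\<forall>x\<in>carrier (HLie scale (n + 1)).
                    theta_star scale' n (HLie_fun scale' f (n + 1) x)
                      = HC_fun scale' f n (theta_star scale n x)))"
    if B: "unital_algebra scale'" and f: "unital_algebra_hom scale scale' f"
    for scale' :: "'k \<Rightarrow> 'b \<Rightarrow> 'b" and f :: "'a \<Rightarrow> 'b"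
  proof -
    interpret algebra_map scale scale' f
      by (intro algebra_map.intro algebra_map_axioms.intro unital_algebra_char_0.intro A B f)
    show ?thesis
      using leibniz_les_natural connes_les_natural alpha_star_natural phi_star_natural theta_star_natural by blast
  qed
  show ?thesis
    using A.connes_iso_linear A.connes_iso_bij A.leibniz_is_les A.connes_is_les A.leibniz_connes_les_map natural
    by blast
qed

end
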